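(* $\mathcal{L}(FCFL)\subset\mathcal{L}(FE0L)\subset\mathcal{L}(FET0L)\subset\mathcal{L}(FCSL)$.
   Context: A fuzzy $0L$ system is $FG=(\Sigma,\widetilde{h},\omega,J,f)$, where $\Sigma$ is a finite alphabet, $\omega\in\Sigma^*$ is the axiom, $h$ is a finite substitution on $\Sigma$ viewed as a finite set of productions $a\rightarrow u$ ($a\in\Sigma$, $u\in\Sigma^*$), each production carries a label $r$ from the label set $J$, $f:J\rightarrow[0,1]$ gives the grade of application of each production, and $\widetilde{h}=\{(r)\,a\rightarrow u\ f(r)\}$ is the corresponding set of fuzzy productions. A fuzzy derivation of $x_m$ from $\omega$ is a sequence $\omega=x_0,x_1,\dots,x_m$ in which $x_{i+1}$ is obtained from $x_i$ by rewriting every letter of $x_i$ simultaneously by some labelled production. The grade of a string is $f_{FG}(\omega)=\max_{r\in J}f(r)$ and, for $x\neq\omega$, $f_{FG}(x)=\max\{\min f(r_{ij})\}$, where the minimum is over all productions $r_{ij}$ used in a fuzzy derivation of $x$ from $\omega$ and the maximum is over all such derivations. A fuzzy $E0L$ system is $FG=(\Sigma,\widetilde{h},\omega,J,f,\Delta)$ with $(\Sigma,\widetilde{h},\omega,J,f)$ a fuzzy $0L$ system and $\Delta\subseteq\Sigma$; its fuzzy language is $\{(f_{FG}(x),x)\mid x\in\bigcup_{i\ge0}h^i(\omega)\cap\Delta^*\}$. A fuzzy $T0L$ system $(\Sigma,\widetilde{H},\omega,J,f)$ has a nonempty finite set $\widetilde{H}=\{\widetilde{h}_1,\dots,\widetilde{h}_k\}$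 of fuzzy substitutions (tables) with pairwise disjoint label sets $J_i$, $J=\bigcup_i J_i$, $f_i=f|_{J_i}$, each $(\Sigma,\widetilde{h}_i,\omega,J_i,f_i)$ being a fuzzy $0L$ system. In a derivation step one table is chosen and all letters are rewritten by that table; the grade of a string is defined analogously (max over derivations of the min of grades of productions used). The underlying language is $\{\omega\}\cup\{x\in h_1\cdots h_m(\omega)\}$ for $h_1,\dots,h_m$ the substitutions of tables in $\widetilde{H}$. A fuzzy $ET0L$ system additionally has a terminal alphabet $\Delta\subseteq\Sigma$ and its fuzzy language consists of the pairs $(f_{FG}(x),x)$ with $x$ in the underlying language of the fuzzy $T0L$ system and $x\in\Delta^*$. $\mathcal{L}(FE0L)$ and $\mathcal{L}(FET0L)$ denote the classes of fuzzy languages generated by fuzzy $E0L$, respectively fuzzy $ET0L$, systems. $\mathcal{L}(FCFL)$ and $\mathcal{L}(FCSL)$ denote the classes of fuzzy context-free, respectively context-sensitive, languages generated by fuzzy grammars in the sense of Lee and Zadeh: grammars $(V_N,V_T,P,S,J,f)$ whose productions are labelled by $J$ with grades $f:J\rightarrow[0,1]$, the grade of a terminal string being the maximum over its derivations of the minimum grade of the productions used. *)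

theory Defs
  imports Complex_Main "HOL-Library.Infinite_Typeclass"
begin

text \<open>
  Letters are drawn from a fixed type, which is assumed infinite only in the theorem, so that
  auxiliary symbols are always available; all alphabets are finite subsets of it.
  A fuzzy language is a set of pairs (grade, string). Only generated strings occur in such a pair:
  a string generated with grade 0 belongs to the language (with grade 0), a string that is not
  generated does not. This convention is the same for L systems and for grammars.
\<close>

type_synonym 'a fuzzy_language = "(real \<times> 'a list) set"

text \<open>
  Labelled productions are pairs of a label and a production. A label names one production;
  one production may occur under several labels.
\<close>

definition graded_labelling :: "('r \<times> 'p) set \<Rightarrow> 'r set \<Rightarrow> ('r \<Rightarrow> real) \<Rightarrow> bool" where
  "graded_labelling P J f \<longleftrightarrow>
     finite P \<and> inj_on fst P \<and> J = fst ` P \<and> (\<forall>r\<in>J. 0 \<le> f r \<and> f r \<le> 1)"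


section \<open>Fuzzy L systems\<close>

type_synonym ('r, 'a) table = "('r \<times> 'a \<times> 'a list) set"

text \<open>
  The alphabet is nonempty, which makes the label set nonempty and so the grade of the axiom
  well defined; each letter has at least one production.
\<close>

definition fuzzy_0L ::
  "'a set \<Rightarrow> ('r, 'a) table \<Rightarrow> 'a list \<Rightarrow> 'r set \<Rightarrow> ('r \<Rightarrow> real) \<Rightarrow> bool" where
  "fuzzy_0L \<Sigma> h \<omega> J f \<longleftrightarrow>
     finite \<Sigma> \<and> \<Sigma> \<noteq> {} \<and> \<omega> \<in> lists \<Sigma> \<and>
     h \<subseteq> UNIV \<times> \<Sigma> \<times> lists \<Sigma> \<and> (\<forall>a\<in>\<Sigma>. \<exists>r u. (r, a, u) \<in> h) \<and>
     graded_labelling h J f"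

definition fuzzy_E0L ::
  "'a set \<Rightarrow> ('r, 'a) table \<Rightarrow> 'a list \<Rightarrow> 'r set \<Rightarrow> ('r \<Rightarrow> real) \<Rightarrow> 'a set \<Rightarrow> bool" where
  "fuzzy_E0L \<Sigma> h \<omega> J f \<Delta> \<longleftrightarrow> fuzzy_0L \<Sigma> h \<omega> J f \<and> \<Delta> \<subseteq> \<Sigma>"

definition fuzzy_T0L ::
  "'a set \<Rightarrow> ('r, 'a) table set \<Rightarrow> 'a list \<Rightarrow> 'r set \<Rightarrow> ('r \<Rightarrow> real) \<Rightarrow> bool" where
  "fuzzy_T0L \<Sigma> H \<omega> J f \<longleftrightarrow>
     finite H \<and> H \<noteq> {} \<and>
     (\<forall>h\<in>H. fuzzy_0L \<Sigma> h \<omega> (fst ` h) f) \<and>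
     (\<forall>h\<in>H. \<forall>h'\<in>H. h \<noteq> h' \<longrightarrow> fst ` h \<inter> fst ` h' = {}) \<and>
     J = (\<Union>h\<in>H. fst ` h)"

definition fuzzy_ET0L ::
  "'a set \<Rightarrow> ('r, 'a) table set \<Rightarrow> 'a list \<Rightarrow> 'r set \<Rightarrow> ('r \<Rightarrow> real) \<Rightarrow> 'a set \<Rightarrow> bool" where
  "fuzzy_ET0L \<Sigma> H \<omega> J f \<Delta> \<longleftrightarrow> fuzzy_T0L \<Sigma> H \<omega> J f \<and> \<Delta> \<subseteq> \<Sigma>"

definition subst_letter :: "('r, 'a) table \<Rightarrow> 'a \<Rightarrow> 'a list set" where
  "subst_letter h a = {u. \<exists>r. (r, a, u) \<in> h}"

primrec subst_word :: "('r, 'a) table \<Rightarrow> 'a list \<Rightarrow> 'a list set" where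
  "subst_word h [] = {[]}"
| "subst_word h (a # w) = {u @ v | u v. u \<in> subst_letter h a \<and> v \<in> subst_word h w}"

definition subst_lang :: "('r, 'a) table \<Rightarrow> 'a list set \<Rightarrow> 'a list set" where
  "subst_lang h L = (\<Union>w\<in>L. subst_word h w)"

definition language_0L :: "('r, 'a) table \<Rightarrow> 'a list \<Rightarrow> 'a list set" where
  "language_0L h \<omega> = (\<Union>i. (subst_lang h ^^ i) {\<omega>})"

definition language_T0L :: "('r, 'a) table set \<Rightarrow> 'a list \<Rightarrow> 'a list set" where
  "language_T0L H \<omega> = {\<omega>} \<union> (\<Union>hs\<in>lists H. foldr subst_lang hs {\<omega>})"

text \<open>
  \<open>L_derivation H \<omega> rs x\<close>: there is a fuzzy derivation of \<open>x\<close> from \<open>\<omega>\<close> in which \<open>rs\<close> lists the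
  labels of all productions used. In a step, \<open>ps\<close> gives the labelled production chosen for each
  letter occurrence, all from one table.
\<close>

inductive L_derivation ::
  "('r, 'a) table set \<Rightarrow> 'a list \<Rightarrow> 'r list \<Rightarrow> 'a list \<Rightarrow> bool"
  for H :: "('r, 'a) table set" and \<omega> :: "'a list" where
  start: "L_derivation H \<omega> [] \<omega>"
| step: "L_derivation H \<omega> rs x \<Longrightarrow> h \<in> H \<Longrightarrow> set ps \<subseteq> h \<Longrightarrow>
         x = map (\<lambda>(r, a, u). a) ps \<Longrightarrow> y = concat (map (\<lambda>(r, a, u). u) ps) \<Longrightarrow>
         L_derivation H \<omega> (rs @ map fst ps) y"

text \<open>
  The set under the outer \<open>Max\<close> is contained in \<open>f ` J\<close>, hence finite, and for a generated
  \<open>x \<noteq> \<omega>\<close> no derivation has an empty list of labels.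
\<close>

definition grade_T0L ::
  "('r, 'a) table set \<Rightarrow> 'a list \<Rightarrow> 'r set \<Rightarrow> ('r \<Rightarrow> real) \<Rightarrow> 'a list \<Rightarrow> real" where
  "grade_T0L H \<omega> J f x =
     (if x = \<omega> then Max (f ` J) else Max {Min (f ` set rs) | rs. L_derivation H \<omega> rs x})"

definition grade_0L ::
  "('r, 'a) table \<Rightarrow> 'a list \<Rightarrow> 'r set \<Rightarrow> ('r \<Rightarrow> real) \<Rightarrow> 'a list \<Rightarrow> real" where
  "grade_0L h = grade_T0L {h}"

definition fuzzy_language_E0L ::
  "('r, 'a) table \<Rightarrow> 'a list \<Rightarrow> 'r set \<Rightarrow> ('r \<Rightarrow> real) \<Rightarrow> 'a set \<Rightarrow> 'a fuzzy_language" where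
  "fuzzy_language_E0L h \<omega> J f \<Delta> =
     {(grade_0L h \<omega> J f x, x) | x. x \<in> language_0L h \<omega> \<inter> lists \<Delta>}"

definition fuzzy_language_ET0L ::
  "('r, 'a) table set \<Rightarrow> 'a list \<Rightarrow> 'r set \<Rightarrow> ('r \<Rightarrow> real) \<Rightarrow> 'a set \<Rightarrow> 'a fuzzy_language" where
  "fuzzy_language_ET0L H \<omega> J f \<Delta> =
     {(grade_T0L H \<omega> J f x, x) | x. x \<in> language_T0L H \<omega> \<inter> lists \<Delta>}"


section \<open>Fuzzy grammars\<close>

type_synonym ('r, 'a) rules = "('r \<times> 'a list \<times> 'a list) set"

definition fuzzy_grammar ::
  "'a set \<Rightarrow> 'a set \<Rightarrow> ('r, 'a) rules \<Rightarrow> 'a \<Rightarrow> 'r set \<Rightarrow> ('r \<Rightarrow> real) \<Rightarrow> bool" where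
  "fuzzy_grammar VN VT P S J f \<longleftrightarrow>
     finite VN \<and> finite VT \<and> VN \<inter> VT = {} \<and> S \<in> VN \<and>
     P \<subseteq> UNIV \<times> lists (VN \<union> VT) \<times> lists (VN \<union> VT) \<and> graded_labelling P J f"

text \<open>Erasing productions are permitted in context-free grammars.\<close>

definition fuzzy_CF_grammar ::
  "'a set \<Rightarrow> 'a set \<Rightarrow> ('r, 'a) rules \<Rightarrow> 'a \<Rightarrow> 'r set \<Rightarrow> ('r \<Rightarrow> real) \<Rightarrow> bool" where
  "fuzzy_CF_grammar VN VT P S J f \<longleftrightarrow>
     fuzzy_grammar VN VT P S J f \<and> (\<forall>(r, \<alpha>, \<beta>)\<in>P. \<exists>A\<in>VN. \<alpha> = [A])"

text \<open>
  As usual, the production from \<open>S\<close> to the empty word is admitted provided that \<open>S\<close> occurs in no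
  right-hand side.
\<close>

definition fuzzy_CS_grammar ::
  "'a set \<Rightarrow> 'a set \<Rightarrow> ('r, 'a) rules \<Rightarrow> 'a \<Rightarrow> 'r set \<Rightarrow> ('r \<Rightarrow> real) \<Rightarrow> bool" where
  "fuzzy_CS_grammar VN VT P S J f \<longleftrightarrow>
     fuzzy_grammar VN VT P S J f \<and>
     (\<forall>(r, \<alpha>, \<beta>)\<in>P.
        (\<exists>u v \<gamma>. \<exists>A\<in>VN. \<gamma> \<noteq> [] \<and> \<alpha> = u @ [A] @ v \<and> \<beta> = u @ \<gamma> @ v) \<or>
        (\<alpha> = [S] \<and> \<beta> = [] \<and> (\<forall>(r', \<alpha>', \<beta>')\<in>P. S \<notin> set \<beta>')))"

inductive G_derivation :: "('r, 'a) rules \<Rightarrow> 'a \<Rightarrow> 'r list \<Rightarrow> 'a list \<Rightarrow> bool"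
  for P :: "('r, 'a) rules" and S :: 'a where
  start: "G_derivation P S [] [S]"
| step: "G_derivation P S rs (u @ \<alpha> @ v) \<Longrightarrow> (r, \<alpha>, \<beta>) \<in> P \<Longrightarrow>
         G_derivation P S (rs @ [r]) (u @ \<beta> @ v)"

definition grade_G :: "('r, 'a) rules \<Rightarrow> 'a \<Rightarrow> ('r \<Rightarrow> real) \<Rightarrow> 'a list \<Rightarrow> real" where
  "grade_G P S f x = Max {Min (f ` set rs) | rs. G_derivation P S rs x}"

definition fuzzy_language_G ::
  "'a set \<Rightarrow> ('r, 'a) rules \<Rightarrow> 'a \<Rightarrow> ('r \<Rightarrow> real) \<Rightarrow> 'a fuzzy_language" where
  "fuzzy_language_G VT P S f =
     {(grade_G P S f x, x) | x. x \<in> lists VT \<and> (\<exists>rs. G_derivation P S rs x)}"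


section \<open>The classes of fuzzy languages\<close>

text \<open>Label sets are finite, so labels can be taken to be natural numbers.\<close>

definition FCFL :: "'a fuzzy_language set" where
  "FCFL = {fuzzy_language_G VT P S f | VN VT P S (J :: nat set) f. fuzzy_CF_grammar VN VT P S J f}"

definition FCSL :: "'a fuzzy_language set" where
  "FCSL = {fuzzy_language_G VT P S f | VN VT P S (J :: nat set) f. fuzzy_CS_grammar VN VT P S J f}"

definition FE0L :: "'a fuzzy_language set" where
  "FE0L = {fuzzy_language_E0L h \<omega> J f \<Delta> | \<Sigma> h \<omega> (J :: nat set) f \<Delta>. fuzzy_E0L \<Sigma> h \<omega> J f \<Delta>}"

definition FET0L :: "'a fuzzy_language set" where
  "FET0L = {fuzzy_language_ET0L H \<omega> J f \<Delta> | \<Sigma> H \<omega> (J :: nat set) f \<Delta>. fuzzy_ET0L \<Sigma> H \<omega> J f \<Delta>}"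

end

theory Submission
  imports Defs "HOL-Library.Multiset"
begin

text \<open>
  A context-free grammar becomes an E0L system by adding the productions \<open>a \<rightarrow> a\<close> with grade 1. An
  ET0L system is first made propagating: every letter carries the set of the letters that are going
  to vanish, so that only surviving occurrences need to be written. A propagating system is an
  iterated nonerasing transducer, which a context-sensitive grammar simulates by a head that sweeps
  over the word. Grades are handled by thresholds: the start production chooses a grade \<open>c\<close>, and
  afterwards only productions of grade at least \<open>c\<close> are simulated, with grade 1.

  Strictness is witnessed by languages of grade 1. The lengths of the words of a context-free
  language have bounded gaps, which excludes the words \<open>a\<^sup>N\<close> with \<open>N = 2\<^sup>n\<close>. The lengths in an ET0L
  language have gaps of bounded ratio, which excludes a context-sensitive language with lengths
  growing like a tower of exponentials. Finally \<open>w c w c w\<close> with \<open>w = a\<^sup>i b\<^sup>j\<close> is not E0L: up to a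
  bounded amount of information, the middle factor \<open>w\<close> is determined by the number of derivation
  steps alone, and increasing this number by a suitable period can only increase the numbers of
  occurrences of \<open>a\<close> and \<open>b\<close>, whereas the pairs \<open>(i, j)\<close> contain arbitrarily large antichains.
\<close>


text \<open>A word has a derivation with minimum at least \<open>c\<close> exactly if it is
  derivable by productions of grade at least \<open>c\<close>; so its grade is the largest such
  \<open>c\<close> among the finitely many values of \<open>f\<close>. The axiom fits in: derivable
  in zero steps under every threshold, it gets the largest value, which is the grade that the
  definition assigns to it. Sets of vanishing letters suffice because a step rewrites all letters by
  the same table: whether a letter can vanish depends only on the tables still to come, not on the
  occurrence. The strictness proofs look only at the generated words. In w c w c w, a factor that
  leaves a c outside is fixed by its context, which contains a complete outer copy of w. A letter
  that produces both c leads down to a word in which they separate, since one letter cannot be a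
  word with two c. What is produced there has no freedom left, yet still contains the middle w. With
  a single separator the descent could end in the letter c itself and yield nothing.\<close>

section \<open>Derivations in L systems\<close>

primrec ders :: "('r, 'a) table list \<Rightarrow> 'a list \<Rightarrow> 'a list \<Rightarrow> bool" where
  "ders [] w x \<longleftrightarrow> w = x"
| "ders (h # hs) w x \<longleftrightarrow> (\<exists>y\<in>subst_word h w. ders hs y x)"

lemma subst_word_append:
  "y \<in> subst_word h (u @ v) \<longleftrightarrow>
     (\<exists>y1 y2. y = y1 @ y2 \<and> y1 \<in> subst_word h u \<and> y2 \<in> subst_word h v)"
proof (induction u arbitrary: y)
  case (Cons a u)
  show ?case (is "?l \<longleftrightarrow> ?r")
  proof
    assume ?l
    then obtain p q where "y = p @ q" "p \<in> subst_letter h a" "q \<in> subst_word h (u @ v)" by auto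
    moreover from this(3) obtain q1 q2 where "q = q1 @ q2" "q1 \<in> subst_word h u" "q2 \<in> subst_word h v"
      using Cons by blast
    ultimately have "y = (p @ q1) @ q2" "p @ q1 \<in> subst_word h (a # u)" "q2 \<in> subst_word h v" by auto
    then show ?r by blast
  next
    assume ?r
    then obtain p q y2 where "y = (p @ q) @ y2" "p \<in> subst_letter h a" "q \<in> subst_word h u"
      "y2 \<in> subst_word h v" by auto
    moreover from this have "q @ y2 \<in> subst_word h (u @ v)" using Cons by blast
    ultimately show ?l by auto
  qed
qed auto

lemma subst_word_single [simp]: "subst_word h [a] = subst_letter h a"
  by auto

lemma ders_Nil [simp]: "ders hs [] x \<longleftrightarrow> x = []"
  by (induction hs) auto

lemma ders_append_word:
  "ders hs (u @ v) x \<longleftrightarrow> (\<exists>x1 x2. x = x1 @ x2 \<and> ders hs u x1 \<and> ders hs v x2)"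
proof (induction hs arbitrary: u v)
  case (Cons h hs)
  show ?case (is "?l \<longleftrightarrow> ?r")
  proof
    assume ?l
    then obtain y1 y2 where "y1 \<in> subst_word h u" "y2 \<in> subst_word h v" "ders hs (y1 @ y2) x"
      by (auto simp: subst_word_append)
    then show ?r using Cons[of y1 y2] by auto
  next
    assume ?r
    then obtain x1 x2 y1 y2 where "x = x1 @ x2" "y1 \<in> subst_word h u" "ders hs y1 x1"
      "y2 \<in> subst_word h v" "ders hs y2 x2" by auto
    moreover from this have "ders hs (y1 @ y2) x" using Cons[of y1 y2] by blast
    moreover from calculation have "y1 @ y2 \<in> subst_word h (u @ v)"
      unfolding subst_word_append by blast
    ultimately show ?l unfolding ders.simps by blast
  qed
qed auto

lemma ders_append:
  "ders (hs @ hs') w x \<longleftrightarrow> (\<exists>y. ders hs w y \<and> ders hs' y x)"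
  by (induction hs arbitrary: w) auto

text \<open>The table sequence is fixed, so the letters of a word evolve independently of each
  other. All later letterwise factorisations of derivations rest on this.\<close>

lemma ders_list_all2:
  "ders hs u x \<longleftrightarrow> (\<exists>zs. x = concat zs \<and> list_all2 (\<lambda>a. ders hs [a]) u zs)"
proof (induction u arbitrary: x)
  case (Cons a u)
  have "ders hs (a # u) x \<longleftrightarrow> (\<exists>x1 x2. x = x1 @ x2 \<and> ders hs [a] x1 \<and> ders hs u x2)"
    using ders_append_word[of hs "[a]" u x] by simp
  also have "\<dots> \<longleftrightarrow> (\<exists>z zs. x = z @ concat zs \<and> ders hs [a] z \<and> list_all2 (\<lambda>a. ders hs [a]) u zs)"
    using Cons by blast
  also have "\<dots> \<longleftrightarrow> (\<exists>zs. x = concat zs \<and> list_all2 (\<lambda>a. ders hs [a]) (a # u) zs)"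
    unfolding list_all2_Cons1 by (metis concat.simps(2))
  finally show ?case .
qed auto

lemma subst_word_productions:
  "y \<in> subst_word h w \<longleftrightarrow>
     (\<exists>ps. set ps \<subseteq> h \<and> w = map (\<lambda>(r, a, u). a) ps \<and> y = concat (map (\<lambda>(r, a, u). u) ps))"
  (is "_ \<longleftrightarrow> ?P w y")
proof
  assume "y \<in> subst_word h w"
  then show "?P w y"
  proof (induction w arbitrary: y)
    case (Cons a w)
    from Cons.prems obtain r u v where uv: "y = u @ v" "(r, a, u) \<in> h" "v \<in> subst_word h w"
      by (auto simp: subst_letter_def)
    obtain ps where "set ps \<subseteq> h" "w = map (\<lambda>(r, a, u). a) ps"
      "v = concat (map (\<lambda>(r, a, u). u) ps)" using Cons.IH[OF uv(3)] by blast
    with uv show ?case by (intro exI[of _ "(r, a, u) # ps"]) simp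
  qed simp
next
  assume "?P w y"
  then obtain ps where "set ps \<subseteq> h" and w: "w = map (\<lambda>(r, a, u). a) ps"
    and y: "y = concat (map (\<lambda>(r, a, u). u) ps)" by blast
  from this(1) show "y \<in> subst_word h w" unfolding w y
    by (induction ps) (auto simp: subst_letter_def)
qed

text \<open>\<open>foldr\<close> applies the last table of the list first, as in the usual notation
  for composed substitutions, whereas \<open>ders\<close> consumes the list from its head.\<close>

lemma ders_rev_foldr: "x \<in> foldr subst_lang hs {\<omega>} \<longleftrightarrow> ders (rev hs) \<omega> x"
proof (induction hs arbitrary: x)
  case (Cons h hs)
  have "x \<in> foldr subst_lang (h # hs) {\<omega>} \<longleftrightarrow> (\<exists>w. ders (rev hs) \<omega> w \<and> x \<in> subst_word h w)"
    using Cons by (simp add: subst_lang_def[of h] Bex_def)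
  also have "\<dots> \<longleftrightarrow> ders (rev (h # hs)) \<omega> x"
    by (simp add: ders_append)
  finally show ?case .
qed (simp add: eq_commute)

lemma language_T0L_iff: "x \<in> language_T0L H \<omega> \<longleftrightarrow> (\<exists>hs\<in>lists H. ders hs \<omega> x)"
proof
  assume "x \<in> language_T0L H \<omega>"
  then consider "x = \<omega>" | hs where "hs \<in> lists H" "ders (rev hs) \<omega> x"
    by (auto simp: language_T0L_def ders_rev_foldr)
  then show "\<exists>hs\<in>lists H. ders hs \<omega> x"
  proof cases
    case 1
    then show ?thesis by (intro bexI[of _ "[]"]) auto
  next
    case 2
    then show ?thesis by (intro bexI[of _ "rev hs"]) auto
  qed
next
  assume "\<exists>hs\<in>lists H. ders hs \<omega> x"
  then obtain hs where "hs \<in> lists H" "ders hs \<omega> x" ..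
  then have "rev hs \<in> lists H" "x \<in> foldr subst_lang (rev hs) {\<omega>}"
    by (auto simp: ders_rev_foldr)
  then show "x \<in> language_T0L H \<omega>" unfolding language_T0L_def by blast
qed

lemma language_0L_iff: "x \<in> language_0L h \<omega> \<longleftrightarrow> (\<exists>t. ders (replicate t h) \<omega> x)"
proof -
  have "x \<in> (subst_lang h ^^ t) {\<omega>} \<longleftrightarrow> ders (replicate t h) \<omega> x" for t
    using ders_rev_foldr[of x "replicate t h" \<omega>] by (simp add: foldr_replicate)
  then show ?thesis by (auto simp: language_0L_def)
qed

lemma language_0L_eq: "language_0L h = language_T0L {h}"
proof (intro ext set_eqI)
  fix \<omega> x
  have r: "hs \<in> lists {h} \<longleftrightarrow> (\<exists>t. hs = replicate t h)" for hs
  proof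
    assume "hs \<in> lists {h}"
    then have "hs = replicate (length hs) h" by (induction hs) auto
    then show "\<exists>t. hs = replicate t h" ..
  qed auto
  then show "x \<in> language_0L h \<omega> \<longleftrightarrow> x \<in> language_T0L {h} \<omega>"
    unfolding language_0L_iff language_T0L_iff Bex_def r by blast
qed

lemma fuzzy_language_E0L_eq: "fuzzy_language_E0L h = fuzzy_language_ET0L {h}"
  by (intro ext) (simp add: fuzzy_language_E0L_def fuzzy_language_ET0L_def grade_0L_def language_0L_eq)

lemma L_derivation_ders:
  "(\<exists>rs. L_derivation H \<omega> rs x) \<longleftrightarrow> (\<exists>hs\<in>lists H. ders hs \<omega> x)"
proof
  assume "\<exists>rs. L_derivation H \<omega> rs x"
  then obtain rs where "L_derivation H \<omega> rs x" ..
  then show "\<exists>hs\<in>lists H. ders hs \<omega> x"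
  proof induction
    case start
    then show ?case by (intro bexI[of _ "[]"]) auto
  next
    case (step rs x h ps y)
    then obtain hs where hs: "hs \<in> lists H" "ders hs \<omega> x" by blast
    have "y \<in> subst_word h x" using step by (auto simp: subst_word_productions)
    with hs step show ?case by (intro bexI[of _ "hs @ [h]"]) (auto simp: ders_append)
  qed
next
  assume "\<exists>hs\<in>lists H. ders hs \<omega> x"
  then obtain hs where "hs \<in> lists H" "ders hs \<omega> x" by blast
  then show "\<exists>rs. L_derivation H \<omega> rs x"
  proof (induction hs arbitrary: x rule: rev_induct)
    case Nil
    then show ?case by (auto intro: L_derivation.start)
  next
    case (snoc h hs)
    then obtain y where "ders hs \<omega> y" "x \<in> subst_word h y" by (auto simp: ders_append)
    moreover from this snoc obtain rs where "L_derivation H \<omega> rs y" by auto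
    ultimately show ?case using snoc.prems L_derivation.step[of H \<omega> rs y h]
      by (auto simp: subst_word_productions)
  qed
qed

lemma L_derivation_labels:
  "L_derivation H \<omega> rs x \<Longrightarrow> set rs \<subseteq> (\<Union>h\<in>H. fst ` h)"
  by (induction rule: L_derivation.induct) auto

text \<open>A step without labels rewrites the empty word and changes nothing. Hence for words other
  than the axiom every \<open>Min\<close> is taken over a nonempty set.\<close>

lemma L_derivation_no_labels: "L_derivation H \<omega> [] x \<Longrightarrow> x = \<omega>"
proof (induction "[] :: 'a list" x rule: L_derivation.induct)
  case (step rs x h ps y)
  then show ?case by auto
qed simp

lemma snd_fuzzy_language_ET0L:
  "snd ` fuzzy_language_ET0L H \<omega> J f \<Delta> = {x \<in> lists \<Delta>. \<exists>hs\<in>lists H. ders hs \<omega> x}"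
  by (auto simp: fuzzy_language_ET0L_def language_T0L_iff image_def)

lemma snd_fuzzy_language_E0L:
  "snd ` fuzzy_language_E0L h \<omega> J f \<Delta> = {x \<in> lists \<Delta>. \<exists>t. ders (replicate t h) \<omega> x}"
  by (auto simp: fuzzy_language_E0L_def language_0L_iff image_def)

lemma snd_fuzzy_language_G:
  "snd ` fuzzy_language_G VT P S f = {x \<in> lists VT. \<exists>rs. G_derivation P S rs x}"
  by (auto simp: fuzzy_language_G_def image_def)

lemma FE0L_subset_FET0L: "FE0L \<subseteq> FET0L"
proof
  fix F :: "'a fuzzy_language"
  assume "F \<in> FE0L"
  then obtain \<Sigma> h \<omega> J and f :: "nat \<Rightarrow> real" and \<Delta> where
    F: "F = fuzzy_language_E0L h \<omega> J f \<Delta>" and E: "fuzzy_E0L \<Sigma> h \<omega> J f \<Delta>"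
    by (auto simp: FE0L_def)
  have J: "J = fst ` h" using E by (simp add: fuzzy_E0L_def fuzzy_0L_def graded_labelling_def)
  then have "fuzzy_ET0L \<Sigma> {h} \<omega> J f \<Delta>"
    using E by (auto simp: fuzzy_E0L_def fuzzy_ET0L_def fuzzy_T0L_def)
  then show "F \<in> FET0L" using F unfolding FET0L_def fuzzy_language_E0L_eq by blast
qed

section \<open>Derivations in grammars\<close>

definition gstep :: "('r, 'a) rules \<Rightarrow> 'a list \<Rightarrow> 'a list \<Rightarrow> bool" where
  "gstep P x y \<longleftrightarrow> (\<exists>u v r \<alpha> \<beta>. (r, \<alpha>, \<beta>) \<in> P \<and> x = u @ \<alpha> @ v \<and> y = u @ \<beta> @ v)"

lemma G_derivation_gstep: "(\<exists>rs. G_derivation P S rs x) \<longleftrightarrow> (gstep P)\<^sup>*\<^sup>* [S] x"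
proof
  assume "\<exists>rs. G_derivation P S rs x"
  then obtain rs where "G_derivation P S rs x" ..
  then show "(gstep P)\<^sup>*\<^sup>* [S] x"
  proof induction
    case (step rs u \<alpha> v r \<beta>)
    then have "gstep P (u @ \<alpha> @ v) (u @ \<beta> @ v)" unfolding gstep_def by blast
    with step.IH show ?case by simp
  qed simp
next
  assume "(gstep P)\<^sup>*\<^sup>* [S] x"
  then show "\<exists>rs. G_derivation P S rs x"
  proof induction
    case base
    then show ?case by (blast intro: G_derivation.start)
  next
    case (step y z)
    then show ?case unfolding gstep_def by (blast intro: G_derivation.step)
  qed
qed

lemma gstep_context: "gstep P x y \<Longrightarrow> gstep P (p @ x @ q) (p @ y @ q)"
  unfolding gstep_def by (metis append.assoc)

lemma gsteps_context: "(gstep P)\<^sup>*\<^sup>* x y \<Longrightarrow> (gstep P)\<^sup>*\<^sup>* (p @ x @ q) (p @ y @ q)"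
proof (induction rule: rtranclp_induct)
  case (step y z)
  then show ?case using gstep_context[of P y z p q] by simp
qed simp

lemma gsteps_append:
  assumes "(gstep P)\<^sup>*\<^sup>* u u'" "(gstep P)\<^sup>*\<^sup>* v v'"
  shows "(gstep P)\<^sup>*\<^sup>* (u @ v) (u' @ v')"
  using gsteps_context[OF assms(1), of "[]" v] gsteps_context[OF assms(2), of u' "[]"] by simp

text \<open>A left-hand side of a single letter cannot straddle the border between \<open>u\<close>
  and \<open>v\<close>, so every step takes place in one of the halves.\<close>

lemma CF_gsteps_append:
  assumes CF: "\<And>r \<alpha> \<beta>. (r, \<alpha>, \<beta>) \<in> P \<Longrightarrow> \<exists>A. \<alpha> = [A]"
    and "(gstep P)\<^sup>*\<^sup>* (u @ v) y"
  shows "\<exists>y1 y2. y = y1 @ y2 \<and> (gstep P)\<^sup>*\<^sup>* u y1 \<and> (gstep P)\<^sup>*\<^sup>* v y2"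
  using assms(2)
proof (induction rule: rtranclp_induct)
  case (step y z)
  then obtain y1 y2 where y: "y = y1 @ y2" "(gstep P)\<^sup>*\<^sup>* u y1" "(gstep P)\<^sup>*\<^sup>* v y2" by blast
  obtain p q r A \<beta> where p: "(r, [A], \<beta>) \<in> P" "y = p @ [A] @ q" and z: "z = p @ \<beta> @ q"
    using step.hyps(2) CF unfolding gstep_def by metis
  have ctx: "gstep P (p' @ [A] @ q') (p' @ \<beta> @ q')" for p' q'
    using p(1) unfolding gstep_def by blast
  from p(2) y(1) consider us where "p = y1 @ us" "us @ [A] @ q = y2"
    | us where "p @ [A] @ us = y1" "q = us @ y2"
    by (auto simp: append_eq_append_conv2 append_eq_Cons_conv)
  then show ?case
  proof cases
    case 1
    then have "(gstep P)\<^sup>*\<^sup>* v (us @ \<beta> @ q)" using y(3) ctx[of us q] by simp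
    then show ?thesis using y 1 z by auto
  next
    case 2
    then have "(gstep P)\<^sup>*\<^sup>* u (p @ \<beta> @ us)" using y(2) ctx[of p us] by simp
    then show ?thesis using y 2 z by (intro exI[of _ "p @ \<beta> @ us"] exI[of _ y2]) simp
  qed
qed auto


section \<open>Context-free languages are E0L\<close>

text \<open>Extra labels of grade 1 cannot lower a minimum of grades that are at most 1. This is
  applied to the labels of the identity productions.\<close>

lemma Min_grade_extend:
  fixes f f' :: "'r \<Rightarrow> real"
  assumes "finite B" "A \<noteq> {}" "A \<subseteq> B"
    and "\<And>r. r \<in> A \<Longrightarrow> f' r = f r \<and> f r \<le> 1" "\<And>r. r \<in> B - A \<Longrightarrow> f' r = 1"
  shows "Min (f' ` B) = Min (f ` A)"
proof (rule antisym)
  have fin: "finite A" using assms finite_subset by blast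
  have "Min (f ` A) \<in> f ` A" using fin assms by (intro Min_in) auto
  then obtain a where a: "a \<in> A" "Min (f ` A) = f a" by auto
  show "Min (f' ` B) \<le> Min (f ` A)"
    using a assms by (metis Min_le finite_imageI image_eqI subsetD)
  have "f a \<le> f' b" if "b \<in> B" for b
  proof (cases "b \<in> A")
    case True
    then show ?thesis using a assms fin by (metis Min_le finite_imageI imageI)
  qed (use a assms that in auto)
  then show "Min (f ` A) \<le> Min (f' ` B)"
    using assms a by (intro Min.boundedI) auto
qed

lemma FCFL_subset_FE0L: "(FCFL :: 'a fuzzy_language set) \<subseteq> FE0L"
proof
  fix F :: "'a fuzzy_language"
  assume "F \<in> FCFL"
  then obtain VN VT P S and J :: "nat set" and f where F: "F = fuzzy_language_G VT P S f"
    and G: "fuzzy_CF_grammar VN VT P S J f"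
    by (auto simp: FCFL_def)
  have CF0: "\<forall>(r, \<alpha>, \<beta>)\<in>P. \<exists>A\<in>VN. \<alpha> = [A]"
    and fin: "finite VN" "finite VT" "finite P" and S: "S \<in> VN" and disj: "VN \<inter> VT = {}"
    and P: "P \<subseteq> UNIV \<times> lists (VN \<union> VT) \<times> lists (VN \<union> VT)" and inj: "inj_on fst P"
    and J: "J = fst ` P" and f01: "\<forall>r\<in>J. 0 \<le> f r \<and> f r \<le> 1"
    using G unfolding fuzzy_CF_grammar_def fuzzy_grammar_def graded_labelling_def by blast+
  define \<Sigma> where "\<Sigma> = VN \<union> VT"
  have fin\<Sigma>: "finite \<Sigma>" using fin by (simp add: \<Sigma>_def)
  have CF: "\<exists>A\<in>VN. \<alpha> = [A] \<and> \<beta> \<in> lists \<Sigma>" if "(r, \<alpha>, \<beta>) \<in> P" for r \<alpha> \<beta>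
  proof -
    have "\<beta> \<in> lists \<Sigma>" using subsetD[OF P that] unfolding \<Sigma>_def by simp
    then show ?thesis using bspec[OF CF0 that] by simp
  qed
  obtain e :: "'a \<Rightarrow> nat" where e: "inj_on e \<Sigma>"
    using finite_imp_inj_to_nat_seg[OF fin\<Sigma>] by blast
  have "finite J" using J fin by simp
  then obtain N where N: "\<And>r. r \<in> J \<Longrightarrow> r < N" unfolding finite_nat_set_iff_bounded by blast
  have lab: "r < N" if "(r, \<alpha>, \<beta>) \<in> P" for r \<alpha> \<beta>
    using J N that by (metis fst_conv imageI)
  \<comment> \<open>Labels of the identity productions, shifted beyond all labels of the grammar so
    that \<open>f'\<close> can tell the two kinds apart.\<close>
  define I where "I = (\<lambda>a. N + e a) ` \<Sigma>"
  define h where "h = (\<lambda>(r, \<alpha>, \<beta>). (r, hd \<alpha>, \<beta>)) ` P \<union> (\<lambda>a. (N + e a, a, [a])) ` \<Sigma>"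
  define f' where "f' r = (if r < N then f r else 1)" for r
  have hI: "(r, a, u) \<in> h \<longleftrightarrow> (r, [a], u) \<in> P \<or> (r = N + e a \<and> u = [a] \<and> a \<in> \<Sigma>)" for r a u
    using CF unfolding h_def by (force simp: image_iff)
  have labI: "r \<notin> I" if "(r, \<alpha>, \<beta>) \<in> P" for r \<alpha> \<beta>
    using lab[OF that] by (auto simp: I_def)
  have "inj_on fst h"
  proof (rule inj_onI)
    fix p q assume pq: "p \<in> h" "q \<in> h" "fst p = fst q"
    obtain r a u r' a' u' where eq: "p = (r, a, u)" "q = (r', a', u')" by (metis prod.exhaust)
    have "(r, [a], u) \<in> P \<Longrightarrow> (r, [a'], u') \<in> P \<Longrightarrow> a = a' \<and> u = u'"
      using inj_onD[OF inj, of "(r, [a], u)" "(r, [a'], u')"] pq(3) eq by auto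
    then show "p = q" using pq unfolding eq by (auto simp: hI dest: lab inj_onD[OF e])
  qed
  moreover have "finite h" using fin fin\<Sigma> by (simp add: h_def)
  moreover have "\<forall>r\<in>fst ` h. 0 \<le> f' r \<and> f' r \<le> 1"
    using f01 J lab by (force simp: f'_def hI)
  moreover have "h \<subseteq> UNIV \<times> \<Sigma> \<times> lists \<Sigma>"
    using CF by (fastforce simp: hI \<Sigma>_def)
  moreover have "\<forall>a\<in>\<Sigma>. \<exists>r u. (r, a, u) \<in> h" by (auto simp: hI)
  ultimately have E: "fuzzy_E0L \<Sigma> h [S] (fst ` h) f' VT"
    using S fin\<Sigma> by (auto simp: fuzzy_E0L_def fuzzy_0L_def graded_labelling_def \<Sigma>_def)
  have words: "x \<in> lists \<Sigma> \<and> set rs \<subseteq> J" if "G_derivation P S rs x" for rs x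
    using that
  proof induction
    case start
    then show ?case using S by (simp add: \<Sigma>_def)
  next
    case (step rs u \<alpha> v r \<beta>)
    then have "r \<in> J" using J by (metis fst_conv imageI)
    with step show ?case using CF by fastforce
  qed
  \<comment> \<open>One grammar step becomes a parallel step in which the rest of the word is
    copied. Only the sets of labels are compared, since \<open>Min\<close> depends on nothing
    else.\<close>
  have GL: "\<exists>rs'. L_derivation {h} [S] rs' x \<and> set rs \<subseteq> set rs' \<and> set rs' - set rs \<subseteq> I"
    if "G_derivation P S rs x" for rs x
    using that
  proof induction
    case start
    then show ?case by (blast intro: L_derivation.start)
  next
    case (step rs u \<alpha> v r \<beta>)
    then obtain rs' where rs': "L_derivation {h} [S] rs' (u @ \<alpha> @ v)" "set rs \<subseteq> set rs'"
      "set rs' - set rs \<subseteq> I" by blast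
    obtain A where A: "\<alpha> = [A]" using CF step by blast
    define idp where "idp = map (\<lambda>a. (N + e a, a, [a]))"
    define ps where "ps = idp u @ [(r, A, \<beta>)] @ idp v"
    have uv: "set u \<subseteq> \<Sigma>" "set v \<subseteq> \<Sigma>" using words[OF step(1)] by auto
    have i: "map (\<lambda>(r, a, u). a) (idp w) = w" "concat (map (\<lambda>(r, a, u). u) (idp w)) = w" for w
      by (induction w) (simp_all add: idp_def)
    have "L_derivation {h} [S] (rs' @ map fst ps) (u @ \<beta> @ v)"
    proof (rule L_derivation.step[OF rs'(1), of h])
      show "set ps \<subseteq> h" using uv step(2) A by (auto simp: ps_def idp_def hI)
    qed (simp_all add: ps_def i A)
    moreover have "set (map fst ps) - {r} \<subseteq> I" "r \<in> set (map fst ps)"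
      using uv by (auto simp: ps_def idp_def I_def)
    ultimately show ?case using rs' by (intro exI[of _ "rs' @ map fst ps"]) auto
  qed
  \<comment> \<open>A parallel step is carried out from left to right: \<open>u\<close> is already
    rewritten, and identity productions cost no step of the grammar.\<close>
  have par: "\<exists>rs'. G_derivation P S (rs @ rs') (u @ concat (map (\<lambda>(r, a, u). u) ps) @ v)
               \<and> set rs' = fst ` set ps - I"
    if "set ps \<subseteq> h" "G_derivation P S rs (u @ map (\<lambda>(r, a, u). a) ps @ v)" for ps rs u v
    using that
  proof (induction ps arbitrary: rs u)
    case Nil
    then show ?case by (intro exI[of _ "[]"]) simp
  next
    case (Cons p ps)
    obtain r a w where p: "p = (r, a, w)" by (metis prod.exhaust)
    have "(r, a, w) \<in> h" using Cons p by simp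
    then consider "(r, [a], w) \<in> P" | "r \<in> I" "w = [a]" by (auto simp: hI I_def)
    then show ?case
    proof cases
      case 1
      have "G_derivation P S (rs @ [r]) (u @ w @ map (\<lambda>(r, a, u). a) ps @ v)"
        using G_derivation.step[OF _ 1, of S rs u "map (\<lambda>(r, a, u). a) ps @ v"] Cons.prems p by simp
      then obtain rs' where "G_derivation P S ((rs @ [r]) @ rs')
          ((u @ w) @ concat (map (\<lambda>(r, a, u). u) ps) @ v)" "set rs' = fst ` set ps - I"
        using Cons.IH[of "rs @ [r]" "u @ w"] Cons.prems by auto
      then show ?thesis using p labI[OF 1] by (intro exI[of _ "r # rs'"]) auto
    next
      case 2
      then obtain rs' where "G_derivation P S (rs @ rs')
          ((u @ [a]) @ concat (map (\<lambda>(r, a, u). u) ps) @ v)" "set rs' = fst ` set ps - I"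
        using Cons.IH[of rs "u @ [a]"] Cons.prems p by auto
      then show ?thesis using p 2 by (intro exI[of _ rs']) auto
    qed
  qed
  have LG: "\<exists>rs. G_derivation P S rs x \<and> set rs = set rs' - I"
    if "L_derivation {h} [S] rs' x" for rs' x
    using that
  proof induction
    case start
    then show ?case by (intro exI[of _ "[]"]) (auto intro: G_derivation.start)
  next
    case (step rs' x h' ps y)
    then obtain rs where "G_derivation P S rs x" "set rs = set rs' - I" by blast
    then obtain rs2 where "G_derivation P S (rs @ rs2) y" "set rs2 = fst ` set ps - I"
      using par[of ps rs "[]" "[]"] step by auto
    then show ?case using \<open>set rs = _\<close> by (intro exI[of _ "rs @ rs2"]) auto
  qed
  have Min_eq: "Min (f' ` set rs') = Min (f ` set rs)"
    if "x \<noteq> [S]" "G_derivation P S rs x" "set rs \<subseteq> set rs'" "set rs' - set rs \<subseteq> I" for x rs rs'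
  proof (rule Min_grade_extend)
    show "set rs \<noteq> {}" using that(2,1) by cases auto
    show "f' r = f r \<and> f r \<le> 1" if "r \<in> set rs" for r
    proof -
      have "r \<in> J" using words \<open>G_derivation P S rs x\<close> that by blast
      then show ?thesis using N f01 by (simp add: f'_def)
    qed
    show "f' r = 1" if "r \<in> set rs' - set rs" for r
      using that \<open>set rs' - set rs \<subseteq> I\<close> by (auto simp: f'_def I_def)
  qed (use that in auto)
  \<comment> \<open>The grade of the axiom of an L system is set separately, without regard to its
    derivations; a terminal word is never the axiom.\<close>
  have "x \<noteq> [S]" if "x \<in> lists VT" for x using that S disj by auto
  moreover have "{Min (f ` set rs) | rs. G_derivation P S rs x} =
      {Min (f' ` set rs) | rs. L_derivation {h} [S] rs x}" if "x \<noteq> [S]" for x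
  proof (intro equalityI subsetI)
    fix c assume "c \<in> {Min (f ` set rs) | rs. G_derivation P S rs x}"
    then obtain rs where rs: "G_derivation P S rs x" "c = Min (f ` set rs)" by blast
    obtain rs' where "L_derivation {h} [S] rs' x" "set rs \<subseteq> set rs'" "set rs' - set rs \<subseteq> I"
      using GL[OF rs(1)] by blast
    moreover from this have "c = Min (f' ` set rs')" using Min_eq[OF that rs(1)] rs(2) by simp
    ultimately show "c \<in> {Min (f' ` set rs) | rs. L_derivation {h} [S] rs x}" by blast
  next
    fix c assume "c \<in> {Min (f' ` set rs) | rs. L_derivation {h} [S] rs x}"
    then obtain rs' where rs': "L_derivation {h} [S] rs' x" "c = Min (f' ` set rs')" by blast
    then obtain rs where "G_derivation P S rs x" "set rs = set rs' - I" using LG by blast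
    moreover from this have "Min (f' ` set rs') = Min (f ` set rs)"
      by (intro Min_eq[OF that]) auto
    ultimately show "c \<in> {Min (f ` set rs) | rs. G_derivation P S rs x}"
      unfolding rs'(2) by blast
  qed
  ultimately have "grade_G P S f x = grade_T0L {h} [S] (fst ` h) f' x" if "x \<in> lists VT" for x
    using that by (simp add: grade_G_def grade_T0L_def)
  moreover have "(\<exists>rs. G_derivation P S rs x) \<longleftrightarrow> x \<in> language_T0L {h} [S]" for x
    using GL LG unfolding language_T0L_iff L_derivation_ders[symmetric] by blast
  ultimately have "F = fuzzy_language_E0L h [S] (fst ` h) f' VT"
    unfolding F fuzzy_language_E0L_eq fuzzy_language_ET0L_def fuzzy_language_G_def
    by (intro Collect_cong) (metis IntD1 IntD2 IntI)
  then show "F \<in> FE0L" using E unfolding FE0L_def by blast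
qed

section \<open>Separation of context-free from E0L languages by length gaps\<close>

text \<open>
  Along a derivation, the least length of a terminal word derivable from the sentential form grows
  by a bounded amount in each step, and it takes its values among the lengths of generated words.
\<close>

lemma CF_length_gaps:
  assumes G: "fuzzy_CF_grammar VN VT P S J f"
  defines "L \<equiv> {x \<in> lists VT. \<exists>rs. G_derivation P S rs x}"
  shows "\<exists>C N0. \<forall>x\<in>L. \<forall>N\<ge>N0. N \<le> length x \<longrightarrow> (\<exists>y\<in>L. N \<le> length y \<and> length y \<le> N + C)"
proof -
  have CF: "\<exists>A\<in>VN. \<alpha> = [A]" if "(r, \<alpha>, \<beta>) \<in> P" for r \<alpha> \<beta>
    using G that unfolding fuzzy_CF_grammar_def by blast
  have fin: "finite P" and disj: "VN \<inter> VT = {}"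
    using G unfolding fuzzy_CF_grammar_def fuzzy_grammar_def graded_labelling_def by blast+
  have L: "L = {x \<in> lists VT. (gstep P)\<^sup>*\<^sup>* [S] x}" by (simp add: L_def G_derivation_gstep)
  define T where "T \<alpha> y \<longleftrightarrow> y \<in> lists VT \<and> (gstep P)\<^sup>*\<^sup>* \<alpha> y" for \<alpha> y
  define m where "m \<alpha> = (LEAST n. \<exists>y. T \<alpha> y \<and> length y = n)" for \<alpha>
  have m_ex: "\<exists>z. T \<alpha> z \<and> length z = m \<alpha>" if "T \<alpha> y" for \<alpha> y
    using LeastI_ex[of "\<lambda>n. \<exists>y. T \<alpha> y \<and> length y = n"] that unfolding m_def by blast
  have m_le: "m \<alpha> \<le> length y" if "T \<alpha> y" for \<alpha> y
    using that unfolding m_def by (intro Least_le) blast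
  \<comment> \<open>The largest of the minimal terminal lengths of right-hand sides. A right-hand
    side deriving no terminal word contributes an unspecified number, which can only enlarge the
    bound.\<close>
  define C where "C = Max (insert 0 ((\<lambda>(r, \<alpha>, \<beta>). m \<beta>) ` P))"
  have C: "m \<beta> \<le> C" if "(r, \<alpha>, \<beta>) \<in> P" for r \<alpha> \<beta>
  proof -
    have "m \<beta> \<in> insert 0 ((\<lambda>(r, \<alpha>, \<beta>). m \<beta>) ` P)" using that by force
    then show ?thesis unfolding C_def using fin by (intro Max_ge) auto
  qed
  have split: "\<exists>y1 y2. y = y1 @ y2 \<and> T u y1 \<and> T v y2" if "T (u @ v) y" for u v y
    using CF_gsteps_append[of P u v y] CF that unfolding T_def by fastforce
  \<comment> \<open>In a shortest terminal word derived from \<open>\<alpha>\<close>, the factor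
    stemming from the rewritten nonterminal is exchanged for a shortest one stemming from
    \<open>\<gamma>\<close>.\<close>
  have m_step: "m \<beta> \<le> m \<alpha> + C" if step: "gstep P \<alpha> \<beta>" and ex: "T \<beta> y" for \<alpha> \<beta> y
  proof -
    obtain u v r A \<gamma> where A: "(r, [A], \<gamma>) \<in> P" "\<alpha> = u @ [A] @ v" "\<beta> = u @ \<gamma> @ v"
      using step CF unfolding gstep_def by metis
    have "T \<alpha> y" using ex step unfolding T_def by (meson converse_rtranclp_into_rtranclp)
    then obtain z where z: "T \<alpha> z" "length z = m \<alpha>" using m_ex by blast
    then obtain z1 z2 z3 where z': "z = z1 @ z2 @ z3" "T u z1" "T v z3"
      using split[of u "[A] @ v" z] split[of "[A]" v] A by metis
    obtain y2 where "T \<gamma> y2" using split[of u "\<gamma> @ v" y] split[of \<gamma> v] ex A by metis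
    then obtain z2' where z2': "T \<gamma> z2'" "length z2' = m \<gamma>" using m_ex by blast
    have "T \<beta> (z1 @ z2' @ z3)"
      using z' z2' A(3) unfolding T_def by (auto intro: gsteps_append)
    then show ?thesis using m_le[of \<beta> "z1 @ z2' @ z3"] z z' z2' C[OF A(1)] by simp
  qed
  \<comment> \<open>Looks for the first sentential form whose value of \<open>m\<close> reaches
    \<open>N\<close>: the predecessor is below \<open>N\<close>, so the overshoot is at most
    \<open>C\<close>.\<close>
  have "\<exists>y\<in>L. N \<le> length y \<and> length y \<le> N + C"
    if "(gstep P)\<^sup>*\<^sup>* [S] \<alpha>" "T \<alpha> x" "N \<le> m \<alpha>" "m [S] \<le> N" for \<alpha> x N
    using that
  proof (induction arbitrary: x rule: rtranclp_induct)
    case base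
    then obtain z where "T [S] z" "length z = m [S]" using m_ex by blast
    then show ?case using base by (intro bexI[of _ z]) (auto simp: L T_def)
  next
    case (step \<alpha> \<beta>)
    have x: "T \<alpha> x" using step unfolding T_def by (meson converse_rtranclp_into_rtranclp)
    show ?case
    proof (cases "N \<le> m \<alpha>")
      case True
      then show ?thesis using step x by blast
    next
      case False
      then have "m \<beta> \<le> N + C" using m_step[OF step(2)] step by fastforce
      moreover obtain z where "T \<beta> z" "length z = m \<beta>" using m_ex step by blast
      moreover from this step have "z \<in> L" unfolding L T_def
        by (metis (mono_tags, lifting) mem_Collect_eq rtranclp.rtrancl_into_rtrancl rtranclp_trans)
      ultimately show ?thesis using step.prems by (intro bexI[of _ z]) simp_all
    qed
  qed
  \<comment> \<open>A terminal word derives only itself, so at the end of a derivation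
    \<open>m\<close> is the actual length.\<close>
  moreover have "m x = length x" if "x \<in> lists VT" for x
  proof -
    have "y = x" if "T x y" for y
    proof -
      have "(gstep P)\<^sup>*\<^sup>* x y" using that unfolding T_def by blast
      then show ?thesis
      proof (cases rule: converse_rtranclpE)
        case (step z)
        then obtain A where "A \<in> VN" "A \<in> set x" using CF unfolding gstep_def by fastforce
        then show ?thesis using disj \<open>x \<in> lists VT\<close> by blast
      qed simp
    qed
    moreover have "T x x" using that by (simp add: T_def)
    ultimately show ?thesis by (metis m_ex)
  qed
  ultimately have "\<exists>y\<in>L. N \<le> length y \<and> length y \<le> N + C"
    if "x \<in> L" "N \<le> length x" "m [S] \<le> N" for x N
    using that unfolding L T_def by (metis (mono_tags, lifting) mem_Collect_eq rtranclp.rtrancl_refl)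
  then show ?thesis by blast
qed

lemma FE0L_not_FCFL: "\<exists>F :: 'a fuzzy_language. F \<in> FE0L \<and> F \<notin> FCFL"
proof -
  define a :: 'a where "a = undefined"
  define h :: "(nat, 'a) table" where "h = {(0, a, [a, a])}"
  define F where "F = fuzzy_language_E0L h [a] {0} (\<lambda>_. 1) {a}"
  have "fuzzy_E0L {a} h [a] {0} (\<lambda>_. 1) {a}"
    by (simp add: fuzzy_E0L_def fuzzy_0L_def graded_labelling_def h_def)
  then have E: "F \<in> FE0L" unfolding F_def FE0L_def by blast
  have sub: "subst_word h (replicate n a) = {replicate (2 * n) a}" for n
    by (induction n) (auto simp: subst_letter_def h_def)
  have der: "ders (replicate t h) (replicate n a) x \<longleftrightarrow> x = replicate (2 ^ t * n) a" for t n x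
    by (induction t arbitrary: n) (auto simp: sub mult_ac)
  have "{x \<in> lists {a}. \<exists>t. ders (replicate t h) [a] x} = range (\<lambda>t. replicate (2 ^ t) a)"
    using der[of _ 1] by auto
  then have snd: "snd ` F = range (\<lambda>t. replicate (2 ^ t) a)"
    unfolding F_def snd_fuzzy_language_E0L .
  have "F \<notin> FCFL"
  proof
    assume "F \<in> FCFL"
    then obtain VN VT P S J and f :: "nat \<Rightarrow> real" where "F = fuzzy_language_G VT P S f"
      and G: "fuzzy_CF_grammar VN VT P S J f" by (auto simp: FCFL_def)
    then have L: "{x \<in> lists VT. \<exists>rs. G_derivation P S rs x} = range (\<lambda>t. replicate (2 ^ t) a)"
      using snd by (simp add: snd_fuzzy_language_G)
    obtain C N0 where gap: "\<And>x N. x \<in> range (\<lambda>t. replicate (2 ^ t) a) \<Longrightarrow> N0 \<le> N \<Longrightarrow> N \<le> length x \<Longrightarrow>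
      \<exists>y\<in>range (\<lambda>t. replicate (2 ^ t) a). N \<le> length y \<and> length y \<le> N + C"
      using CF_length_gaps[OF G] unfolding L by blast
    \<comment> \<open>As \<open>n\<close> exceeds \<open>C\<close> and 2^n exceeds \<open>n\<close>,
      the numbers from 2^n + 1 to 2^n + 1 + C lie strictly between consecutive powers of
      two.\<close>
    define n where "n = N0 + C + 1"
    have n: "n < 2 ^ n" by simp
    have "Suc (2 ^ n) \<le> length (replicate (2 ^ Suc n) a)"
      using n unfolding length_replicate power_Suc by linarith
    then have "\<exists>y\<in>range (\<lambda>t. replicate (2 ^ t) a). Suc (2 ^ n) \<le> length y \<and> length y \<le> Suc (2 ^ n) + C"
      using n by (intro gap[of "replicate (2 ^ Suc n) a"] rangeI) (simp_all add: n_def)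
    then obtain t where t: "Suc (2 ^ n) \<le> (2::nat) ^ t" "(2::nat) ^ t \<le> Suc (2 ^ n) + C" by auto
    have "(2::nat) ^ t < 2 ^ Suc n" using t n by (simp add: n_def)
    then have "t \<le> n" using power_less_imp_less_exp[of "2::nat" t "Suc n"] by simp
    then have "(2::nat) ^ t \<le> 2 ^ n" by (intro power_increasing) auto
    then show False using t(1) by linarith
  qed
  then show ?thesis using E by blast
qed

section \<open>Iterated morphisms\<close>

primrec iter_morphism :: "('b \<Rightarrow> 'b list) \<Rightarrow> nat \<Rightarrow> 'b \<Rightarrow> 'b list" where
  "iter_morphism f 0 x = [x]"
| "iter_morphism f (Suc m) x = concat (map (iter_morphism f m) (f x))"

lemma concat_map_concat_map:
  "concat (map g (concat (map f xs))) = concat (map (\<lambda>x. concat (map g (f x))) xs)"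
  by (induction xs) auto

lemma iter_morphism_add:
  "iter_morphism f (m + n) x = concat (map (iter_morphism f n) (iter_morphism f m x))"
proof (induction m arbitrary: x)
  case (Suc m)
  then have "iter_morphism f (m + n) = (\<lambda>x. concat (map (iter_morphism f n) (iter_morphism f m x)))"
    by auto
  then show ?case by (simp add: concat_map_concat_map)
qed simp

lemma mset_concat_map_mono:
  assumes "\<And>x. x \<in> set xs \<Longrightarrow> mset (f x) \<subseteq># mset (g x)"
  shows "mset (concat (map f xs)) \<subseteq># mset (concat (map g xs))"
  using assms by (induction xs) (auto intro: subset_mset.add_mono)

lemma mset_concat_map_subset:
  assumes "mset xs \<subseteq># mset ys"
  shows "mset (concat (map f xs)) \<subseteq># mset (concat (map f ys))"
proof -
  have eq: "mset (concat (map f zs)) = (\<Sum>x\<in>#mset zs. mset (f x))" for zs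
    by (induction zs) auto
  show ?thesis using assms unfolding eq by (metis image_mset_union sum_mset.union
      mset_subset_eq_add_left subset_mset.le_iff_add)
qed

lemma mset_concat_map_member: "x \<in> set xs \<Longrightarrow> mset (f x) \<subseteq># mset (concat (map f xs))"
  by (metis concat.simps(1) concat.simps(2) append_Nil2 list.simps(8) list.simps(9)
      mset_concat_map_subset mset_subset_eq_single mset_single_iff_right set_mset_mset)

text \<open>
  A letter \<open>x\<close> that reproduces itself after \<open>d\<close> steps has \<open>f\<^sup>m(x)\<close> contained in \<open>f\<^sup>m\<^sup>+\<^sup>d(x)\<close>;
  any other letter leaves its set of reachable letters after one step.
\<close>

lemma iter_morphism_mset_mono:
  assumes fin: "finite X" and closed: "\<And>x. x \<in> X \<Longrightarrow> set (f x) \<subseteq> X"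
  shows "\<exists>P>0. \<forall>m\<ge>card X. \<forall>x\<in>X. \<forall>k.
           mset (iter_morphism f m x) \<subseteq># mset (iter_morphism f (m + k * P) x)"
proof -
  \<comment> \<open>A return time of \<open>x\<close> if there is one; the second disjunct makes the
    choice possible for letters that never return.\<close>
  define d where "d x = (SOME d. d > 0 \<and> (x \<in> set (iter_morphism f d x) \<or>
    (\<forall>d'>0. x \<notin> set (iter_morphism f d' x))))" for x
  have d: "d x > 0 \<and> (x \<in> set (iter_morphism f (d x) x) \<or> (\<forall>d'>0. x \<notin> set (iter_morphism f d' x)))" for x
    unfolding d_def by (rule someI_ex) (metis zero_less_one)
  \<comment> \<open>A common multiple of all return times.\<close>
  define P where "P = prod d X"
  have P0: "P > 0" using d by (simp add: P_def prod_pos)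
  define R where "R x = {y. \<exists>m. y \<in> set (iter_morphism f m x)}" for x
  have inX: "set (iter_morphism f m x) \<subseteq> X" if "x \<in> X" for m x
    using that
  proof (induction m arbitrary: x)
    case (Suc m)
    then show ?case using closed by fastforce
  qed simp
  then have RX: "R x \<subseteq> X" if "x \<in> X" for x using that by (auto simp: R_def)
  have R_self: "x \<in> R x" for x unfolding R_def by (auto intro: exI[of _ 0])
  have R_step: "R y \<subseteq> R x" if y: "y \<in> set (f x)" for x y
  proof
    fix w assume "w \<in> R y"
    then obtain m where "w \<in> set (iter_morphism f m y)" by (auto simp: R_def)
    then have "w \<in> set (iter_morphism f (Suc m) x)" using y by auto
    then show "w \<in> R x" unfolding R_def by blast
  qed
  have cyc: "x \<in> set (iter_morphism f (j * e) x)" if "x \<in> set (iter_morphism f e x)" for x j e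
  proof (induction j)
    case (Suc j)
    have "x \<in> set (iter_morphism f (e + j * e) x)"
      using Suc that by (auto simp: iter_morphism_add)
    then show ?case by (simp add: algebra_simps)
  qed simp
  have "mset (iter_morphism f m x) \<subseteq># mset (iter_morphism f (m + k * P) x)"
    if "x \<in> X" "card (R x) \<le> m" for m x k
    using that
  \<comment> \<open>Passing through a letter that never returns uses up one unit of \<open>m\<close>
    and shrinks \<open>R x\<close>, so \<open>card (R x) \<le> m\<close> is enough.\<close>
  proof (induction "card (R x)" arbitrary: x m rule: less_induct)
    case less
    show ?case
    proof (cases "\<exists>d'>0. x \<in> set (iter_morphism f d' x)")
      case True
      then have "x \<in> set (iter_morphism f (d x) x)" using d by blast
      moreover have "d x dvd P" unfolding P_def using less.prems fin by (intro dvd_prodI)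
      then obtain j where "k * P = j * d x" by (metis dvd_def dvd_mult mult.commute)
      ultimately have "x \<in> set (iter_morphism f (k * P) x)" using cyc by simp
      then have "mset (iter_morphism f m x) \<subseteq># mset (iter_morphism f (k * P + m) x)"
        unfolding iter_morphism_add by (rule mset_concat_map_member)
      then show ?thesis by (simp add: add.commute)
    next
      case False
      have "card (R x) > 0" using R_self RX[OF less.prems(1)] fin
        by (metis card_gt_0_iff empty_iff finite_subset)
      then obtain m' where m': "m = Suc m'" using less.prems by (metis Suc_le_D Suc_leI)
      have "mset (iter_morphism f m' y) \<subseteq># mset (iter_morphism f (m' + k * P) y)"
        if y: "y \<in> set (f x)" for y
      proof -
        have "x \<notin> R y"
        proof
          assume "x \<in> R y"
          then obtain n where "x \<in> set (iter_morphism f n y)" by (auto simp: R_def)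
          then have "x \<in> set (iter_morphism f (Suc n) x)" using y by auto
          then show False using False by blast
        qed
        then have "R y \<subset> R x" using R_step[OF y] R_self[of x] by blast
        then have "card (R y) < card (R x)"
          using RX[OF less.prems(1)] fin by (meson psubset_card_mono finite_subset)
        moreover have "y \<in> X" using closed[OF less.prems(1)] y by blast
        ultimately show ?thesis using less.hyps[of y m'] less.prems m' by simp
      qed
      then show ?thesis by (simp add: m' mset_concat_map_mono)
    qed
  qed
  moreover have "card (R x) \<le> card X" if "x \<in> X" for x using RX[OF that] fin card_mono by blast
  ultimately show ?thesis using P0 by (meson order_trans)
qed


section \<open>Canonical derivations in a single table\<close>

definition tder :: "('r, 'a) table \<Rightarrow> 'a set \<Rightarrow> nat \<Rightarrow> 'a list \<Rightarrow> 'a list \<Rightarrow> bool" where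
  "tder h \<Delta> t u x \<longleftrightarrow> x \<in> lists \<Delta> \<and> ders (replicate t h) u x"

lemma tder_0: "tder h \<Delta> 0 u x \<longleftrightarrow> u \<in> lists \<Delta> \<and> x = u"
  by (auto simp: tder_def)

lemma tder_Suc: "tder h \<Delta> (Suc t) u x \<longleftrightarrow> (\<exists>y\<in>subst_word h u. tder h \<Delta> t y x)"
  by (auto simp: tder_def)

lemma tder_list_all2:
  "tder h \<Delta> t u x \<longleftrightarrow> (\<exists>zs. x = concat zs \<and> list_all2 (\<lambda>a. tder h \<Delta> t [a]) u zs)"
proof -
  have "list_all2 (\<lambda>a. tder h \<Delta> t [a]) u zs \<longleftrightarrow>
      concat zs \<in> lists \<Delta> \<and> list_all2 (\<lambda>a. ders (replicate t h) [a]) u zs" for zs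
    by (induction zs arbitrary: u) (auto simp: tder_def list_all2_Cons2)
  then show ?thesis unfolding tder_def ders_list_all2[of "replicate t h" u] by blast
qed

text \<open>The letters that derive a terminal word in exactly \<open>t\<close> steps, computed
  backwards: each set is a function of the preceding one alone.\<close>

primrec alive :: "('r, 'a) table \<Rightarrow> 'a set \<Rightarrow> nat \<Rightarrow> 'a set" where
  "alive h \<Delta> 0 = \<Delta>"
| "alive h \<Delta> (Suc t) = {a. \<exists>u\<in>subst_letter h a. u \<in> lists (alive h \<Delta> t)}"

text \<open>The choice depends on the set \<open>V\<close> and not on the number of remaining steps,
  so that periodicity of \<open>alive\<close> carries over to the selected productions.\<close>

definition select_rhs :: "('r, 'a) table \<Rightarrow> 'a set \<Rightarrow> 'a \<Rightarrow> 'a list" where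
  "select_rhs h V a = (SOME u. u \<in> subst_letter h a \<and> u \<in> lists V)"

primrec canonical :: "('r, 'a) table \<Rightarrow> 'a set \<Rightarrow> nat \<Rightarrow> 'a \<Rightarrow> 'a list" where
  "canonical h \<Delta> 0 a = [a]"
| "canonical h \<Delta> (Suc t) a = concat (map (canonical h \<Delta> t) (select_rhs h (alive h \<Delta> t) a))"

lemma select_rhs:
  assumes "a \<in> alive h \<Delta> (Suc t)"
  shows "select_rhs h (alive h \<Delta> t) a \<in> subst_letter h a" "select_rhs h (alive h \<Delta> t) a \<in> lists (alive h \<Delta> t)"
proof -
  have "\<exists>u. u \<in> subst_letter h a \<and> u \<in> lists (alive h \<Delta> t)" using assms by auto
  then show "select_rhs h (alive h \<Delta> t) a \<in> subst_letter h a"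
    "select_rhs h (alive h \<Delta> t) a \<in> lists (alive h \<Delta> t)"
    unfolding select_rhs_def by (metis (mono_tags, lifting) someI_ex)+
qed

lemma tder_alive: "tder h \<Delta> t u x \<Longrightarrow> u \<in> lists (alive h \<Delta> t)"
proof (induction t arbitrary: u)
  case 0
  then show ?case by (simp add: tder_0)
next
  case (Suc t)
  then obtain y where y: "y \<in> subst_word h u" "y \<in> lists (alive h \<Delta> t)" by (auto simp: tder_Suc)
  then show ?case
  proof (induction u arbitrary: y)
    case (Cons a u)
    then obtain v w where "y = v @ w" "v \<in> subst_letter h a" "w \<in> subst_word h u" by auto
    with Cons show ?case by (auto simp del: in_lists_conv_set simp: in_lists_conv_set[of "_ @ _"])
  qed simp
qed

lemma tder_canonical:
  "u \<in> lists (alive h \<Delta> t) \<Longrightarrow> tder h \<Delta> t u (concat (map (canonical h \<Delta> t) u))"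
proof (induction t arbitrary: u)
  case 0
  then show ?case by (simp add: tder_0)
next
  case (Suc t)
  have "tder h \<Delta> (Suc t) [a] (canonical h \<Delta> (Suc t) a)" if a: "a \<in> set u" for a
  proof -
    have "a \<in> alive h \<Delta> (Suc t)" using a Suc.prems by auto
    note c = select_rhs[OF this]
    show ?thesis unfolding tder_Suc
      using c(1) Suc.IH[OF c(2)] by (intro bexI[of _ "select_rhs h (alive h \<Delta> t) a"]) simp_all
  qed
  then have "list_all2 (\<lambda>a. tder h \<Delta> (Suc t) [a]) u (map (canonical h \<Delta> (Suc t)) u)"
    by (simp add: list_all2_conv_all_nth)
  then show ?case unfolding tder_list_all2[of _ _ _ u] by blast
qed

text \<open>There are finitely many subsets of \<open>\<Sigma>\<close>, and each set of alive
  letters determines the next; so the sequence runs into a cycle.\<close>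

lemma alive_periodic:
  assumes "finite \<Sigma>" "h \<subseteq> UNIV \<times> \<Sigma> \<times> lists \<Sigma>" "\<Delta> \<subseteq> \<Sigma>"
  shows "\<exists>t0 p. p > 0 \<and> (\<forall>m. alive h \<Delta> (t0 + m) = alive h \<Delta> (t0 + m mod p))"
proof -
  have sub: "alive h \<Delta> t \<subseteq> \<Sigma>" for t
    using assms(2,3) by (cases t) (auto simp: subst_letter_def)
  have "range (alive h \<Delta>) \<subseteq> Pow \<Sigma>" using sub by blast
  moreover have "finite (Pow \<Sigma>)" using assms(1) by simp
  ultimately have "finite (range (alive h \<Delta>))" by (rule finite_subset)
  then have "\<not> inj (alive h \<Delta>)" by (metis finite_imageD infinite_UNIV_nat)
  then obtain t0 t1 where t: "t0 < t1" "alive h \<Delta> t0 = alive h \<Delta> t1"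
    unfolding inj_def by (metis linorder_neqE_nat)
  define p where "p = t1 - t0"
  have "alive h \<Delta> (t0 + p + m) = alive h \<Delta> (t0 + m)" for m
    using t by (induction m) (simp_all add: p_def)
  then have "alive h \<Delta> (t0 + (q * p + r)) = alive h \<Delta> (t0 + r)" for q r
    by (induction q) (simp_all add: add.assoc)
  then have "alive h \<Delta> (t0 + m) = alive h \<Delta> (t0 + m mod p)" for m
    by (metis div_mult_mod_eq)
  then show ?thesis using t by (intro exI[of _ t0] exI[of _ p]) (simp add: p_def)
qed

text \<open>Canonical derivations use different productions at different times, but only
  periodically many. Attaching to each letter the residue of the remaining steps turns them into one
  iterated morphism, to which \<open>iter_morphism_mset_mono\<close> applies.\<close>

lemma canonical_mset_mono:
  assumes fin: "finite \<Sigma>" and h: "h \<subseteq> UNIV \<times> \<Sigma> \<times> lists \<Sigma>" and \<Delta>: "\<Delta> \<subseteq> \<Sigma>"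
  shows "\<exists>P>0. \<exists>T. \<forall>t\<ge>T. \<forall>k. \<forall>u\<in>lists (alive h \<Delta> t).
    mset (concat (map (canonical h \<Delta> t) u)) \<subseteq># mset (concat (map (canonical h \<Delta> (t + k * P)) u))"
proof -
  obtain t0 p where p: "p > 0" and per: "\<And>m. alive h \<Delta> (t0 + m) = alive h \<Delta> (t0 + m mod p)"
    using alive_periodic[OF assms] by blast
  \<comment> \<open>Residues are counted down cyclically, since the number of remaining steps
    decreases along a derivation.\<close>
  define pred where "pred r = (if r = 0 then p - 1 else r - 1)" for r
  define f where "f = (\<lambda>(a, r). map (\<lambda>b. (b, pred r)) (select_rhs h (alive h \<Delta> (t0 + pred r)) a))"
  define X where "X = {(a, r). r < p \<and> a \<in> alive h \<Delta> (t0 + r)}"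
  have sub: "alive h \<Delta> t \<subseteq> \<Sigma>" for t
    using h \<Delta> by (cases t) (auto simp: subst_letter_def)
  have "X \<subseteq> \<Sigma> \<times> {..<p}" using sub by (auto simp: X_def)
  then have finX: "finite X" using fin finite_subset by blast
  have pred_mod: "pred (Suc m mod p) = m mod p" for m
  proof (cases "Suc (m mod p) = p")
    case True
    then show ?thesis by (simp add: pred_def mod_Suc)
  qed (simp add: pred_def mod_Suc)
  have closed: "set (f x) \<subseteq> X" if "x \<in> X" for x
  proof -
    obtain a r where x: "x = (a, r)" by (cases x)
    then have ar: "r < p" "a \<in> alive h \<Delta> (t0 + r)" using that by (simp_all add: X_def)
    \<comment> \<open>Some number with \<open>Suc m mod p = r\<close>; the summand \<open>p\<close>
      avoids truncated subtraction at \<open>r = 0\<close>.\<close>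
    define m where "m = p + r - 1"
    have m: "Suc m mod p = r" using ar p by (simp add: m_def)
    then have pr: "pred r = m mod p" using pred_mod[of m] by simp
    have "alive h \<Delta> (t0 + Suc m) = alive h \<Delta> (t0 + r)" using per[of "Suc m"] m by simp
    then have "a \<in> alive h \<Delta> (Suc (t0 + m))" using ar by simp
    from select_rhs(2)[OF this] per[of m] pr p show ?thesis
      by (auto simp: x f_def X_def)
  qed
  \<comment> \<open>The morphism covers all but the last \<open>t0\<close> steps, during which the
    sets of alive letters need not follow the cycle.\<close>
  have can: "canonical h \<Delta> (t0 + m) a =
      concat (map (canonical h \<Delta> t0 \<circ> fst) (iter_morphism f m (a, m mod p)))" for m a
  proof (induction m arbitrary: a)
    case (Suc m)
    have "iter_morphism f (Suc m) (a, Suc m mod p) = concat (map (\<lambda>b. iter_morphism f m (b, m mod p))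
        (select_rhs h (alive h \<Delta> (t0 + m)) a))"
      by (simp add: f_def pred_mod per[of m] o_def)
    moreover have "canonical h \<Delta> (t0 + m) =
        (\<lambda>a. concat (map (canonical h \<Delta> t0 \<circ> fst) (iter_morphism f m (a, m mod p))))"
      using Suc by blast
    ultimately show ?case by (simp only: add_Suc_right canonical.simps concat_map_concat_map)
  qed simp
  have "\<exists>P>0. \<forall>m\<ge>card X. \<forall>x\<in>X. \<forall>k.
      mset (iter_morphism f m x) \<subseteq># mset (iter_morphism f (m + k * P) x)"
    by (rule iter_morphism_mset_mono[OF finX]) (rule closed)
  then obtain P where P: "P > 0" "\<forall>m\<ge>card X. \<forall>x\<in>X. \<forall>k.
      mset (iter_morphism f m x) \<subseteq># mset (iter_morphism f (m + k * P) x)"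
    by (elim exE conjE)
  \<comment> \<open>The additional factor \<open>p\<close> preserves the residue and hence the
    letter from which the morphism starts.\<close>
  have "mset (concat (map (canonical h \<Delta> t) u)) \<subseteq># mset (concat (map (canonical h \<Delta> (t + k * (P * p))) u))"
    if t: "t \<ge> t0 + card X" and u: "u \<in> lists (alive h \<Delta> t)" for t k u
  proof (rule mset_concat_map_mono)
    fix a assume "a \<in> set u"
    define m where "m = t - t0"
    have tm: "t = t0 + m" "m \<ge> card X" using t by (simp_all add: m_def)
    have "(a, m mod p) \<in> X"
      using u \<open>a \<in> set u\<close> per[of m] p by (auto simp: X_def tm)
    then have "mset (iter_morphism f m (a, m mod p)) \<subseteq>#
        mset (iter_morphism f (m + (k * p) * P) (a, m mod p))"
      using P(2) tm(2) by simp
    moreover have "(m + (k * p) * P) mod p = m mod p"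
      by (metis mod_mult_self2 mult.commute mult.left_commute)
    moreover have "t + k * (P * p) = t0 + (m + (k * p) * P)" using tm by simp
    ultimately show "mset (canonical h \<Delta> t a) \<subseteq># mset (canonical h \<Delta> (t + k * (P * p)) a)"
      unfolding tm(1) can by (metis can tm(1) mset_concat_map_subset)
  qed
  moreover have "P * p > 0" using P(1) p by simp
  ultimately show ?thesis by blast
qed


section \<open>A language that is not E0L\<close>

definition word3 :: "'a \<Rightarrow> 'a list \<Rightarrow> 'a list" where
  "word3 c w = w @ [c] @ w @ [c] @ w"

lemma takeWhile_word3: "c \<notin> set w \<Longrightarrow> takeWhile (\<lambda>y. y \<noteq> c) (word3 c w) = w"
proof -
  assume "c \<notin> set w"
  then have "takeWhile (\<lambda>y. y \<noteq> c) (w @ [c] @ w @ [c] @ w) = w @ takeWhile (\<lambda>y. y \<noteq> c) ([c] @ w @ [c] @ w)"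
    by (intro takeWhile_append2) auto
  then show ?thesis by (simp add: word3_def)
qed

lemma rev_word3: "rev (word3 c w) = word3 c (rev w)"
  by (simp add: word3_def)

lemma count_word3: "c \<notin> set w \<Longrightarrow> count_list (word3 c w) c = 2"
  by (simp add: word3_def)

text \<open>With at most one \<open>c\<close> inside \<open>m\<close>, a \<open>c\<close> occurs in
  \<open>p\<close> or in \<open>s\<close>. Then \<open>w\<close> can be read off as the beginning of
  \<open>p\<close> up to its first \<open>c\<close>, or as the end of \<open>s\<close> after its
  last one.\<close>

lemma word3_context_unique:
  assumes w: "c \<notin> set w" "c \<notin> set w'"
    and eq: "word3 c w = p @ m @ s" "word3 c w' = p @ m' @ s"
    and m: "count_list m c \<le> 1"
  shows "m = m'"
proof -
  have "count_list p c + count_list m c + count_list s c = 2"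
    using count_word3[OF w(1)] unfolding eq by simp
  then have "count_list p c \<noteq> 0 \<or> count_list s c \<noteq> 0" using m by linarith
  then consider "c \<in> set p" | "c \<in> set s" by (auto simp: count_list_0_iff)
  then have "w = w'"
  proof cases
    case 1
    then have "takeWhile (\<lambda>y. y \<noteq> c) (p @ q) = takeWhile (\<lambda>y. y \<noteq> c) p" for q
      by (simp add: takeWhile_append1)
    then show ?thesis using takeWhile_word3[OF w(1)] takeWhile_word3[OF w(2)] unfolding eq by metis
  next
    case 2
    then have t: "takeWhile (\<lambda>y. y \<noteq> c) (rev s @ q) = takeWhile (\<lambda>y. y \<noteq> c) (rev s)" for q
      by (simp add: takeWhile_append1)
    have "takeWhile (\<lambda>y. y \<noteq> c) (rev (word3 c w)) = rev w"
      "takeWhile (\<lambda>y. y \<noteq> c) (rev (word3 c w')) = rev w'"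
      using w by (simp_all add: rev_word3 takeWhile_word3)
    then have "rev w = rev w'" unfolding eq using t by simp
    then show ?thesis by simp
  qed
  then show ?thesis using eq by simp
qed

text \<open>As both separators lie in \<open>z\<close>, \<open>U\<close> is a prefix of the first
  copy of \<open>w\<close> and \<open>V\<close> a suffix of the last. So \<open>z\<close> keeps at
  least the middle one of three copies.\<close>

lemma word3_factor_counts:
  assumes c: "c \<notin> set w" and eq: "word3 c w = U @ z @ V" and z: "count_list z c = 2" and d: "d \<noteq> c"
  shows "count_list w d \<le> count_list z d" "count_list z d \<le> 3 * count_list w d"
proof -
  have total: "count_list U x + count_list z x + count_list V x = count_list (word3 c w) x" for x
    unfolding eq by simp
  have "c \<notin> set U" "c \<notin> set V"
    using total[of c] z count_word3[OF c] by (auto simp flip: count_list_0_iff)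
  have "w = U @ takeWhile (\<lambda>y. y \<noteq> c) (z @ V)"
    using takeWhile_word3[OF c] \<open>c \<notin> set U\<close> unfolding eq by (subst (asm) takeWhile_append2) auto
  then have "count_list U d \<le> count_list w d" by (metis count_list_append le_add1)
  moreover have "takeWhile (\<lambda>y. y \<noteq> c) (rev (word3 c w)) = rev w"
    using c by (simp add: rev_word3 takeWhile_word3)
  then have "rev w = rev V @ takeWhile (\<lambda>y. y \<noteq> c) (rev z @ rev U)"
    using \<open>c \<notin> set V\<close> unfolding eq rev_append append_assoc
    by (subst (asm) takeWhile_append2) auto
  then have "count_list V d \<le> count_list w d" by (metis count_list_append count_list_rev le_add1)
  moreover have "count_list (word3 c w) d = 3 * count_list w d" using d by (simp add: word3_def)
  ultimately show "count_list w d \<le> count_list z d" "count_list z d \<le> 3 * count_list w d"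
    using total[of d] by linarith+
qed

text \<open>
  Follow the derivation downwards as long as a single letter produces both occurrences of \<open>c\<close>.
  Below the point where they separate, every letter leaves a \<open>c\<close> outside of the factor it produces,
  so that this factor is determined by the rest of the word.
\<close>

lemma word3_unique_factor:
  assumes W: "\<And>w. w \<in> W \<Longrightarrow> c \<notin> set w"
    and Y: "\<And>a y. y \<in> subst_letter h a \<Longrightarrow> y \<in> Y"
    and "u \<in> Y" "\<And>x. tder h \<Delta> t u x \<Longrightarrow> U @ x @ V \<in> word3 c ` W"
    and "tder h \<Delta> t u z" "count_list z c = 2"
  shows "\<exists>U' V' y t' z'. U @ z @ V = U' @ z' @ V' \<and> y \<in> Y \<and> count_list z' c = 2 \<and>
           tder h \<Delta> t' y z' \<and> (\<forall>x. tder h \<Delta> t' y x \<longrightarrow> x = z')"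
  using assms(3-)
proof (induction t arbitrary: u U V z rule: less_induct)
  case (less t)
  obtain zs where z: "z = concat zs" and zs: "list_all2 (\<lambda>a. tder h \<Delta> t [a]) u zs"
    using less.prems(3) unfolding tder_list_all2[of h \<Delta> t u] by blast
  have len: "length zs = length u" using zs by (simp add: list_all2_lengthD)
  have upd: "concat (zs[i := x]) = concat (take i zs) @ x @ concat (drop (Suc i) zs)"
    if "i < length zs" for i x
    using that by (simp add: upd_conv_take_nth_drop)
  have z_i: "z = concat (take i zs) @ zs ! i @ concat (drop (Suc i) zs)" if "i < length zs" for i
    using upd[OF that, of "zs ! i"] by (simp add: z)
  have der: "tder h \<Delta> t u (concat (zs[i := x]))" if "i < length zs" "tder h \<Delta> t [u ! i] x" for i x
    unfolding tder_list_all2[of h \<Delta> t u]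
    using list_all2_update_cong[OF zs, of "u ! i" x i] that(2) by (intro exI[of _ "zs[i := x]"]) simp
  define U' where "U' i = U @ concat (take i zs)" for i
  define V' where "V' i = concat (drop (Suc i) zs) @ V" for i
  have in_K: "U' i @ x @ V' i \<in> word3 c ` W" if "i < length zs" "tder h \<Delta> t [u ! i] x" for i x
    using less.prems(2)[OF der[OF that]] upd[OF that(1), of x] by (simp add: U'_def V'_def)
  have zs_i: "tder h \<Delta> t [u ! i] (zs ! i)" if "i < length zs" for i
    using zs that len by (simp add: list_all2_conv_all_nth)
  have cnt: "count_list (zs ! i) c \<le> 2" if "i < length zs" for i
    using z_i[OF that] less.prems(4) by simp
  show ?case
  proof (cases "\<exists>i<length zs. count_list (zs ! i) c = 2")
    case True
    then obtain i where i: "i < length zs" "count_list (zs ! i) c = 2" by blast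
    show ?thesis
    proof (cases t)
      \<comment> \<open>With no step left, the factor is the letter itself, too short for two
        occurrences of \<open>c\<close>.\<close>
      case 0
      then have "zs ! i = [u ! i]" using zs_i[OF i(1)] by (simp add: tder_0)
      then show ?thesis using i(2) by (simp split: if_splits)
    next
      case (Suc t')
      obtain y where y: "y \<in> subst_letter h (u ! i)" "tder h \<Delta> t' y (zs ! i)"
        using zs_i[OF i(1)] unfolding Suc tder_Suc by auto
      have "\<exists>U'' V'' y' t'' z'. U' i @ zs ! i @ V' i = U'' @ z' @ V'' \<and> y' \<in> Y \<and> count_list z' c = 2 \<and>
           tder h \<Delta> t'' y' z' \<and> (\<forall>x. tder h \<Delta> t'' y' x \<longrightarrow> x = z')"
      proof (rule less.IH)
        show "U' i @ x @ V' i \<in> word3 c ` W" if "tder h \<Delta> t' y x" for x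
          using that y(1) by (intro in_K[OF i(1)]) (auto simp: Suc tder_Suc)
      qed (use Suc y i Y in auto)
      then show ?thesis using z_i[OF i(1)] by (simp add: U'_def V'_def)
    qed
  next
    case False
    \<comment> \<open>Exchanging a single factor of \<open>z\<close> for that of \<open>x\<close>
      stays in the language, and a factor with at most one \<open>c\<close> is then fixed by its
      context.\<close>
    have "x = z" if x: "tder h \<Delta> t u x" for x
    proof -
      obtain xs where xs: "x = concat xs" "list_all2 (\<lambda>a. tder h \<Delta> t [a]) u xs"
        using x unfolding tder_list_all2[of h \<Delta> t u] by blast
      have "xs ! i = zs ! i" if i: "i < length zs" for i
      proof -
        have "tder h \<Delta> t [u ! i] (xs ! i)" using xs(2) i len by (simp add: list_all2_conv_all_nth)
        then obtain w w' where "w \<in> W" "w' \<in> W" "word3 c w = U' i @ zs ! i @ V' i"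
          "word3 c w' = U' i @ xs ! i @ V' i"
          using in_K[OF i] zs_i[OF i] by (metis imageE)
        moreover have "count_list (zs ! i) c \<le> 1" using cnt[OF i] False i by fastforce
        ultimately show ?thesis using word3_context_unique W by metis
      qed
      moreover have "length xs = length zs" using xs(2) len by (simp add: list_all2_lengthD)
      ultimately have "xs = zs" by (simp add: list_eq_iff_nth_eq)
      then show ?thesis using xs z by simp
    qed
    then show ?thesis using less.prems by blast
  qed
qed

lemma word3_not_E0L:
  fixes h :: "('r, 'a) table"
  assumes fin: "finite \<Sigma>" "finite h" and h: "h \<subseteq> UNIV \<times> \<Sigma> \<times> lists \<Sigma>" and \<Delta>: "\<Delta> \<subseteq> \<Sigma>"
    and dist: "a \<noteq> b" "c \<noteq> a" "c \<noteq> b"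
  shows "{x \<in> lists \<Delta>. \<exists>t. ders (replicate t h) \<omega> x} \<noteq>
           word3 c ` {replicate i a @ replicate j b | i j. True}"
proof
  let ?W = "{replicate i a @ replicate j b | i j. True}"
  assume K: "{x \<in> lists \<Delta>. \<exists>t. ders (replicate t h) \<omega> x} = word3 c ` ?W"
  define Y where "Y = insert \<omega> ((snd \<circ> snd) ` h)"
  have finY: "finite Y" using fin by (simp add: Y_def)
  have Y: "y \<in> Y" if "y \<in> subst_letter h a" for a y
    using that by (force simp: Y_def subst_letter_def)
  have c_W: "c \<notin> set w" if "w \<in> ?W" for w using that dist by auto
  have tK: "x \<in> word3 c ` ?W \<longleftrightarrow> (\<exists>t. tder h \<Delta> t \<omega> x)" for x
    unfolding tder_def using K by blast
  from canonical_mset_mono[OF fin(1) h \<Delta>]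
  obtain P T where P: "P > 0" and mono': "\<forall>t\<ge>T. \<forall>k. \<forall>u\<in>lists (alive h \<Delta> t).
    mset (concat (map (canonical h \<Delta> t) u)) \<subseteq># mset (concat (map (canonical h \<Delta> (t + k * P)) u))"
    by (elim exE conjE)
  note mono = mono'[rule_format]
  \<comment> \<open>The number of classes distinguished by \<open>cls\<close> below. The
    \<open>R + 1\<close> words \<open>w e\<close> form an antichain that survives counting errors up
    to the factor 3 of \<open>word3_factor_counts\<close>, because neighbouring powers differ by the
    factor 4.\<close>
  define R where "R = card Y * (T + P)"
  define w where "w e = replicate (4 ^ e) a @ replicate (4 ^ (R - e)) b" for e
  have cw: "c \<notin> set (w e)" for e using dist by (simp add: w_def)
  have "\<exists>U V y t z. word3 c (w e) = U @ z @ V \<and> y \<in> Y \<and> count_list z c = 2 \<and>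
          tder h \<Delta> t y z \<and> (\<forall>x. tder h \<Delta> t y x \<longrightarrow> x = z)" for e
  proof -
    have "word3 c (w e) \<in> word3 c ` ?W" by (auto simp: w_def)
    then obtain t where t: "tder h \<Delta> t \<omega> (word3 c (w e))" using tK by blast
    have "\<exists>U V y t z. [] @ word3 c (w e) @ [] = U @ z @ V \<and> y \<in> Y \<and> count_list z c = 2 \<and>
          tder h \<Delta> t y z \<and> (\<forall>x. tder h \<Delta> t y x \<longrightarrow> x = z)"
    proof (rule word3_unique_factor[where W = ?W])
      show "[] @ x @ [] \<in> word3 c ` ?W" if "tder h \<Delta> t \<omega> x" for x
        using tK that by auto
    qed (use c_W Y t count_word3[OF cw] in \<open>auto simp: Y_def\<close>)
    then show ?thesis by simp
  qed
  then obtain U V y t z where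
    fac: "\<And>e. word3 c (w e) = U e @ z e @ V e" and y: "\<And>e. y e \<in> Y" and cz: "\<And>e. count_list (z e) c = 2"
    and z: "\<And>e. tder h \<Delta> (t e) (y e) (z e)" and uniq: "\<And>e x. tder h \<Delta> (t e) (y e) x \<Longrightarrow> x = z e"
    by metis
  \<comment> \<open>Being the only possible result, \<open>z e\<close> is the canonical one, so it
    depends on \<open>y e\<close> and \<open>t e\<close> alone.\<close>
  have can: "z e = concat (map (canonical h \<Delta> (t e)) (y e))" for e
    using uniq[OF tder_canonical[OF tder_alive[OF z]], of e] by simp
  \<comment> \<open>Equal classes mean equal \<open>y\<close>, and numbers of steps that are equal
    or at least \<open>T\<close> with difference divisible by \<open>P\<close>, so that
    \<open>mono\<close> compares the factors.\<close>
  define cls where "cls e = (y e, if t e < T then t e else T + t e mod P)" for e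
  have "cls ` {..R} \<subseteq> Y \<times> {..<T + P}" using y P by (auto simp: cls_def)
  then have "card (cls ` {..R}) \<le> R"
    using card_mono[of "Y \<times> {..<T + P}" "cls ` {..R}"] finY by (simp add: R_def card_cartesian_product)
  then have "\<not> inj_on cls {..R}" using card_image[of cls "{..R}"] by force
  then obtain e1 e2 where "e1 \<le> R" "e2 \<le> R" "e1 < e2" "cls e1 = cls e2"
    unfolding inj_on_def by (metis atMost_iff linorder_neqE_nat)
  have comparable: "mset (z e) \<subseteq># mset (z e')" if "cls e = cls e'" "t e \<le> t e'" for e e'
  proof (cases "t e = t e'")
    case True
    then show ?thesis using can[of e] can[of e'] that by (simp add: cls_def)
  next
    case False
    have ye: "y e = y e'" using that(1) by (simp add: cls_def)
    have T: "t e \<ge> T" "t e mod P = t e' mod P"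
      using that False by (auto simp: cls_def split: if_splits)
    then have "P dvd t e' - t e" using that(2) by (metis mod_eq_dvd_iff_nat)
    then obtain k where "t e' = t e + k * P"
      using \<open>t e \<le> t e'\<close> by (metis dvd_div_mult_self le_add_diff_inverse)
    then show ?thesis using mono[OF T(1) tder_alive[OF z], of k] can[of e] can[of e'] ye by simp
  qed
  have count_le: "count_list (z e) d \<le> count_list (z e') d" if "mset (z e) \<subseteq># mset (z e')" for e e' d
    using mset_subset_eq_count[OF that, of d] by (simp add: count_mset)
  have bnd: "count_list (w e) d \<le> count_list (z e) d" "count_list (z e) d \<le> 3 * count_list (w e) d"
    if "d \<noteq> c" for e d
    using word3_factor_counts[OF cw fac cz that] by blast+
  have rep: "count_list (replicate n x) d = (if x = d then n else 0)" for n x d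
    by (induction n) auto
  have wa: "count_list (w e) a = 4 ^ e" and wb: "count_list (w e) b = 4 ^ (R - e)" for e
    using dist by (simp_all add: w_def rep)
  have pow: "3 * (4::nat) ^ m < 4 ^ n" if "m < n" for m n
  proof -
    have "(4::nat) ^ Suc m \<le> 4 ^ n" using that by (intro power_increasing) auto
    moreover have "3 * (4::nat) ^ m < 4 ^ Suc m" by simp
    ultimately show ?thesis by linarith
  qed
  show False
  proof (cases "t e1 \<le> t e2")
    case True
    then have "count_list (z e1) b \<le> count_list (z e2) b"
      using comparable \<open>cls e1 = cls e2\<close> count_le by blast
    then have "4 ^ (R - e1) \<le> 3 * (4::nat) ^ (R - e2)"
      using bnd[of b] dist wb by (metis order_trans)
    then show False using pow[of "R - e2" "R - e1"] \<open>e1 < e2\<close> \<open>e2 \<le> R\<close> by linarith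
  next
    case False
    then have "count_list (z e2) a \<le> count_list (z e1) a"
      using comparable[of e2 e1] \<open>cls e1 = cls e2\<close> count_le by simp
    then have "4 ^ e2 \<le> 3 * (4::nat) ^ e1"
      using bnd[of a] dist wa by (metis order_trans)
    then show False using pow[of e1 e2] \<open>e1 < e2\<close> by linarith
  qed
qed

section \<open>The same language generated by an ET0L system\<close>

lemma subst_word_deterministic:
  assumes "\<And>a. a \<in> set w \<Longrightarrow> subst_letter h a = {g a}"
  shows "subst_word h w = {concat (map g w)}"
  using assms by (induction w) auto

lemma FET0L_not_FE0L: "\<exists>F :: 'a::infinite fuzzy_language. F \<in> FET0L \<and> F \<notin> FE0L"
proof -
  obtain a :: 'a where True by simp
  obtain b where b: "b \<notin> {a}" using ex_new_if_finite[OF infinite_UNIV] finite.emptyI finite_insert by metis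
  obtain c where c: "c \<notin> {a, b}" using ex_new_if_finite[OF infinite_UNIV] finite.emptyI finite_insert by metis
  obtain s where s: "s \<notin> {a, b, c}" using ex_new_if_finite[OF infinite_UNIV] finite.emptyI finite_insert by metis
  \<comment> \<open>The labels of table \<open>i\<close> start at \<open>4 * i\<close>, which makes
    the label sets disjoint. All three occurrences of \<open>s\<close> always meet the same table,
    so the three copies grow in parallel.\<close>
  define tab :: "nat \<Rightarrow> 'a list \<Rightarrow> (nat, 'a) table" where
    "tab i u = {(4 * i, s, u), (4 * i + 1, a, [a]), (4 * i + 2, b, [b]), (4 * i + 3, c, [c])}" for i u
  define H where "H = {tab 0 [a, s], tab 1 [s, b], tab 2 []}"
  define \<omega> where "\<omega> = word3 c [s]"
  define J where "J = (\<Union>h\<in>H. fst ` h)"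
  define \<Sigma> where "\<Sigma> = {s, a, b, c}"
  define F where "F = fuzzy_language_ET0L H \<omega> J (\<lambda>_. 1) {a, b, c}"
  have tab0L: "fuzzy_0L \<Sigma> (tab i u) \<omega> (fst ` tab i u) (\<lambda>_. 1)" if "u \<in> lists \<Sigma>" for i u
    using that by (auto simp: fuzzy_0L_def graded_labelling_def tab_def \<Sigma>_def \<omega>_def word3_def inj_on_def)
  have tab_fst: "fst ` tab i u = {4 * i, 4 * i + 1, 4 * i + 2, 4 * i + 3}" for i u
    by (auto simp: tab_def)
  have "fst ` tab i u \<inter> fst ` tab j v = {}" if "i \<noteq> j" for i j u v
    using that unfolding tab_fst by auto
  then have "fuzzy_T0L \<Sigma> H \<omega> J (\<lambda>_. 1)"
    unfolding fuzzy_T0L_def using tab0L by (auto simp: H_def J_def \<Sigma>_def)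
  then have "fuzzy_ET0L \<Sigma> H \<omega> J (\<lambda>_. 1) {a, b, c}" by (auto simp: fuzzy_ET0L_def \<Sigma>_def)
  then have F: "F \<in> FET0L" unfolding F_def FET0L_def by blast
  \<comment> \<open>Here \<open>m\<close> is \<open>[s]\<close> until the erasing table has been
    used, and \<open>[]\<close> afterwards.\<close>
  define W where "W = (\<lambda>i m j. word3 c (replicate i a @ m @ replicate j b))"
  have sl: "subst_letter (tab i u) x = {if x = s then u else [x]}" if "x \<in> {s, a, b, c}" for i u x
    using that s b c by (auto simp: subst_letter_def tab_def)
  have sub: "subst_word (tab k u) (W i m j) = {W i (concat (map (\<lambda>x. u) m)) j}"
    if "set m \<subseteq> {s}" for k u i m j
  proof -
    have m: "map (\<lambda>x. if x = s then u else [x]) m = map (\<lambda>x. u) m" using that by auto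
    have single: "concat (map (\<lambda>x. if x = s then u else [x]) (replicate n y)) = replicate n y"
      if "y \<noteq> s" for n y
      using that by (induction n) auto
    have "set (W i m j) \<subseteq> {s, a, b, c}" using that by (auto simp: W_def word3_def)
    then have "subst_word (tab k u) (W i m j) =
        {concat (map (\<lambda>x. if x = s then u else [x]) (W i m j))}"
      using sl by (intro subst_word_deterministic) blast
    moreover have "a \<noteq> s" "b \<noteq> s" "c \<noteq> s" using s by auto
    ultimately show ?thesis by (simp add: W_def word3_def m single)
  qed
  have sub1: "subst_word (tab k [a, s]) (W i [s] j) = {W (Suc i) [s] j}" for k i j
    using sub[of "[s]" k "[a, s]"] by (simp add: W_def replicate_app_Cons_same)
  have sub2: "subst_word (tab k [s, b]) (W i [s] j) = {W i [s] (Suc j)}" for k i j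
    using sub[of "[s]" k "[s, b]"] by (simp add: W_def)
  have sub3: "subst_word (tab k []) (W i [s] j) = {W i [] j}" for k i j
    using sub[of "[s]" k "[]"] by (simp add: W_def)
  have sub4: "subst_word (tab k u) (W i [] j) = {W i [] j}" for k u i j
    using sub[of "[]" k u] by (simp add: W_def)
  have sound: "\<exists>i m j. x = W i m j \<and> m \<in> {[s], []}"
    if "ders hs (W i m j) x" "hs \<in> lists H" "m \<in> {[s], []}" for hs i m j x
    using that
  proof (induction hs arbitrary: i m j)
    case (Cons h hs)
    obtain i' m' j' where "subst_word h (W i m j) = {W i' m' j'}" "m' \<in> {[s], []}"
      using Cons.prems sub1 sub2 sub3 sub4 by (auto simp: H_def; blast)
    with Cons show ?case by auto
  qed auto
  have complete: "\<exists>hs\<in>lists H. ders hs \<omega> (W i [] j)" for i j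
  proof -
    have "ders (replicate i (tab 0 [a, s])) (W n [s] l) (W (n + i) [s] l)" for n l
    proof (induction i arbitrary: n)
      case (Suc i)
      then show ?case using Suc[of "Suc n"] by (simp add: sub1)
    qed simp
    moreover have "ders (replicate j (tab 1 [s, b])) (W n [s] l) (W n [s] (l + j))" for n l
    proof (induction j arbitrary: l)
      case (Suc j)
      then show ?case using Suc[of "Suc l"] by (simp add: sub2)
    qed simp
    ultimately have "ders (replicate i (tab 0 [a, s]) @ replicate j (tab 1 [s, b]) @ [tab 2 []])
        (W 0 [s] 0) (W i [] j)"
      unfolding ders_append by (metis add_0 ders.simps insertI1 sub3)
    moreover have "\<omega> = W 0 [s] 0" by (simp add: \<omega>_def W_def)
    ultimately show ?thesis
      by (intro bexI[of _ "replicate i (tab 0 [a, s]) @ replicate j (tab 1 [s, b]) @ [tab 2 []]"])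
        (auto simp: H_def)
  qed
  have "{x \<in> lists {a, b, c}. \<exists>hs\<in>lists H. ders hs \<omega> x} = {W i [] j | i j. True}"
  proof (intro equalityI subsetI)
    fix x assume "x \<in> {x \<in> lists {a, b, c}. \<exists>hs\<in>lists H. ders hs \<omega> x}"
    moreover from this obtain hs where "hs \<in> lists H" "ders hs (W 0 [s] 0) x"
      by (auto simp: \<omega>_def W_def)
    then obtain i m j where "x = W i m j" "m \<in> {[s], []}" using sound by blast
    moreover have "s \<notin> set x" using calculation(1) s by auto
    then have "m \<noteq> [s]" using \<open>x = W i m j\<close> by (auto simp: W_def word3_def)
    ultimately show "x \<in> {W i [] j | i j. True}" by auto
  next
    fix x assume "x \<in> {W i [] j | i j. True}"
    then obtain i j where "x = W i [] j" by blast
    then show "x \<in> {x \<in> lists {a, b, c}. \<exists>hs\<in>lists H. ders hs \<omega> x}"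
      using complete[of i j] by (auto simp: W_def word3_def)
  qed
  then have snd: "snd ` F = word3 c ` {replicate i a @ replicate j b | i j. True}"
    unfolding F_def snd_fuzzy_language_ET0L by (auto simp: W_def)
  have "F \<notin> FE0L"
  proof
    assume "F \<in> FE0L"
    then obtain \<Sigma> h \<omega> J and f :: "nat \<Rightarrow> real" and \<Delta> where
      "F = fuzzy_language_E0L h \<omega> J f \<Delta>" and E: "fuzzy_E0L \<Sigma> h \<omega> J f \<Delta>"
      by (auto simp: FE0L_def)
    then have "{x \<in> lists \<Delta>. \<exists>t. ders (replicate t h) \<omega> x} =
        word3 c ` {replicate i a @ replicate j b | i j. True}"
      using snd by (simp add: snd_fuzzy_language_E0L)
    moreover have "finite \<Sigma>" "finite h" "h \<subseteq> UNIV \<times> \<Sigma> \<times> lists \<Sigma>" "\<Delta> \<subseteq> \<Sigma>"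
      using E unfolding fuzzy_E0L_def fuzzy_0L_def graded_labelling_def by blast+
    ultimately show False using word3_not_E0L[of \<Sigma> h \<Delta> a b c \<omega>] b c by auto
  qed
  then show ?thesis using F by blast
qed

section \<open>Context-sensitive grammars over abstract nonterminals\<close>

text \<open>The infinite letter type supplies fresh letters to represent nonterminals of an
  arbitrary type.\<close>

lemma ex_inj_avoiding:
  fixes A :: "'n set" and B :: "'a::infinite set"
  assumes "finite A" "finite B"
  shows "\<exists>g :: 'n \<Rightarrow> 'a. inj_on g A \<and> g ` A \<inter> B = {}"
proof -
  have "infinite (UNIV - B)" using assms(2) infinite_UNIV by (metis finite_Diff2)
  then obtain C where C: "C \<subseteq> UNIV - B" "finite C" "card C = card A"
    using infinite_arbitrarily_large by metis
  then obtain g where "bij_betw g A C" using assms(1) finite_same_card_bij by metis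
  then show ?thesis using C by (intro exI[of _ g]) (auto simp: bij_betw_def)
qed

lemma map_eq_append3:
  assumes "map \<phi> y = u @ w @ v"
  shows "\<exists>y1 y2 y3. y = y1 @ y2 @ y3 \<and> map \<phi> y1 = u \<and> map \<phi> y2 = w \<and> map \<phi> y3 = v"
  using assms by (metis map_eq_append_conv)

lemma graded_set_eqI:
  assumes "\<And>x. x \<in> A \<Longrightarrow> P x \<longleftrightarrow> Q x" "\<And>x. x \<in> A \<Longrightarrow> g x = h x"
  shows "{(g x, x) | x. x \<in> A \<and> P x} = {(h x, x) | x. x \<in> A \<and> Q x}"
  using assms by fastforce

text \<open>An abstract grammar with nonterminals \<open>Inl\<close> and terminals
  \<open>Inr\<close>, whose start symbol is left implicit: a pair \<open>(c, w)\<close> of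
  \<open>I\<close> stands for a start production to \<open>w\<close> of grade \<open>c\<close>, and
  all of \<open>R\<close> counts as grade 1.\<close>

definition graded_start_language ::
  "('l, 'n + 'a) rules \<Rightarrow> (real \<times> ('n + 'a) list) set \<Rightarrow> 'a set \<Rightarrow> 'a fuzzy_language" where
  "graded_start_language R I \<Delta> =
     {(Max {c. \<exists>w. (c, w) \<in> I \<and> (gstep R)\<^sup>*\<^sup>* w (map Inr x)}, x) | x.
        x \<in> lists \<Delta> \<and> (\<exists>c w. (c, w) \<in> I \<and> (gstep R)\<^sup>*\<^sup>* w (map Inr x))}"

text \<open>Since all productions after the first have grade 1, the minimum along a derivation is
  the grade of the start production. The start symbol is fresh and occurs on no right-hand side,
  which admits an empty start word.\<close>

lemma FCSL_grammar:
  fixes R :: "('l, 'n + 'a::infinite) rules"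
  assumes fin: "finite R" "finite I" "finite \<Delta>"
    and cs: "\<And>r \<alpha> \<beta>. (r, \<alpha>, \<beta>) \<in> R \<Longrightarrow> \<exists>u v n \<gamma>. \<gamma> \<noteq> [] \<and> \<alpha> = u @ [Inl n] @ v \<and> \<beta> = u @ \<gamma> @ v"
    and tR: "\<And>r \<alpha> \<beta> a. (r, \<alpha>, \<beta>) \<in> R \<Longrightarrow> Inr a \<in> set \<alpha> \<union> set \<beta> \<Longrightarrow> a \<in> \<Delta>"
    and tI: "\<And>c w a. (c, w) \<in> I \<Longrightarrow> Inr a \<in> set w \<Longrightarrow> a \<in> \<Delta>"
    and c01: "\<And>c w. (c, w) \<in> I \<Longrightarrow> 0 \<le> c \<and> c \<le> 1"
  shows "graded_start_language R I \<Delta> \<in> FCSL"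
proof -
  define Sym where "Sym = (\<Union>(r, \<alpha>, \<beta>)\<in>R. set \<alpha> \<union> set \<beta>) \<union> (\<Union>(c, w)\<in>I. set w) \<union> Inr ` \<Delta>"
  have finSym: "finite Sym" using fin by (auto simp: Sym_def)
  have SymR: "\<alpha> \<in> lists Sym" "\<beta> \<in> lists Sym" if "(r, \<alpha>, \<beta>) \<in> R" for r \<alpha> \<beta>
    using that by (fastforce simp: Sym_def)+
  have SymI: "w \<in> lists Sym" if "(c, w) \<in> I" for c w using that by (fastforce simp: Sym_def)
  have Sym_Inr: "a \<in> \<Delta>" if "Inr a \<in> Sym" for a
    using that tR tI by (fastforce simp: Sym_def)
  \<comment> \<open>\<open>None\<close> stands for the new start symbol.\<close>
  define N where "N = insert None (Some ` {n. Inl n \<in> Sym})"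
  have "finite {n. Inl n \<in> Sym}" using finSym finite_vimageI[of Sym Inl] by (simp add: vimage_def)
  then have finN: "finite N" by (simp add: N_def)
  obtain g :: "'n option \<Rightarrow> 'a" where g: "inj_on g N" "g ` N \<inter> \<Delta> = {}"
    using ex_inj_avoiding[OF finN fin(3)] by blast
  define \<phi> where "\<phi> = case_sum (\<lambda>n. g (Some n)) id"
  have \<phi>_simps: "\<phi> (Inl n) = g (Some n)" "\<phi> (Inr a) = a" for n a by (simp_all add: \<phi>_def)
  define S where "S = g None"
  have gN: "g (Some n) \<notin> \<Delta>" "g (Some n) \<noteq> S" "g (Some n) \<in> g ` N" if "Inl n \<in> Sym" for n
  proof -
    have "Some n \<in> N" "None \<in> N" using that by (auto simp: N_def)
    then show "g (Some n) \<notin> \<Delta>" "g (Some n) \<noteq> S" "g (Some n) \<in> g ` N"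
      using g inj_onD[OF g(1), of "Some n" None] by (auto simp: S_def)
  qed
  have S: "S \<in> g ` N" "S \<notin> \<Delta>" using g by (auto simp: S_def N_def)
  have inj\<phi>: "inj_on \<phi> Sym"
  proof (rule inj_onI)
    fix x y assume xy: "x \<in> Sym" "y \<in> Sym" "\<phi> x = \<phi> y"
    show "x = y"
    proof (cases x; cases y)
      fix n m assume "x = Inl n" "y = Inl m"
      then show ?thesis using xy inj_onD[OF g(1), of "Some n" "Some m"] by (auto simp: \<phi>_simps N_def)
    next
      fix n a assume "x = Inl n" "y = Inr a"
      then show ?thesis using xy gN Sym_Inr by (auto simp: \<phi>_simps)
    next
      fix n a assume "x = Inr a" "y = Inl n"
      then show ?thesis using xy gN Sym_Inr by (auto simp: \<phi>_simps)
    qed (use xy in \<open>simp add: \<phi>_simps\<close>)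
  qed
  have \<phi>Sym: "\<phi> x \<in> g ` N \<union> \<Delta>" "\<phi> x \<noteq> S" if "x \<in> Sym" for x
    using that gN Sym_Inr S by (cases x; auto simp: \<phi>_simps)+
  have \<phi>lists: "map \<phi> y \<in> lists (g ` N \<union> \<Delta>)" "S \<notin> set (map \<phi> y)" if "y \<in> lists Sym" for y
  proof -
    have "b \<in> Sym" if "b \<in> set y" for b using that \<open>y \<in> lists Sym\<close> by auto
    then show "map \<phi> y \<in> lists (g ` N \<union> \<Delta>)" "S \<notin> set (map \<phi> y)"
      unfolding in_lists_conv_set set_map using \<phi>Sym by (blast, metis imageE)
  qed
  \<comment> \<open>The grade is a component of the element, so one start word with two grades
    yields two labelled productions.\<close>
  define Q where "Q = (\<lambda>(r, \<alpha>, \<beta>). (map \<phi> \<alpha>, map \<phi> \<beta>, 1)) ` R \<union> (\<lambda>(c, w). ([S], map \<phi> w, c)) ` I"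
  have finQ: "finite Q" using fin by (simp add: Q_def)
  obtain e :: "'a list \<times> 'a list \<times> real \<Rightarrow> nat" where e: "inj_on e Q"
    using finite_imp_inj_to_nat_seg[OF finQ] by blast
  define P where "P = (\<lambda>(\<alpha>, \<beta>, c). (e (\<alpha>, \<beta>, c), \<alpha>, \<beta>)) ` Q"
  define f where "f r = snd (snd (inv_into Q e r))" for r
  have f: "f (e (\<alpha>, \<beta>, c)) = c" if "(\<alpha>, \<beta>, c) \<in> Q" for \<alpha> \<beta> c
    using that e by (simp add: f_def)
  have P_iff: "(r, \<alpha>, \<beta>) \<in> P \<longleftrightarrow> (\<exists>c. (\<alpha>, \<beta>, c) \<in> Q \<and> r = e (\<alpha>, \<beta>, c))" for r \<alpha> \<beta>
    by (force simp: P_def)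
  have P_cases: "(\<exists>r' \<alpha>' \<beta>'. (r', \<alpha>', \<beta>') \<in> R \<and> \<alpha> = map \<phi> \<alpha>' \<and> \<beta> = map \<phi> \<beta>' \<and> f r = 1) \<or>
      (\<exists>w. (f r, w) \<in> I \<and> \<alpha> = [S] \<and> \<beta> = map \<phi> w)" if "(r, \<alpha>, \<beta>) \<in> P" for r \<alpha> \<beta>
  proof -
    obtain c where c: "(\<alpha>, \<beta>, c) \<in> Q" "f r = c"
      using \<open>(r, \<alpha>, \<beta>) \<in> P\<close> f by (auto simp: P_iff)
    from c(1) consider r' \<alpha>' \<beta>' where "(r', \<alpha>', \<beta>') \<in> R" "\<alpha> = map \<phi> \<alpha>'" "\<beta> = map \<phi> \<beta>'" "c = 1"
      | w where "(c, w) \<in> I" "\<alpha> = [S]" "\<beta> = map \<phi> w"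
      unfolding Q_def by auto
    then show ?thesis using c(2) by cases blast+
  qed
  have P_R: "\<exists>l. (l, map \<phi> \<alpha>, map \<phi> \<beta>) \<in> P \<and> f l = 1" if "(r, \<alpha>, \<beta>) \<in> R" for r \<alpha> \<beta>
  proof -
    have "(map \<phi> \<alpha>, map \<phi> \<beta>, 1) \<in> Q" using that by (force simp: Q_def)
    then show ?thesis using f P_iff by blast
  qed
  have P_I: "\<exists>l. (l, [S], map \<phi> w) \<in> P \<and> f l = c" if "(c, w) \<in> I" for c w
  proof -
    have "([S], map \<phi> w, c) \<in> Q" using that by (force simp: Q_def)
    then show ?thesis using f P_iff by blast
  qed
  have S_rhs: "S \<notin> set \<beta>" "\<beta> \<in> lists (g ` N \<union> \<Delta>)" if "(r, \<alpha>, \<beta>) \<in> P" for r \<alpha> \<beta>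
    using P_cases[OF that] SymR(2) SymI \<phi>lists by blast+
  have lhs: "\<alpha> \<in> lists (g ` N \<union> \<Delta>)" if "(r, \<alpha>, \<beta>) \<in> P" for r \<alpha> \<beta>
  proof -
    from P_cases[OF that] consider r' \<alpha>' \<beta>' where "(r', \<alpha>', \<beta>') \<in> R" "\<alpha> = map \<phi> \<alpha>'" | "\<alpha> = [S]"
      by blast
    then show ?thesis
    proof cases
      case 1
      then show ?thesis using \<phi>lists(1) SymR(1) by blast
    qed (use S in simp)
  qed
  have gr: "fuzzy_grammar (g ` N) \<Delta> P S (fst ` P) f"
    unfolding fuzzy_grammar_def graded_labelling_def
  proof (intro conjI ballI)
    show "P \<subseteq> UNIV \<times> lists (g ` N \<union> \<Delta>) \<times> lists (g ` N \<union> \<Delta>)"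
    proof
      fix p assume "p \<in> P"
      moreover obtain r \<alpha> \<beta> where p: "p = (r, \<alpha>, \<beta>)" by (metis prod.exhaust)
      ultimately have "\<alpha> \<in> lists (g ` N \<union> \<Delta>)" "\<beta> \<in> lists (g ` N \<union> \<Delta>)" using lhs S_rhs(2) by blast+
      then show "p \<in> UNIV \<times> lists (g ` N \<union> \<Delta>) \<times> lists (g ` N \<union> \<Delta>)" unfolding p by blast
    qed
    show "inj_on fst P" by (rule inj_onI) (auto simp: P_def dest: inj_onD[OF e])
    fix r assume "r \<in> fst ` P"
    then obtain \<alpha> \<beta> where "(r, \<alpha>, \<beta>) \<in> P" by auto
    then have "f r = 1 \<or> (\<exists>w. (f r, w) \<in> I)" using P_cases by blast
    then show "0 \<le> f r" "f r \<le> 1" using c01 by auto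
  qed (use finN finQ fin g S in \<open>auto simp: P_def\<close>)
  have csP: "(\<exists>u v \<gamma>. \<exists>A\<in>g ` N. \<gamma> \<noteq> [] \<and> \<alpha> = u @ [A] @ v \<and> \<beta> = u @ \<gamma> @ v) \<or>
      (\<alpha> = [S] \<and> \<beta> = [] \<and> (\<forall>(r', \<alpha>', \<beta>')\<in>P. S \<notin> set \<beta>'))" if "(r, \<alpha>, \<beta>) \<in> P" for r \<alpha> \<beta>
    using P_cases[OF that]
  proof (elim disjE exE conjE)
    fix r' \<alpha>' \<beta>' assume R: "(r', \<alpha>', \<beta>') \<in> R" "\<alpha> = map \<phi> \<alpha>'" "\<beta> = map \<phi> \<beta>'"
    obtain u v n \<gamma> where uv: "\<gamma> \<noteq> []" "\<alpha>' = u @ [Inl n] @ v" "\<beta>' = u @ \<gamma> @ v" using cs[OF R(1)] by blast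
    then have "Inl n \<in> Sym" using SymR(1)[OF R(1)] by auto
    then have "g (Some n) \<in> g ` N" using gN by blast
    moreover have "\<alpha> = map \<phi> u @ [g (Some n)] @ map \<phi> v" "\<beta> = map \<phi> u @ map \<phi> \<gamma> @ map \<phi> v"
      "map \<phi> \<gamma> \<noteq> []" using R uv by (simp_all add: \<phi>_simps)
    ultimately show ?thesis by blast
  next
    fix w assume w: "(f r, w) \<in> I" "\<alpha> = [S]" "\<beta> = map \<phi> w"
    show ?thesis
    proof (cases "w = []")
      case True
      then show ?thesis using w S_rhs by auto
    next
      case False
      then have "\<beta> \<noteq> []" "\<alpha> = [] @ [S] @ []" "\<beta> = [] @ \<beta> @ []" using w by simp_all
      then show ?thesis using S by blast
    qed
  qed
  have G: "fuzzy_CS_grammar (g ` N) \<Delta> P S (fst ` P) f"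
    unfolding fuzzy_CS_grammar_def
  proof (intro conjI gr ballI, clarify)
    fix r \<alpha> \<beta> assume "(r, \<alpha>, \<beta>) \<in> P" and n: "\<not> (\<alpha> = [S] \<and> \<beta> = [] \<and> (\<forall>(r', \<alpha>', \<beta>')\<in>P. S \<notin> set \<beta>'))"
    then show "\<exists>u v \<gamma>. \<exists>A\<in>g ` N. \<gamma> \<noteq> [] \<and> \<alpha> = u @ [A] @ v \<and> \<beta> = u @ \<gamma> @ v"
      using csP by metis
  qed
  have sound: "(rs = [] \<and> x = [S]) \<or> (\<exists>w y. (Min (f ` set rs), w) \<in> I \<and> rs \<noteq> [] \<and> x = map \<phi> y \<and>
      y \<in> lists Sym \<and> (gstep R)\<^sup>*\<^sup>* w y)" if "G_derivation P S rs x" for rs x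
    using that
  proof induction
    case (step rs u \<alpha> v r \<beta>)
    from step.IH show ?case
    proof (elim disjE exE conjE)
      assume rs: "rs = []" "u @ \<alpha> @ v = [S]"
      from P_cases[OF step.hyps(2)] show ?thesis
      proof (elim disjE exE conjE)
        fix r' \<alpha>' \<beta>' assume R: "(r', \<alpha>', \<beta>') \<in> R" "\<alpha> = map \<phi> \<alpha>'"
        then have "S \<notin> set \<alpha>" "\<alpha> \<noteq> []" using \<phi>lists(2) SymR(1) cs[OF R(1)] by auto
        then show ?thesis using rs by (auto simp: append_eq_Cons_conv)
      next
        fix w assume w: "(f r, w) \<in> I" "\<alpha> = [S]" "\<beta> = map \<phi> w"
        then have "u = []" "v = []" using rs by (auto simp: append_eq_Cons_conv)
        then show ?thesis using w rs SymI[OF w(1)]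
          by (intro disjI2 exI[of _ w] conjI) simp_all
      qed
    next
      fix w y assume y: "(Min (f ` set rs), w) \<in> I" "rs \<noteq> []" "u @ \<alpha> @ v = map \<phi> y" "y \<in> lists Sym"
        "(gstep R)\<^sup>*\<^sup>* w y"
      from P_cases[OF step.hyps(2)] show ?thesis
      proof (elim disjE exE conjE)
        fix r' \<alpha>' \<beta>' assume R: "(r', \<alpha>', \<beta>') \<in> R" "\<alpha> = map \<phi> \<alpha>'" "\<beta> = map \<phi> \<beta>'" "f r = 1"
        obtain y1 y2 y3 where y': "y = y1 @ y2 @ y3" "map \<phi> y1 = u" "map \<phi> y2 = \<alpha>" "map \<phi> y3 = v"
          using map_eq_append3 y(3) by metis
        have "set y2 \<union> set \<alpha>' \<subseteq> Sym" using y(4) y'(1) SymR(1)[OF R(1)] by auto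
        then have "y2 = \<alpha>'" using y'(3) R(2) inj\<phi> by (metis inj_on_subset map_inj_on)
        then have "gstep R y (y1 @ \<beta>' @ y3)" using R y' unfolding gstep_def by blast
        then have "(gstep R)\<^sup>*\<^sup>* w (y1 @ \<beta>' @ y3)" using y(5) by simp
        moreover have "y1 @ \<beta>' @ y3 \<in> lists Sym" using y(4) y'(1) SymR(2)[OF R(1)] by auto
        moreover have "Min (f ` set (rs @ [r])) = Min (f ` set rs)"
          using y(1,2) R(4) c01 by (simp add: Min_insert min_absorb2)
        ultimately show ?thesis using y R y' by (intro disjI2 exI[of _ w] exI[of _ "y1 @ \<beta>' @ y3"]) simp
      next
        fix w' assume "\<alpha> = [S]"
        then have "S \<in> set (map \<phi> y)" unfolding y(3)[symmetric] by simp
        then show ?thesis using \<phi>lists(2)[OF y(4)] by blast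
      qed
    qed
  qed simp
  have complete: "\<exists>rs. G_derivation P S rs (map \<phi> y) \<and> rs \<noteq> [] \<and> Min (f ` set rs) = c"
    if "(c, w) \<in> I" "(gstep R)\<^sup>*\<^sup>* w y" for c w y
    using that(2)
  proof (induction rule: rtranclp_induct)
    case base
    obtain l where "(l, [S], map \<phi> w) \<in> P" "f l = c" using P_I \<open>(c, w) \<in> I\<close> by blast
    then have "G_derivation P S ([] @ [l]) ([] @ map \<phi> w @ [])"
      by (intro G_derivation.step[of P S "[]" "[]" "[S]" "[]"]) (auto intro: G_derivation.start)
    then show ?case using \<open>f l = c\<close> by (intro exI[of _ "[l]"]) simp
  next
    case (step y z)
    then obtain rs where rs: "G_derivation P S rs (map \<phi> y)" "rs \<noteq> []" "Min (f ` set rs) = c" by blast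
    obtain r u v \<alpha> \<beta> where R: "(r, \<alpha>, \<beta>) \<in> R" "y = u @ \<alpha> @ v" "z = u @ \<beta> @ v"
      using step unfolding gstep_def by blast
    obtain l where l: "(l, map \<phi> \<alpha>, map \<phi> \<beta>) \<in> P" "f l = 1" using P_R R by blast
    have "G_derivation P S (rs @ [l]) (map \<phi> z)"
      using G_derivation.step[OF _ l(1), of S rs "map \<phi> u" "map \<phi> v"] rs(1) R by simp
    moreover have "Min (f ` set (rs @ [l])) = c"
      using rs(2,3) l(2) c01[OF that(1)] by (simp add: Min_insert min_absorb2)
    ultimately show ?case by (intro exI[of _ "rs @ [l]"]) simp
  qed
  have terminal: "y = map Inr x" if "x \<in> lists \<Delta>" "y \<in> lists Sym" "x = map \<phi> y" for x y
  proof -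
    have "b = Inr (\<phi> b)" if "b \<in> set y" for b
    proof (cases b)
      case (Inl n)
      then have "\<phi> (Inl n) \<in> \<Delta>" using \<open>x \<in> lists \<Delta>\<close> \<open>x = map \<phi> y\<close> that by auto
      then have "g (Some n) \<in> \<Delta>" by (simp add: \<phi>_simps)
      then show ?thesis using gN(1) \<open>y \<in> lists Sym\<close> that Inl by auto
    qed (simp add: \<phi>_simps)
    then have "map (Inr \<circ> \<phi>) y = y" by (intro map_idI) simp
    then show ?thesis using that by simp
  qed
  have Min_iff: "(\<exists>rs. G_derivation P S rs x \<and> c = Min (f ` set rs)) \<longleftrightarrow>
      (\<exists>w. (c, w) \<in> I \<and> (gstep R)\<^sup>*\<^sup>* w (map Inr x))" if x: "x \<in> lists \<Delta>" for c x
  proof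
    assume "\<exists>rs. G_derivation P S rs x \<and> c = Min (f ` set rs)"
    then obtain rs where rs: "G_derivation P S rs x" "c = Min (f ` set rs)" by blast
    have "x \<noteq> [S]" using x S by auto
    then obtain w y where wy: "(c, w) \<in> I" "x = map \<phi> y" "y \<in> lists Sym" "(gstep R)\<^sup>*\<^sup>* w y"
      using sound[OF rs(1)] rs(2) by blast
    have "y = map Inr x" by (rule terminal[OF x wy(3,2)])
    then show "\<exists>w. (c, w) \<in> I \<and> (gstep R)\<^sup>*\<^sup>* w (map Inr x)" using wy(1,4) by auto
  next
    assume "\<exists>w. (c, w) \<in> I \<and> (gstep R)\<^sup>*\<^sup>* w (map Inr x)"
    then obtain w where "(c, w) \<in> I" "(gstep R)\<^sup>*\<^sup>* w (map Inr x)" by blast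
    moreover have "map \<phi> (map Inr x) = x" by (simp add: \<phi>_simps o_def)
    ultimately show "\<exists>rs. G_derivation P S rs x \<and> c = Min (f ` set rs)" using complete by metis
  qed
  have gr_eq: "grade_G P S f x = Max {c. \<exists>w. (c, w) \<in> I \<and> (gstep R)\<^sup>*\<^sup>* w (map Inr x)}"
    if "x \<in> lists \<Delta>" for x
  proof -
    have "{Min (f ` set rs) | rs. G_derivation P S rs x} =
        {c. \<exists>w. (c, w) \<in> I \<and> (gstep R)\<^sup>*\<^sup>* w (map Inr x)}"
      using Min_iff[OF that] by blast
    then show ?thesis by (simp add: grade_G_def)
  qed
  have ex_eq: "(\<exists>rs. G_derivation P S rs x) \<longleftrightarrow> (\<exists>c w. (c, w) \<in> I \<and> (gstep R)\<^sup>*\<^sup>* w (map Inr x))"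
    if "x \<in> lists \<Delta>" for x
    using Min_iff[OF that] by metis
  have "graded_start_language R I \<Delta> = fuzzy_language_G \<Delta> P S f"
    unfolding graded_start_language_def fuzzy_language_G_def
    by (rule graded_set_eqI) (simp_all only: gr_eq ex_eq)
  then show ?thesis using G unfolding FCSL_def by blast
qed

section \<open>Noncontracting rules with at most two symbols on the left\<close>

definition kuroda_rules ::
  "('n \<times> ('n + 'a) list) set \<Rightarrow> ('n \<times> 'n \<times> ('n + 'a) \<times> ('n + 'a)) set \<Rightarrow> (unit, 'n + 'a) rules" where
  "kuroda_rules K1 K2 = (\<lambda>(X, \<gamma>). ((), [Inl X], \<gamma>)) ` K1 \<union>
     (\<lambda>(X, Y, Z, W). ((), [Inl X, Inl Y], [Z, W])) ` K2"

lemma kuroda_rules_iff: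
  "(r, \<alpha>, \<beta>) \<in> kuroda_rules K1 K2 \<longleftrightarrow>
     (\<exists>X. (X, \<beta>) \<in> K1 \<and> \<alpha> = [Inl X]) \<or> (\<exists>X Y Z W. (X, Y, Z, W) \<in> K2 \<and> \<alpha> = [Inl X, Inl Y] \<and> \<beta> = [Z, W])"
  by (force simp: kuroda_rules_def)

section \<open>Splitting a pair rule into context-sensitive productions\<close>

type_synonym ('n, 'a) pair_rule = "'n \<times> 'n \<times> ('n + 'a) \<times> ('n + 'a)"
type_synonym ('n, 'a) pair_symbol = "('n + ('n, 'a) pair_rule \<times> bool) + 'a"

definition old :: "'n + 'a \<Rightarrow> ('n, 'a) pair_symbol" where
  "old = map_sum Inl id"

definition fstp :: "('n, 'a) pair_rule \<Rightarrow> ('n, 'a) pair_symbol" where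
  "fstp r = Inl (Inr (r, False))"

definition sndp :: "('n, 'a) pair_rule \<Rightarrow> ('n, 'a) pair_symbol" where
  "sndp r = Inl (Inr (r, True))"

text \<open>The usual splitting: each of the four productions rewrites one symbol next to an
  unchanged neighbour. The auxiliary symbols contain the whole rule, so that different rules cannot
  be mixed up.\<close>

definition pair_rules ::
  "('n \<times> ('n + 'a) list) set \<Rightarrow> ('n, 'a) pair_rule set \<Rightarrow> (unit, ('n, 'a) pair_symbol) rules" where
  "pair_rules K1 K2 = (\<lambda>(X, \<gamma>). ((), [old (Inl X)], map old \<gamma>)) ` K1 \<union>
     (\<Union>(X, Y, Z, W)\<in>K2. let r = (X, Y, Z, W) in
        {((), [old (Inl X), old (Inl Y)], [fstp r, old (Inl Y)]),
         ((), [fstp r, old (Inl Y)], [fstp r, sndp r]),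
         ((), [fstp r, sndp r], [old Z, sndp r]),
         ((), [old Z, sndp r], [old Z, old W])})"

text \<open>
  The rule \<open>X Y \<rightarrow> Z W\<close> is carried out when \<open>Y\<close> is replaced, so that \<open>fstp\<close> stands for \<open>X\<close> before
  and for \<open>Z\<close> after \<open>sndp\<close> has been written to its right.
\<close>

fun decode :: "('n, 'a) pair_symbol list \<Rightarrow> ('n + 'a) list" where
  "decode [] = []"
| "decode (Inr a # s) = Inr a # decode s"
| "decode (Inl (Inl n) # s) = Inl n # decode s"
| "decode (Inl (Inr ((X, Y, Z, W), b)) # s) =
     (if b then W else if s \<noteq> [] \<and> hd s = sndp (X, Y, Z, W) then Z else Inl X) # decode s"

lemma decode_old [simp]: "decode (old b # s) = b # decode s"
  by (cases b) (simp_all add: old_def)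

lemma decode_map_old [simp]: "decode (map old w @ s) = w @ decode s"
  by (induction w) simp_all

lemma decode_fstp: "decode (fstp (X, Y, Z, W) # s) =
    (if s \<noteq> [] \<and> hd s = sndp (X, Y, Z, W) then Z else Inl X) # decode s"
  by (simp add: fstp_def)

lemma decode_sndp [simp]: "decode (sndp (X, Y, Z, W) # s) = W # decode s"
  by (simp add: sndp_def)

lemma old_neq_sndp [simp]: "old b \<noteq> sndp r" "sndp r \<noteq> old b"
  by (cases b; simp add: old_def sndp_def)+

lemma fstp_neq_sndp [simp]: "fstp r \<noteq> sndp r'"
  by (simp add: fstp_def sndp_def)

text \<open>Decoding looks ahead by one symbol, and only to recognise a \<open>sndp\<close>. If the
  tail begins with no \<open>sndp\<close> before and after the change, the prefix is decoded
  alike.\<close>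

lemma decode_context:
  assumes "\<And>r. b \<noteq> sndp r" "\<And>r. b' \<noteq> sndp r"
  shows "\<exists>d. decode (u @ b # v) = d @ decode (b # v) \<and> decode (u @ b' # v') = d @ decode (b' # v')"
proof (induction u)
  case (Cons s u)
  then obtain d where d: "decode (u @ b # v) = d @ decode (b # v)"
    "decode (u @ b' # v') = d @ decode (b' # v')" by blast
  consider a where "s = Inr a" | n where "s = Inl (Inl n)" | X Y Z W k where "s = Inl (Inr ((X, Y, Z, W), k))"
    by (metis prod.exhaust sum.exhaust)
  then show ?case
  proof cases
    case 3
    have "u = [] \<or> hd (u @ b # v) = hd (u @ b' # v')" by (cases u) auto
    then have "(hd (u @ b # v) = sndp (X, Y, Z, W)) = (hd (u @ b' # v') = sndp (X, Y, Z, W))"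
      using assms by auto
    then show ?thesis using 3 d
      by (intro exI[of _ "(if k then W else if hd (u @ b # v) = sndp (X, Y, Z, W) then Z else Inl X) # d"]) auto
  qed (use d in \<open>auto intro: exI[of _ "_ # d"]\<close>)
qed simp

text \<open>Applications belonging to different pairs may interleave or stay unfinished; each single
  one either preserves the decoded word or acts as one step of the original rules.\<close>

lemma gstep_pair_decode:
  assumes K1: "\<And>X. (X, []) \<notin> K1" and "gstep (pair_rules K1 K2) x y"
  shows "(gstep (kuroda_rules K1 K2))\<^sup>*\<^sup>* (decode x) (decode y)"
proof -
  obtain u v r \<alpha> \<beta> where rule: "(r, \<alpha>, \<beta>) \<in> pair_rules K1 K2" and x: "x = u @ \<alpha> @ v" "y = u @ \<beta> @ v"
    using assms(2) unfolding gstep_def by blast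
  have eq: "decode (u @ b # s) = decode (u @ b' # s')"
    if "\<And>r. b \<noteq> sndp r" "\<And>r. b' \<noteq> sndp r" "decode (b # s) = decode (b' # s')" for b b' s s'
    using decode_context[OF that(1,2), of u s s'] that(3) by force
  have step: "gstep (kuroda_rules K1 K2) (decode (u @ b # s)) (decode (u @ b' # s'))"
    if "\<And>r. b \<noteq> sndp r" "\<And>r. b' \<noteq> sndp r" "decode (b # s) = \<alpha>' @ t" "decode (b' # s') = \<beta>' @ t"
      "((), \<alpha>', \<beta>') \<in> kuroda_rules K1 K2" for b b' s s' \<alpha>' \<beta>' t
    using decode_context[OF that(1,2), of u s s'] that(3-) unfolding gstep_def by metis
  from rule consider X \<gamma> where "(X, \<gamma>) \<in> K1" "\<alpha> = [old (Inl X)]" "\<beta> = map old \<gamma>"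
    | X Y Z W where "(X, Y, Z, W) \<in> K2" "\<alpha> = [old (Inl X), old (Inl Y)]" "\<beta> = [fstp (X, Y, Z, W), old (Inl Y)]"
    | X Y Z W where "(X, Y, Z, W) \<in> K2" "\<alpha> = [fstp (X, Y, Z, W), old (Inl Y)]"
        "\<beta> = [fstp (X, Y, Z, W), sndp (X, Y, Z, W)]"
    | X Y Z W where "(X, Y, Z, W) \<in> K2" "\<alpha> = [fstp (X, Y, Z, W), sndp (X, Y, Z, W)]"
        "\<beta> = [old Z, sndp (X, Y, Z, W)]"
    | X Y Z W where "(X, Y, Z, W) \<in> K2" "\<alpha> = [old Z, sndp (X, Y, Z, W)]" "\<beta> = [old Z, old W]"
    unfolding pair_rules_def Let_def by auto
  then show ?thesis
  proof cases
    case 1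
    \<comment> \<open>An empty right-hand side could move a \<open>sndp\<close> up to a waiting
      \<open>fstp\<close> and change how that is decoded.\<close>
    then obtain g \<gamma>' where \<gamma>: "\<gamma> = g # \<gamma>'" using K1 by (cases \<gamma>) auto
    have "gstep (kuroda_rules K1 K2) (decode (u @ old (Inl X) # v)) (decode (u @ old g # map old \<gamma>' @ v))"
      by (rule step[of _ _ _ "[Inl X]" "decode v" _ \<gamma>]) (use 1 \<gamma> in \<open>simp_all add: kuroda_rules_iff\<close>)
    then show ?thesis using x 1 \<gamma> by (simp add: r_into_rtranclp)
  next
    case 2
    then have "decode x = decode y" unfolding x
      using eq[of "old (Inl X)" "fstp (X, Y, Z, W)" "old (Inl Y) # v" "old (Inl Y) # v"]
      by (simp add: decode_fstp)
    then show ?thesis by simp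
  next
    case 3
    have "gstep (kuroda_rules K1 K2) (decode (u @ fstp (X, Y, Z, W) # old (Inl Y) # v))
        (decode (u @ fstp (X, Y, Z, W) # sndp (X, Y, Z, W) # v))"
      by (rule step[of _ _ _ "[Inl X, Inl Y]" "decode v" _ "[Z, W]"])
        (use 3 in \<open>simp_all add: kuroda_rules_iff decode_fstp\<close>)
    then show ?thesis using x 3 by (simp add: r_into_rtranclp)
  next
    case 4
    then have "decode x = decode y" unfolding x
      using eq[of "fstp (X, Y, Z, W)" "old Z" "sndp (X, Y, Z, W) # v" "sndp (X, Y, Z, W) # v"]
      by (simp add: decode_fstp)
    then show ?thesis by simp
  next
    case 5
    then have "decode x = decode y" unfolding x
      using eq[of "old Z" "old Z" "sndp (X, Y, Z, W) # v" "old W # v"] by simp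
    then show ?thesis by simp
  qed
qed

lemma gstep_kuroda_pair:
  assumes "gstep (kuroda_rules K1 K2) x y"
  shows "(gstep (pair_rules K1 K2))\<^sup>*\<^sup>* (map old x) (map old y)"
proof -
  obtain u v r \<alpha> \<beta> where rule: "(r, \<alpha>, \<beta>) \<in> kuroda_rules K1 K2" and x: "x = u @ \<alpha> @ v" "y = u @ \<beta> @ v"
    using assms unfolding gstep_def by blast
  have step: "gstep (pair_rules K1 K2) (map old u @ a @ map old v) (map old u @ b @ map old v)"
    if "((), a, b) \<in> pair_rules K1 K2" for a b
    using that unfolding gstep_def by blast
  from rule consider X where "(X, \<beta>) \<in> K1" "\<alpha> = [Inl X]"
    | X Y Z W where "(X, Y, Z, W) \<in> K2" "\<alpha> = [Inl X, Inl Y]" "\<beta> = [Z, W]"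
    by (auto simp: kuroda_rules_iff)
  then show ?thesis
  proof cases
    case 1
    then have "((), [old (Inl X)], map old \<beta>) \<in> pair_rules K1 K2" by (force simp: pair_rules_def)
    from r_into_rtranclp[of "gstep (pair_rules K1 K2)", OF step[OF this]] show ?thesis using x 1 by simp
  next
    case 2
    define r where "r = (X, Y, Z, W)"
    have "{((), [old (Inl X), old (Inl Y)], [fstp r, old (Inl Y)]),
         ((), [fstp r, old (Inl Y)], [fstp r, sndp r]),
         ((), [fstp r, sndp r], [old Z, sndp r]),
         ((), [old Z, sndp r], [old Z, old W])} \<subseteq> pair_rules K1 K2"
      using 2 unfolding pair_rules_def Let_def r_def by blast
    then have
      "gstep (pair_rules K1 K2) (map old u @ [old (Inl X), old (Inl Y)] @ map old v)
         (map old u @ [fstp r, old (Inl Y)] @ map old v)"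
      "gstep (pair_rules K1 K2) (map old u @ [fstp r, old (Inl Y)] @ map old v)
         (map old u @ [fstp r, sndp r] @ map old v)"
      "gstep (pair_rules K1 K2) (map old u @ [fstp r, sndp r] @ map old v)
         (map old u @ [old Z, sndp r] @ map old v)"
      "gstep (pair_rules K1 K2) (map old u @ [old Z, sndp r] @ map old v)
         (map old u @ [old Z, old W] @ map old v)"
      by (intro step; simp)+
    then have "(gstep (pair_rules K1 K2))\<^sup>*\<^sup>* (map old u @ [old (Inl X), old (Inl Y)] @ map old v)
         (map old u @ [old Z, old W] @ map old v)"
      by (meson converse_rtranclp_into_rtranclp rtranclp.rtrancl_refl)
    then show ?thesis using x 2 by simp
  qed
qed

lemma map_old_Inr: "map old (map Inr x) = map Inr x"
  by (simp add: old_def)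

lemma gsteps_pair_iff:
  assumes K1: "\<And>X. (X, []) \<notin> K1"
  shows "(gstep (pair_rules K1 K2))\<^sup>*\<^sup>* (map old w) (map Inr x) \<longleftrightarrow>
           (gstep (kuroda_rules K1 K2))\<^sup>*\<^sup>* w (map Inr x)"
proof
  assume "(gstep (pair_rules K1 K2))\<^sup>*\<^sup>* (map old w) (map Inr x)"
  moreover have "(gstep (kuroda_rules K1 K2))\<^sup>*\<^sup>* (decode y) (decode z)"
    if "(gstep (pair_rules K1 K2))\<^sup>*\<^sup>* y z" for y z
    using that
  proof (induction rule: rtranclp_induct)
    case (step z z')
    then show ?case using gstep_pair_decode[OF K1, where x = z and y = z' and ?K2.0 = K2] by simp
  qed simp
  ultimately have "(gstep (kuroda_rules K1 K2))\<^sup>*\<^sup>* (decode (map old w)) (decode (map old (map Inr x)))"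
    unfolding map_old_Inr by blast
  then show "(gstep (kuroda_rules K1 K2))\<^sup>*\<^sup>* w (map Inr x)"
    by (simp add: decode_map_old[of _ "[]", simplified] del: map_map)
next
  assume "(gstep (kuroda_rules K1 K2))\<^sup>*\<^sup>* w (map Inr x)"
  moreover have "(gstep (pair_rules K1 K2))\<^sup>*\<^sup>* (map old w) (map old y)"
    if "(gstep (kuroda_rules K1 K2))\<^sup>*\<^sup>* w y" for y
    using that
  proof (induction rule: rtranclp_induct)
    case (step y z)
    then show ?case using gstep_kuroda_pair[of K1 K2 y z] by simp
  qed simp
  ultimately show "(gstep (pair_rules K1 K2))\<^sup>*\<^sup>* (map old w) (map Inr x)"
    by (metis map_old_Inr)
qed

lemma FCSL_kuroda:
  fixes K1 :: "('n \<times> ('n + 'a::infinite) list) set"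
  assumes fin: "finite K1" "finite K2" "finite I" "finite \<Delta>"
    and K1: "\<And>X. (X, []) \<notin> K1"
    and t1: "\<And>X \<gamma> a. (X, \<gamma>) \<in> K1 \<Longrightarrow> Inr a \<in> set \<gamma> \<Longrightarrow> a \<in> \<Delta>"
    and t2: "\<And>X Y Z W a. (X, Y, Z, W) \<in> K2 \<Longrightarrow> Inr a \<in> {Z, W} \<Longrightarrow> a \<in> \<Delta>"
    and tI: "\<And>c w a. (c, w) \<in> I \<Longrightarrow> Inr a \<in> set w \<Longrightarrow> a \<in> \<Delta>"
    and c01: "\<And>c w. (c, w) \<in> I \<Longrightarrow> 0 \<le> c \<and> c \<le> 1"
  shows "graded_start_language (kuroda_rules K1 K2) I \<Delta> \<in> FCSL"
proof -
  define I' where "I' = (\<lambda>(c, w). (c, map old w)) ` I"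
  have Inr_old: "Inr a = old b \<longleftrightarrow> b = Inr a" for a :: 'a and b :: "'n + 'a"
    by (cases b) (auto simp: old_def)
  have Inr_pair: "Inr a \<noteq> fstp r" "Inr a \<noteq> sndp r" for a :: 'a and r :: "('n, 'a) pair_rule"
    by (simp_all add: fstp_def sndp_def)
  have I': "(c, w') \<in> I' \<longleftrightarrow> (\<exists>w. (c, w) \<in> I \<and> w' = map old w)" for c w'
    by (auto simp: I'_def)
  have "graded_start_language (kuroda_rules K1 K2) I \<Delta> = graded_start_language (pair_rules K1 K2) I' \<Delta>"
  proof -
    have "(\<exists>w. (c, w) \<in> I \<and> (gstep (kuroda_rules K1 K2))\<^sup>*\<^sup>* w (map Inr x)) \<longleftrightarrow>
        (\<exists>w. (c, w) \<in> I' \<and> (gstep (pair_rules K1 K2))\<^sup>*\<^sup>* w (map Inr x))" for c x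
      using gsteps_pair_iff[where ?K1.0 = K1 and ?K2.0 = K2, OF K1] by (auto simp: I')
    then show ?thesis unfolding graded_start_language_def by (intro graded_set_eqI) simp_all
  qed
  also have "\<dots> \<in> FCSL"
  proof (rule FCSL_grammar)
    show "finite (pair_rules K1 K2)" using fin by (auto simp: pair_rules_def Let_def)
    show "finite I'" using fin by (simp add: I'_def)
    show "a \<in> \<Delta>" if "(c, w) \<in> I'" "Inr a \<in> set w" for c w a
      using that tI by (auto simp: I' Inr_old)
    show "0 \<le> c \<and> c \<le> 1" if "(c, w) \<in> I'" for c w using that c01 by (auto simp: I')
    show "a \<in> \<Delta>" if "(r, \<alpha>, \<beta>) \<in> pair_rules K1 K2" "Inr a \<in> set \<alpha> \<union> set \<beta>" for r \<alpha> \<beta> a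
      using that t1 t2 by (auto simp: pair_rules_def Let_def Inr_old Inr_pair)
    show "\<exists>u v n \<gamma>. \<gamma> \<noteq> [] \<and> \<alpha> = u @ [Inl n] @ v \<and> \<beta> = u @ \<gamma> @ v"
      if "(r, \<alpha>, \<beta>) \<in> pair_rules K1 K2" for r \<alpha> \<beta>
    proof -
      have one: ?thesis if "\<alpha> = [Inl n]" "\<beta> \<noteq> []" for n
        using that by (intro exI[of _ "[]"] exI[of _ n] exI[of _ \<beta>]) simp
      have 2: ?thesis if "\<alpha> = [Inl n, b]" "\<beta> = [d, b]" for n b d
        using that by (intro exI[of _ "[]"] exI[of _ "[b]"] exI[of _ n] exI[of _ "[d]"]) simp
      have 3: ?thesis if "\<alpha> = [b, Inl n]" "\<beta> = [b, d]" for n b d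
        using that by (intro exI[of _ "[b]"] exI[of _ "[]"] exI[of _ n] exI[of _ "[d]"]) simp
      have old: "old (Inl X) = Inl (Inl X)" for X :: 'n by (simp add: old_def)
      from that consider X \<gamma> where "(X, \<gamma>) \<in> K1" "\<alpha> = [old (Inl X)]" "\<beta> = map old \<gamma>"
        | X Y Z W where "\<alpha> = [old (Inl X), old (Inl Y)]" "\<beta> = [fstp (X, Y, Z, W), old (Inl Y)]"
        | X Y Z W where "\<alpha> = [fstp (X, Y, Z, W), old (Inl Y)]" "\<beta> = [fstp (X, Y, Z, W), sndp (X, Y, Z, W)]"
        | X Y Z W where "\<alpha> = [fstp (X, Y, Z, W), sndp (X, Y, Z, W)]" "\<beta> = [old Z, sndp (X, Y, Z, W)]"
        | X Y Z W where "\<alpha> = [old Z, sndp (X, Y, Z, W)]" "\<beta> = [old Z, old W]"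
        unfolding pair_rules_def Let_def by auto
      then show ?thesis
      proof cases
        case (1 X \<gamma>)
        then have "\<gamma> \<noteq> []" using K1 by metis
        then show ?thesis using one[of "Inl X"] 1 by (simp add: old)
      qed (use 2 3 in \<open>auto simp: old fstp_def sndp_def\<close>)
    qed
  qed (use fin in auto)
  finally show ?thesis .
qed

section \<open>Iterated transducers\<close>

text \<open>At any time one symbol is not idle: \<open>Head\<close> is about to read its letter,
  \<open>Carry\<close> has written its letter and hands the state to the right, \<open>Back\<close>
  returns to the left end, and \<open>Final\<close> turns letters into terminals.\<close>

datatype ('q, 'g) cell = Idle 'g | Head 'q 'g | Carry 'q 'g | Back 'g | Final 'g

fun idle :: "('q, 'g) cell \<Rightarrow> bool" where
  "idle (Idle a) \<longleftrightarrow> True"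
| "idle _ \<longleftrightarrow> False"

text \<open>The flags of a symbol tell whether it is the first and whether it is the last of the word.\<close>

type_synonym ('q, 'g, 'a) symbol = "(bool \<times> bool \<times> ('q, 'g) cell) + 'a"

fun active :: "('q, 'g, 'a) symbol \<Rightarrow> bool" where
  "active (Inl (f, l, X)) \<longleftrightarrow> \<not> idle X"
| "active (Inr a) \<longleftrightarrow> False"

text \<open>An active symbol stands to the right of a \<open>pre\<close> and to the left of a
  \<open>post\<close>; so the former never carries the mark for the last symbol, nor the latter that
  for the first.\<close>

definition pre :: "bool \<Rightarrow> 'g list \<Rightarrow> ('q, 'g, 'a) symbol list" where
  "pre f v = (case v of [] \<Rightarrow> [] | d # r \<Rightarrow>
     Inl (f, False, Idle d) # map (\<lambda>d. Inl (False, False, Idle d)) r)"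

primrec post :: "'g list \<Rightarrow> ('q, 'g, 'a) symbol list" where
  "post [] = []"
| "post (d # s) = Inl (False, s = [], Idle d) # post s"

lemma pre_simps [simp]: "pre f [] = []" "pre f [d] = [Inl (f, False, Idle d)]"
  by (simp_all add: pre_def)

lemma pre_append: "pre f (u @ v) = pre f u @ pre (f \<and> u = []) v"
  by (cases u; cases v) (simp_all add: pre_def)

lemma pre_eq_snoc:
  assumes "pre f p = u @ [b]"
  obtains p' d where "p = p' @ [d]" "u = pre f p'" "b = Inl (f \<and> p' = [], False, Idle d)"
  using assms by (cases p rule: rev_cases) (auto simp: pre_append)

lemma post_eq_Cons:
  assumes "post s = b # u"
  obtains d s' where "s = d # s'" "u = post s'" "b = Inl (False, s' = [], Idle d)"
  using assms by (cases s) auto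

lemma inactive_pre: "b \<in> set (pre f v) \<Longrightarrow> \<not> active b"
  by (auto simp: pre_def split: list.splits)

lemma inactive_post: "b \<in> set (post s) \<Longrightarrow> \<not> active b"
  by (induction s) auto

text \<open>Every left-hand side of \<open>K1\<close> and \<open>K2\<close> contains exactly one
  active symbol. In a word with a single active symbol this fixes the place of application, which
  leaves the cases of \<open>gst_cases\<close>.\<close>

lemma active_unique:
  assumes "xs @ b # ys = us @ b' # vs" "active b" "active b'"
    "\<And>z. z \<in> set xs \<union> set ys \<Longrightarrow> \<not> active z"
  shows "us = xs \<and> b' = b \<and> vs = ys"
proof -
  have "b' \<notin> set xs" "b' \<notin> set ys" using assms by auto
  moreover have "b \<notin> set us" if "b' = b"
    using assms calculation that by (auto simp: append_eq_append_conv2 append_eq_Cons_conv Cons_eq_append_conv)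
  ultimately show ?thesis using assms(1,4)
    by (auto simp: append_eq_append_conv2 append_eq_Cons_conv Cons_eq_append_conv)
qed

text \<open>The condition \<open>v \<noteq> []\<close> provides a written letter on which the state
  can travel and keeps the grammar noncontracting. The relation \<open>out\<close> translates the
  last word letter by letter and may be partial.\<close>

locale transducer =
  fixes Q :: "'q set" and G :: "'g set" and T :: "('q \<times> 'g \<times> 'q \<times> 'g list) set"
    and Qi Qf :: "'q set" and out :: "('g \<times> 'a::infinite) set"
  assumes fin: "finite Q" "finite G" "finite T" "finite out"
    and T: "\<And>q a q' v. (q, a, q', v) \<in> T \<Longrightarrow> q' \<in> Q \<and> v \<in> lists G \<and> v \<noteq> []"
    and Qi: "Qi \<subseteq> Q" and Qf: "Qf \<subseteq> Q"
begin

inductive run :: "'q \<Rightarrow> 'g list \<Rightarrow> 'g list \<Rightarrow> 'q \<Rightarrow> bool" where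
  run_Nil: "run q [] [] q"
| run_Cons: "(q, a, q', v) \<in> T \<Longrightarrow> run q' w x q'' \<Longrightarrow> run q (a # w) (v @ x) q''"

definition sweep :: "'g list \<Rightarrow> 'g list \<Rightarrow> bool" where
  "sweep w w' \<longleftrightarrow> (\<exists>q\<in>Qi. \<exists>q'\<in>Qf. run q w w' q')"

lemma run_snoc:
  assumes "run q w x q'" "(q', a, q'', v) \<in> T"
  shows "run q (w @ [a]) (x @ v) q''"
  using assms
proof induction
  case (run_Nil q)
  then show ?case using run.run_Cons[OF run_Nil run.run_Nil] by simp
next
  case (run_Cons q b q1 v' w x q2)
  then have "run q1 (w @ [a]) (x @ v) q''" by blast
  then show ?case using run.run_Cons[OF run_Cons.hyps(1)] by simp
qed

lemma run_lists: "run q w x q' \<Longrightarrow> x \<in> lists G"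
  by (induction rule: run.induct) (use T in auto)

lemma run_empty_iff: "run q w x q' \<Longrightarrow> x = [] \<longleftrightarrow> w = []"
  by (induction rule: run.induct) (use T in auto)

definition emit :: "bool \<Rightarrow> bool \<Rightarrow> 'g list \<Rightarrow> 'q \<Rightarrow> ('q, 'g, 'a) symbol list" where
  "emit f l v q = pre f (butlast v) @ [Inl (f \<and> butlast v = [], l, Carry q (last v))]"

text \<open>Only the reading rules can lengthen the word. The flags are needed because a grammar has
  no other way to recognise the ends; at the left end it chooses freely between another sweep and
  the output.\<close>

definition K1 :: "((bool \<times> bool \<times> ('q, 'g) cell) \<times> ('q, 'g, 'a) symbol list) set" where
  "K1 = (\<lambda>((q, a, q', v), f, l). ((f, l, Head q a), emit f l v q')) ` (T \<times> UNIV) \<union>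
     (\<lambda>(q, d, f). ((f, True, Carry q d), [Inl (f, True, Back d)])) ` (Qf \<times> G \<times> UNIV) \<union>
     (\<lambda>(q, d, l). ((True, l, Back d), [Inl (True, l, Head q d)])) ` (Qi \<times> G \<times> UNIV) \<union>
     (\<lambda>(d, l). ((True, l, Back d), [Inl (True, l, Final d)])) ` (G \<times> UNIV) \<union>
     (\<lambda>((d, x), f). ((f, True, Final d), [Inr x])) ` (out \<times> UNIV)"

definition K2 :: "((bool \<times> bool \<times> ('q, 'g) cell) \<times> (bool \<times> bool \<times> ('q, 'g) cell) \<times>
    ('q, 'g, 'a) symbol \<times> ('q, 'g, 'a) symbol) set" where
  "K2 = (\<lambda>(q, d, b, f, l). ((f, False, Carry q d), (False, l, Idle b),
       Inl (f, False, Idle d), Inl (False, l, Head q b))) ` (Q \<times> G \<times> G \<times> UNIV) \<union>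
     (\<lambda>(b, d, f, l). ((f, False, Idle b), (False, l, Back d),
       Inl (f, False, Back b), Inl (False, l, Idle d))) ` (G \<times> G \<times> UNIV) \<union>
     (\<lambda>((d, x), b, f, l). ((f, False, Final d), (False, l, Idle b),
       Inr x, Inl (False, l, Final b))) ` (out \<times> G \<times> UNIV)"

abbreviation gst :: "('q, 'g, 'a) symbol list \<Rightarrow> ('q, 'g, 'a) symbol list \<Rightarrow> bool" where
  "gst \<equiv> gstep (kuroda_rules K1 K2)"

lemma K1_iff: "(X, \<gamma>) \<in> K1 \<longleftrightarrow>
    (\<exists>q a q' v f l. (q, a, q', v) \<in> T \<and> X = (f, l, Head q a) \<and> \<gamma> = emit f l v q') \<or>
    (\<exists>q d f. q \<in> Qf \<and> d \<in> G \<and> X = (f, True, Carry q d) \<and> \<gamma> = [Inl (f, True, Back d)]) \<or>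
    (\<exists>q d l. q \<in> Qi \<and> d \<in> G \<and> X = (True, l, Back d) \<and> \<gamma> = [Inl (True, l, Head q d)]) \<or>
    (\<exists>d l. d \<in> G \<and> X = (True, l, Back d) \<and> \<gamma> = [Inl (True, l, Final d)]) \<or>
    (\<exists>d x f. (d, x) \<in> out \<and> X = (f, True, Final d) \<and> \<gamma> = [Inr x])"
proof -
  have 1: "(X, \<gamma>) \<in> (\<lambda>((q, a, q', v), f, l). ((f, l, Head q a), emit f l v q')) ` (T \<times> UNIV) \<longleftrightarrow>
      (\<exists>q a q' v f l. (q, a, q', v) \<in> T \<and> X = (f, l, Head q a) \<and> \<gamma> = emit f l v q')" by (simp add: image_iff Bex_def)
  have 2: "(X, \<gamma>) \<in> (\<lambda>(q, d, f). ((f, True, Carry q d), [Inl (f, True, Back d)])) ` (Qf \<times> G \<times> UNIV) \<longleftrightarrow>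
      (\<exists>q d f. q \<in> Qf \<and> d \<in> G \<and> X = (f, True, Carry q d) \<and> \<gamma> = [Inl (f, True, Back d)])" by (simp add: image_iff Bex_def)
  have 3: "(X, \<gamma>) \<in> (\<lambda>(q, d, l). ((True, l, Back d), [Inl (True, l, Head q d)])) ` (Qi \<times> G \<times> UNIV) \<longleftrightarrow>
      (\<exists>q d l. q \<in> Qi \<and> d \<in> G \<and> X = (True, l, Back d) \<and> \<gamma> = [Inl (True, l, Head q d)])" by (simp add: image_iff Bex_def)
  have 4: "(X, \<gamma>) \<in> (\<lambda>(d, l). ((True, l, Back d), [Inl (True, l, Final d)])) ` (G \<times> UNIV) \<longleftrightarrow>
      (\<exists>d l. d \<in> G \<and> X = (True, l, Back d) \<and> \<gamma> = [Inl (True, l, Final d)])" by (simp add: image_iff Bex_def)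
  have 5: "(X, \<gamma>) \<in> (\<lambda>((d, x), f). ((f, True, Final d), [Inr x])) ` (out \<times> UNIV) \<longleftrightarrow>
      (\<exists>d x f. (d, x) \<in> out \<and> X = (f, True, Final d) \<and> \<gamma> = [Inr x])" by (simp add: image_iff Bex_def)
  show ?thesis unfolding K1_def Un_iff 1 2 3 4 5 by (simp only: disj_assoc)
qed

lemma K2_iff: "(X, Y, Z, W) \<in> K2 \<longleftrightarrow>
    (\<exists>q d b f l. q \<in> Q \<and> d \<in> G \<and> b \<in> G \<and> X = (f, False, Carry q d) \<and> Y = (False, l, Idle b) \<and>
       Z = Inl (f, False, Idle d) \<and> W = Inl (False, l, Head q b)) \<or>
    (\<exists>b d f l. b \<in> G \<and> d \<in> G \<and> X = (f, False, Idle b) \<and> Y = (False, l, Back d) \<and>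
       Z = Inl (f, False, Back b) \<and> W = Inl (False, l, Idle d)) \<or>
    (\<exists>d x b f l. (d, x) \<in> out \<and> b \<in> G \<and> X = (f, False, Final d) \<and> Y = (False, l, Idle b) \<and>
       Z = Inr x \<and> W = Inl (False, l, Final b))"
proof -
  have 1: "(X, Y, Z, W) \<in> (\<lambda>(q, d, b, f, l). ((f, False, Carry q d), (False, l, Idle b),
       Inl (f, False, Idle d), Inl (False, l, Head q b))) ` (Q \<times> G \<times> G \<times> UNIV) \<longleftrightarrow>
    (\<exists>q d b f l. q \<in> Q \<and> d \<in> G \<and> b \<in> G \<and> X = (f, False, Carry q d) \<and> Y = (False, l, Idle b) \<and>
       Z = Inl (f, False, Idle d) \<and> W = Inl (False, l, Head q b))" by (simp add: image_iff Bex_def)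
  have 2: "(X, Y, Z, W) \<in> (\<lambda>(b, d, f, l). ((f, False, Idle b), (False, l, Back d),
       Inl (f, False, Back b), Inl (False, l, Idle d))) ` (G \<times> G \<times> UNIV) \<longleftrightarrow>
    (\<exists>b d f l. b \<in> G \<and> d \<in> G \<and> X = (f, False, Idle b) \<and> Y = (False, l, Back d) \<and>
       Z = Inl (f, False, Back b) \<and> W = Inl (False, l, Idle d))" by (simp add: image_iff Bex_def)
  have 3: "(X, Y, Z, W) \<in> (\<lambda>((d, x), b, f, l). ((f, False, Final d), (False, l, Idle b),
       Inr x, Inl (False, l, Final b))) ` (out \<times> G \<times> UNIV) \<longleftrightarrow>
    (\<exists>d x b f l. (d, x) \<in> out \<and> b \<in> G \<and> X = (f, False, Final d) \<and> Y = (False, l, Idle b) \<and>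
       Z = Inr x \<and> W = Inl (False, l, Final b))" by (simp add: image_iff Bex_def)
  show ?thesis unfolding K2_def Un_iff 1 2 3 by (simp only: disj_assoc)
qed

lemma gst_cases [consumes 3]:
  assumes st: "gst (u @ Inl (f, l, X) # v) y" and X: "\<not> idle X"
    and inactive: "\<forall>z\<in>set u \<union> set v. \<not> active z"
  obtains
    (head) q a q' w where "X = Head q a" "(q, a, q', w) \<in> T" "y = u @ emit f l w q' @ v"
  | (carry_end) q d where "X = Carry q d" "l" "q \<in> Qf" "y = u @ Inl (f, l, Back d) # v"
  | (back_start) q d where "X = Back d" "f" "q \<in> Qi" "y = u @ Inl (f, l, Head q d) # v"
  | (back_final) d where "X = Back d" "f" "y = u @ Inl (f, l, Final d) # v"
  | (final_end) d x where "X = Final d" "l" "(d, x) \<in> out" "y = u @ Inr x # v"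
  | (move_right) q d b l' v' where "X = Carry q d" "v = Inl (False, l', Idle b) # v'"
      "y = u @ Inl (f, False, Idle d) # Inl (False, l', Head q b) # v'"
  | (move_left) d b f' u' where "X = Back d" "u = u' @ [Inl (f', False, Idle b)]"
      "y = u' @ Inl (f', False, Back b) # Inl (False, l, Idle d) # v"
  | (output_step) d x b l' v' where "X = Final d" "(d, x) \<in> out" "v = Inl (False, l', Idle b) # v'"
      "y = u @ Inr x # Inl (False, l', Final b) # v'"
proof -
  obtain p s r \<alpha> \<beta> where rule: "(r, \<alpha>, \<beta>) \<in> kuroda_rules K1 K2"
    and eq: "u @ Inl (f, l, X) # v = p @ \<alpha> @ s" "y = p @ \<beta> @ s"
    using st unfolding gstep_def by blast
  have uniq: "p' = u \<and> Y = (f, l, X) \<and> s' = v"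
    if "u @ Inl (f, l, X) # v = p' @ Inl Y # s'" "active (Inl Y :: ('q, 'g, 'a) symbol)" for p' Y s'
    using active_unique[OF that(1) _ that(2)] X inactive by auto
  from rule consider Y where "(Y, \<beta>) \<in> K1" "\<alpha> = [Inl Y]"
    | Y1 Y2 Z W where "(Y1, Y2, Z, W) \<in> K2" "\<alpha> = [Inl Y1, Inl Y2]" "\<beta> = [Z, W]"
    by (auto simp: kuroda_rules_iff)
  then show thesis
  proof cases
    case 1
    have "active (Inl Y :: ('q, 'g, 'a) symbol)" using 1(1) by (auto simp: K1_iff)
    then have "p = u" "Y = (f, l, X)" "s = v" using uniq[of p Y s] eq 1 by simp_all
    then show ?thesis using 1 eq head carry_end back_start back_final final_end by (auto simp: K1_iff)
  next
    case 2
    have eq1: "u @ Inl (f, l, X) # v = p @ Inl Y1 # Inl Y2 # s"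
      "u @ Inl (f, l, X) # v = (p @ [Inl Y1]) @ Inl Y2 # s"
      using eq 2 by simp_all
    from 2(1) show ?thesis
      unfolding K2_iff
    proof (elim disjE exE conjE)
      fix q d b f' l'
      assume Y: "Y1 = (f', False, Carry q d)" "Y2 = (False, l', Idle b)"
        "Z = Inl (f', False, Idle d)" "W = Inl (False, l', Head q b)"
      then have "p = u \<and> Y1 = (f, l, X) \<and> Inl Y2 # s = v" by (intro uniq eq1) simp
      then show ?thesis using Y eq 2 by (intro move_right[of q d l' b s]) auto
    next
      fix b d f' l'
      assume Y: "Y1 = (f', False, Idle b)" "Y2 = (False, l', Back d)"
        "Z = Inl (f', False, Back b)" "W = Inl (False, l', Idle d)"
      then have "p @ [Inl Y1] = u \<and> Y2 = (f, l, X) \<and> s = v" by (intro uniq eq1) simp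
      then show ?thesis using Y eq 2 by (intro move_left[of d p f' b]) auto
    next
      fix d x b f' l'
      assume Y: "(d, x) \<in> out" "Y1 = (f', False, Final d)" "Y2 = (False, l', Idle b)"
        "Z = Inr x" "W = Inl (False, l', Final b)"
      then have "p = u \<and> Y1 = (f, l, X) \<and> Inl Y2 # s = v" by (intro uniq eq1) simp
      then show ?thesis using Y eq 2 by (intro output_step[of d x l' b s]) auto
    qed
  qed
qed

section \<open>Soundness of the simulation: reachable configurations\<close>

definition config :: "'g list \<Rightarrow> ('q, 'g) cell \<Rightarrow> 'g list \<Rightarrow> ('q, 'g, 'a) symbol list" where
  "config p X s = pre True p @ Inl (p = [], s = [], X) # post s"

definition config_out :: "'a list \<Rightarrow> 'g \<Rightarrow> 'g list \<Rightarrow> ('q, 'g, 'a) symbol list" where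
  "config_out xs d s = map Inr xs @ Inl (xs = [], s = [], Final d) # post s"

definition outputs :: "'g list \<Rightarrow> 'a list \<Rightarrow> bool" where
  "outputs = list_all2 (\<lambda>d x. (d, x) \<in> out)"

text \<open>During a sweep only the image of the part already read is visible; this part itself, the
  \<open>w\<close> of \<open>inv_head\<close> and \<open>inv_carry\<close>, is therefore quantified
  existentially.\<close>

inductive inv :: "'g list \<Rightarrow> ('q, 'g, 'a) symbol list \<Rightarrow> bool" for w0 where
  inv_back: "sweep\<^sup>*\<^sup>* w0 (p @ d # s) \<Longrightarrow> inv w0 (config p (Back d) s)"
| inv_head: "sweep\<^sup>*\<^sup>* w0 (w @ a # s) \<Longrightarrow> q0 \<in> Qi \<Longrightarrow> run q0 w p q \<Longrightarrow> inv w0 (config p (Head q a) s)"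
| inv_carry: "sweep\<^sup>*\<^sup>* w0 (w @ s) \<Longrightarrow> q0 \<in> Qi \<Longrightarrow> run q0 w (p @ [d]) q \<Longrightarrow> inv w0 (config p (Carry q d) s)"
| inv_final: "sweep\<^sup>*\<^sup>* w0 (p @ d # s) \<Longrightarrow> outputs p xs \<Longrightarrow> inv w0 (config_out xs d s)"
| inv_done: "sweep\<^sup>*\<^sup>* w0 z \<Longrightarrow> outputs z xs \<Longrightarrow> inv w0 (map Inr xs)"

lemma inactive_config: "\<forall>z\<in>set (pre True p) \<union> set (post s). \<not> active z"
  "\<forall>z\<in>set (map Inr xs) \<union> set (post s). \<not> active z"
  using inactive_pre inactive_post by fastforce+

lemma active_cells: "\<not> idle (Head q a)" "\<not> idle (Carry q a)" "\<not> idle (Back a)" "\<not> idle (Final a)"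
  by simp_all

lemma inv_step:
  assumes "inv w0 y" "gst y y'"
  shows "inv w0 y'"
  using assms
proof (cases rule: inv.cases)
  case (inv_back p d s)
  have "gst (pre True p @ Inl (p = [], s = [], Back d) # post s) y'"
    using assms(2) inv_back by (simp add: config_def)
  from this active_cells(3) inactive_config(1) show ?thesis
  proof (cases rule: gst_cases)
    case (back_start q d')
    have "inv w0 (config [] (Head q d) s)"
      using inv_back back_start by (intro inv_head[of _ "[]"]) (auto intro: run_Nil)
    then show ?thesis using back_start by (simp add: config_def)
  next
    case (back_final d')
    have "inv w0 (config_out [] d s)"
      using inv_back back_final by (intro inv_final[of _ "[]"]) (auto simp: outputs_def)
    then show ?thesis using back_final by (simp add: config_out_def)
  next
    case (move_left d' b f' u')
    from move_left(2) obtain p' where p: "p = p' @ [b]" "u' = pre True p'" "f' = (p' = [])"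
      by (rule pre_eq_snoc) simp
    have "inv w0 (config p' (Back b) (d # s))"
      using inv_back(2) p by (intro inv.inv_back) simp
    then show ?thesis using move_left p by (simp add: config_def)
  qed auto
next
  case (inv_head w a s q0 p q)
  have "gst (pre True p @ Inl (p = [], s = [], Head q a) # post s) y'"
    using assms(2) inv_head by (simp add: config_def)
  from this active_cells(1) inactive_config(1) show ?thesis
  proof (cases rule: gst_cases)
    case (head q1 a1 q' v)
    then have v: "v \<noteq> []" "(q, a, q', v) \<in> T" using T by auto
    have "inv w0 (config (p @ butlast v) (Carry q' (last v)) s)"
    proof (rule inv_carry[of _ "w @ [a]" s q0])
      show "run q0 (w @ [a]) ((p @ butlast v) @ [last v]) q'"
        using run_snoc[OF inv_head(4) v(2)] v(1) by simp
    qed (use inv_head in auto)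
    then show ?thesis using head by (simp add: config_def emit_def pre_append)
  qed auto
next
  case (inv_carry w s q0 p d q)
  have "gst (pre True p @ Inl (p = [], s = [], Carry q d) # post s) y'"
    using assms(2) inv_carry by (simp add: config_def)
  from this active_cells(2) inactive_config(1) show ?thesis
  proof (cases rule: gst_cases)
    case (carry_end q1 d1)
    then have s: "s = []" and "sweep w (p @ [d])" using inv_carry by (auto simp: sweep_def)
    then have "sweep\<^sup>*\<^sup>* w0 (p @ d # [])" using inv_carry(2) by simp
    then have "inv w0 (config p (Back d) [])" by (rule inv_back)
    then show ?thesis using carry_end s by (simp add: config_def)
  next
    case (move_right q1 d1 b l' v')
    from move_right(2) obtain s' where s: "s = b # s'" "v' = post s'" "l' = (s' = [])"
      by (rule post_eq_Cons) simp
    have "inv w0 (config (p @ [d]) (Head q b) s')"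
      using inv_carry s by (intro inv_head[of _ w b s' q0]) auto
    then show ?thesis using move_right s by (simp add: config_def pre_append)
  qed auto
next
  case (inv_final p d s xs)
  have "gst (map Inr xs @ Inl (xs = [], s = [], Final d) # post s) y'"
    using assms(2) inv_final by (simp add: config_out_def)
  from this active_cells(4) inactive_config(2) show ?thesis
  proof (cases rule: gst_cases)
    case (final_end d1 x)
    have "outputs (p @ [d]) (xs @ [x])"
      using inv_final final_end by (auto simp: outputs_def intro: list_all2_appendI)
    then have "inv w0 (map Inr (xs @ [x]))" using inv_final final_end by (intro inv_done[of _ "p @ [d]"]) auto
    then show ?thesis using final_end by simp
  next
    case (output_step d1 x b l' v')
    from output_step(3) obtain s' where s: "s = b # s'" "v' = post s'" "l' = (s' = [])"
      by (rule post_eq_Cons) simp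
    have "outputs (p @ [d]) (xs @ [x])"
      using inv_final output_step by (auto simp: outputs_def intro: list_all2_appendI)
    then have "inv w0 (config_out (xs @ [x]) b s')"
      using inv_final s by (intro inv.inv_final[of _ "p @ [d]"]) auto
    then show ?thesis using output_step s by (simp add: config_out_def)
  qed auto
next
  case (inv_done z xs)
  obtain u v r \<alpha> \<beta> where "(r, \<alpha>, \<beta>) \<in> kuroda_rules K1 K2" "map Inr xs = u @ \<alpha> @ v"
    using assms(2) inv_done unfolding gstep_def by metis
  moreover from this(1) obtain Y \<alpha>' where "\<alpha> = Inl Y # \<alpha>'" by (auto simp: kuroda_rules_iff)
  ultimately have "Inl Y \<in> set (map Inr xs :: ('q, 'g, 'a) symbol list)" by simp
  then show ?thesis by auto
qed

text \<open>The empty word has no symbol that could be active; it stands for itself and admits no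
  step.\<close>

definition initial :: "'g list \<Rightarrow> ('q, 'g, 'a) symbol list" where
  "initial w = (case w of [] \<Rightarrow> [] | d # s \<Rightarrow> config [] (Back d) s)"

lemma inv_terminal:
  assumes "inv w0 (map Inr xs)"
  shows "\<exists>z. sweep\<^sup>*\<^sup>* w0 z \<and> outputs z xs"
proof -
  have no: "Inl X \<notin> set (map Inr xs :: ('q, 'g, 'a) symbol list)" for X by auto
  from assms show ?thesis
  proof (cases rule: inv.cases)
    case (inv_done z ys)
    then have "ys = xs" by (metis inj_Inr inj_map_eq_map)
    then show ?thesis using inv_done by blast
  qed (use no in \<open>auto simp: config_def config_out_def\<close>)
qed

lemma initial_sound:
  assumes "gst\<^sup>*\<^sup>* (initial w) (map Inr xs)"
  shows "\<exists>z. sweep\<^sup>*\<^sup>* w z \<and> outputs z xs"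
proof (cases w)
  case Nil
  have "inv w []" using inv_done[of w "[]" "[]"] Nil by (simp add: outputs_def)
  then have "inv w (initial w)" using Nil by (simp add: initial_def)
  from assms this have "inv w (map Inr xs)" by (induction rule: rtranclp_induct) (auto intro: inv_step)
  then show ?thesis by (rule inv_terminal)
next
  case (Cons d s)
  then have "inv w (initial w)" using inv_back[of w "[]" d s] by (simp add: initial_def)
  from assms this have "inv w (map Inr xs)" by (induction rule: rtranclp_induct) (auto intro: inv_step)
  then show ?thesis by (rule inv_terminal)
qed

section \<open>Completeness of the simulation\<close>

lemma gst_K1: "(X, \<gamma>) \<in> K1 \<Longrightarrow> gst (u @ Inl X # v) (u @ \<gamma> @ v)"
  unfolding gstep_def kuroda_rules_iff by (metis append_Cons append_Nil)

lemma gst_K2: "(X, Y, Z, W) \<in> K2 \<Longrightarrow> gst (u @ Inl X # Inl Y # v) (u @ Z # W # v)"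
  unfolding gstep_def kuroda_rules_iff by (metis append_Cons append_Nil)

lemma config_run:
  assumes "run q w x q'" "w = a # s" "w \<in> lists G"
  shows "gst\<^sup>*\<^sup>* (config p (Head q a) s) (config (p @ butlast x) (Carry q' (last x)) [])"
  using assms
proof (induction arbitrary: a s p)
  case (run_Cons q a' q1 v w x q')
  then have a: "a' = a" "w = s" by simp_all
  note v = T[OF run_Cons.hyps(1)]
  have "gst (config p (Head q a) s) (config (p @ butlast v) (Carry q1 (last v)) s)"
    using gst_K1[of "(p = [], s = [], Head q a)" "emit (p = []) (s = []) v q1" "pre True p" "post s"]
      run_Cons.hyps(1) a by (auto simp: K1_iff config_def emit_def pre_append)
  then have "gst\<^sup>*\<^sup>* (config p (Head q a) s) (config (p @ butlast v) (Carry q1 (last v)) s)"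
    by (rule r_into_rtranclp)
  also have "gst\<^sup>*\<^sup>* \<dots> (config (p @ butlast (v @ x)) (Carry q' (last (v @ x))) [])"
  proof (cases s)
    case Nil
    then have "w = []" using a by simp
    then have "x = []" "q' = q1" using run_Cons.hyps(2) by (auto elim: run.cases)
    then show ?thesis using Nil by simp
  next
    case (Cons b s')
    have pre_v: "pre True (p @ v) = (pre True (p @ butlast v) @ [Inl (p @ butlast v = [], False, Idle (last v))]
        :: ('q, 'g, 'a) symbol list)"
      using v pre_append[of True "p @ butlast v" "[last v]"] by simp
    have "b \<in> G" "last v \<in> G" using run_Cons.prems a Cons v by auto
    then have "gst (config (p @ butlast v) (Carry q1 (last v)) s) (config (p @ v) (Head q1 b) s')"
      using gst_K2[of "(p @ butlast v = [], False, Carry q1 (last v))" "(False, s' = [], Idle b)"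
          "Inl (p @ butlast v = [], False, Idle (last v))" "Inl (False, s' = [], Head q1 b)"
          "pre True (p @ butlast v)" "post s'"] v Cons pre_v
      by (auto simp: K2_iff config_def)
    then have "gst\<^sup>*\<^sup>* (config (p @ butlast v) (Carry q1 (last v)) s) (config (p @ v) (Head q1 b) s')"
      by (rule r_into_rtranclp)
    also have "gst\<^sup>*\<^sup>* \<dots> (config ((p @ v) @ butlast x) (Carry q' (last x)) [])"
      using run_Cons.IH[of b s' "p @ v"] a Cons run_Cons.prems by simp
    also have "x \<noteq> []" using run_empty_iff[OF run_Cons.hyps(2)] a Cons by simp
    then have "config ((p @ v) @ butlast x) (Carry q' (last x)) [] =
        config (p @ butlast (v @ x)) (Carry q' (last (v @ x))) []"
      by (simp add: butlast_append)
    finally show ?thesis .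
  qed
  finally show ?case .
qed simp

lemma config_back:
  assumes "p @ d # s \<in> lists G"
  shows "gst\<^sup>*\<^sup>* (config p (Back d) s) (initial (p @ d # s))"
  using assms
proof (induction p arbitrary: d s rule: rev_induct)
  case (snoc b p)
  have "gst (config (p @ [b]) (Back d) s) (config p (Back b) (d # s))"
    using gst_K2[of "(p = [], False, Idle b)" "(False, s = [], Back d)"
        "Inl (p = [], False, Back b)" "Inl (False, s = [], Idle d)" "pre True p" "post s"] snoc.prems
    by (auto simp: K2_iff config_def pre_append)
  then show ?case using snoc.IH[of b "d # s"] snoc.prems by (simp add: converse_rtranclp_into_rtranclp)
qed (simp add: initial_def)

lemma initial_sweep:
  assumes "sweep w w'" "w \<in> lists G"
  shows "gst\<^sup>*\<^sup>* (initial w) (initial w')"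
proof (cases w)
  case Nil
  then have "w' = []" using assms run_empty_iff unfolding sweep_def by blast
  then show ?thesis using Nil by simp
next
  case (Cons d s)
  obtain q q' where q: "q \<in> Qi" "q' \<in> Qf" "run q w w' q'" using assms unfolding sweep_def by blast
  have w': "w' \<noteq> []" using run_empty_iff[OF q(3)] Cons by simp
  have G: "d \<in> G" "w' \<in> lists G" "last w' \<in> G"
    using assms(2) Cons run_lists[OF q(3)] w' by auto
  have "gst (initial w) (config [] (Head q d) s)"
    using gst_K1[of "(True, s = [], Back d)" "[Inl (True, s = [], Head q d)]" "[]" "post s"] q G Cons
    by (auto simp: K1_iff config_def initial_def)
  then have "gst\<^sup>*\<^sup>* (initial w) (config [] (Head q d) s)"
    by (rule r_into_rtranclp)
  also have "gst\<^sup>*\<^sup>* \<dots> (config (butlast w') (Carry q' (last w')) [])"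
    using config_run[OF q(3) Cons assms(2), of "[]"] by simp
  also have "gst\<^sup>*\<^sup>* \<dots> (config (butlast w') (Back (last w')) [])"
    using gst_K1[of "(butlast w' = [], True, Carry q' (last w'))" "[Inl (butlast w' = [], True, Back (last w'))]"
        "pre True (butlast w')" "[]"] q G
    by (intro r_into_rtranclp) (auto simp: K1_iff config_def)
  also have "gst\<^sup>*\<^sup>* \<dots> (initial w')"
    using config_back[of "butlast w'" "last w'" "[]"] w' G by simp
  finally show ?thesis .
qed

lemma initial_sweeps:
  assumes "sweep\<^sup>*\<^sup>* w w'" "w \<in> lists G"
  shows "gst\<^sup>*\<^sup>* (initial w) (initial w') \<and> w' \<in> lists G"
  using assms(1)
proof (induction rule: rtranclp_induct)
  case (step y z)
  then have "gst\<^sup>*\<^sup>* (initial y) (initial z)" using initial_sweep by blast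
  moreover obtain q q' where "run q y z q'" using step(2) unfolding sweep_def by blast
  then have "z \<in> lists G" by (rule run_lists)
  ultimately show ?case using step.IH rtranclp_trans[of gst] by blast
qed (use assms(2) in simp)

lemma config_out_outputs:
  assumes "outputs (d # s) ys" "d # s \<in> lists G"
  shows "gst\<^sup>*\<^sup>* (config_out xs d s) (map Inr (xs @ ys))"
  using assms
proof (induction s arbitrary: d xs ys)
  case Nil
  then obtain y where y: "ys = [y]" "(d, y) \<in> out" by (auto simp: outputs_def list_all2_Cons1)
  have "gst (config_out xs d []) (map Inr (xs @ ys))"
    using gst_K1[of "(xs = [], True, Final d)" "[Inr y]" "map Inr xs" "[]"] y
    by (auto simp: K1_iff config_out_def)
  then show ?case by simp
next
  case (Cons b s)
  then obtain y ys' where y: "ys = y # ys'" "(d, y) \<in> out" "outputs (b # s) ys'"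
    by (auto simp: outputs_def list_all2_Cons1)
  have "gst (config_out xs d (b # s)) (config_out (xs @ [y]) b s)"
    using gst_K2[of "(xs = [], False, Final d)" "(False, s = [], Idle b)" "Inr y"
        "Inl (False, s = [], Final b)" "map Inr xs" "post s"] y Cons.prems
    by (auto simp: K2_iff config_out_def)
  then show ?case using Cons.IH[OF y(3), of "xs @ [y]"] Cons.prems y
    by (simp add: converse_rtranclp_into_rtranclp)
qed

lemma initial_outputs:
  assumes "outputs z xs" "z \<in> lists G"
  shows "gst\<^sup>*\<^sup>* (initial z) (map Inr xs)"
proof (cases z)
  case Nil
  then show ?thesis using assms by (simp add: outputs_def initial_def)
next
  case (Cons d s)
  have "gst (initial z) (config_out [] d s)"
    using gst_K1[of "(True, s = [], Back d)" "[Inl (True, s = [], Final d)]" "[]" "post s"] assms Cons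
    by (auto simp: K1_iff config_def config_out_def initial_def)
  then show ?thesis using config_out_outputs[of d s xs "[]"] assms Cons
    by (simp add: converse_rtranclp_into_rtranclp)
qed

lemma initial_iff:
  assumes "w \<in> lists G"
  shows "gst\<^sup>*\<^sup>* (initial w) (map Inr xs) \<longleftrightarrow> (\<exists>z. sweep\<^sup>*\<^sup>* w z \<and> outputs z xs)"
proof
  assume "\<exists>z. sweep\<^sup>*\<^sup>* w z \<and> outputs z xs"
  then obtain z where "sweep\<^sup>*\<^sup>* w z" "outputs z xs" by blast
  then have "gst\<^sup>*\<^sup>* (initial w) (initial z)" "gst\<^sup>*\<^sup>* (initial z) (map Inr xs)"
    using initial_sweeps[OF _ assms] initial_outputs by blast+
  then show "gst\<^sup>*\<^sup>* (initial w) (map Inr xs)" by (rule rtranclp_trans)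
qed (rule initial_sound)

lemma FCSL_transducer:
  assumes I: "finite I" "\<And>c w. (c, w) \<in> I \<Longrightarrow> w \<in> lists G \<and> 0 \<le> c \<and> c \<le> 1"
    and \<Delta>: "finite \<Delta>" "snd ` out \<subseteq> \<Delta>"
  shows "{(Max {c. \<exists>w z. (c, w) \<in> I \<and> sweep\<^sup>*\<^sup>* w z \<and> outputs z x}, x) | x.
           x \<in> lists \<Delta> \<and> (\<exists>c w z. (c, w) \<in> I \<and> sweep\<^sup>*\<^sup>* w z \<and> outputs z x)} \<in> FCSL"
proof -
  define I' where "I' = (\<lambda>(c, w). (c, initial w)) ` I"
  have I': "(c, y) \<in> I' \<longleftrightarrow> (\<exists>w. (c, w) \<in> I \<and> y = initial w)" for c y by (auto simp: I'_def)
  have ex: "(\<exists>y. (c, y) \<in> I' \<and> gst\<^sup>*\<^sup>* y (map Inr x)) \<longleftrightarrow>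
      (\<exists>w z. (c, w) \<in> I \<and> sweep\<^sup>*\<^sup>* w z \<and> outputs z x)" for c x
  proof
    assume "\<exists>y. (c, y) \<in> I' \<and> gst\<^sup>*\<^sup>* y (map Inr x)"
    then obtain w where "(c, w) \<in> I" "gst\<^sup>*\<^sup>* (initial w) (map Inr x)" using I' by auto
    then show "\<exists>w z. (c, w) \<in> I \<and> sweep\<^sup>*\<^sup>* w z \<and> outputs z x" using initial_sound by blast
  next
    assume "\<exists>w z. (c, w) \<in> I \<and> sweep\<^sup>*\<^sup>* w z \<and> outputs z x"
    then obtain w z where w: "(c, w) \<in> I" "sweep\<^sup>*\<^sup>* w z" "outputs z x" by blast
    then have "gst\<^sup>*\<^sup>* (initial w) (map Inr x)" using initial_iff I(2) by blast
    then show "\<exists>y. (c, y) \<in> I' \<and> gst\<^sup>*\<^sup>* y (map Inr x)" using w(1) I' by blast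
  qed
  have out_\<Delta>: "x \<in> \<Delta>" if "(d, x) \<in> out" for d x using that \<Delta>(2) by force
  have no_Inr: "Inr a \<notin> set (pre f v)" "Inr a \<notin> set (post v)" for a f v
    by (auto simp: pre_def split: list.splits) (induction v; simp)
  have "graded_start_language (kuroda_rules K1 K2) I' \<Delta> \<in> FCSL"
  proof (rule FCSL_kuroda)
    show "finite K1" "finite K2"
      using fin finite_subset[OF Qi fin(1)] finite_subset[OF Qf fin(1)] by (auto simp: K1_def K2_def)
    show "(X, []) \<notin> K1" for X by (auto simp: K1_iff emit_def)
    show "a \<in> \<Delta>" if "(X, \<gamma>) \<in> K1" "Inr a \<in> set \<gamma>" for X \<gamma> a
      using that out_\<Delta> unfolding K1_iff by (auto simp: emit_def no_Inr)
    show "a \<in> \<Delta>" if "(X, Y, Z, W) \<in> K2" "Inr a \<in> {Z, W}" for X Y Z W a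
      using that out_\<Delta> unfolding K2_iff by auto
    show "a \<in> \<Delta>" if "(c, y) \<in> I'" "Inr a \<in> set y" for c y a
    proof -
      obtain w where "y = initial w" using \<open>(c, y) \<in> I'\<close> I' by blast
      then show ?thesis using that(2) by (cases w) (auto simp: initial_def config_def no_Inr)
    qed
  qed (use I \<Delta> in \<open>auto simp: I'_def\<close>)
  moreover have "graded_start_language (kuroda_rules K1 K2) I' \<Delta> =
      {(Max {c. \<exists>w z. (c, w) \<in> I \<and> sweep\<^sup>*\<^sup>* w z \<and> outputs z x}, x) | x.
           x \<in> lists \<Delta> \<and> (\<exists>c w z. (c, w) \<in> I \<and> sweep\<^sup>*\<^sup>* w z \<and> outputs z x)}"
    unfolding graded_start_language_def by (rule graded_set_eqI) (simp_all only: ex)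
  ultimately show ?thesis by simp
qed

end

section \<open>Propagating systems\<close>

text \<open>The states of the transducer are the tables. A sweep picks a table at its start and
  never changes it, so one sweep is one derivation step; propagation makes the transducer
  nonerasing.\<close>

lemma FCSL_propagating:
  fixes H :: "('r, 'g) table set" and out :: "('g \<times> 'a::infinite) set"
  assumes fin: "finite G" "finite H" "\<And>h. h \<in> H \<Longrightarrow> finite h" "finite out"
    and H: "\<And>h r a u. h \<in> H \<Longrightarrow> (r, a, u) \<in> h \<Longrightarrow> u \<in> lists G \<and> u \<noteq> []"
    and I: "finite I" "\<And>c w. (c, w) \<in> I \<Longrightarrow> w \<in> lists G \<and> 0 \<le> c \<and> c \<le> 1"
    and \<Delta>: "finite \<Delta>" "snd ` out \<subseteq> \<Delta>"
  shows "{(Max {c. \<exists>w z. (c, w) \<in> I \<and> (\<exists>hs\<in>lists H. ders hs w z) \<and> list_all2 (\<lambda>d x. (d, x) \<in> out) z x}, x) | x.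
           x \<in> lists \<Delta> \<and> (\<exists>c w z. (c, w) \<in> I \<and> (\<exists>hs\<in>lists H. ders hs w z) \<and> list_all2 (\<lambda>d x. (d, x) \<in> out) z x)} \<in> FCSL"
proof -
  define T where "T = {(h, a, h, u) | h a u. h \<in> H \<and> u \<in> subst_letter h a}"
  have T_iff: "(h, a, h', u) \<in> T \<longleftrightarrow> h \<in> H \<and> h' = h \<and> u \<in> subst_letter h a" for h a h' u
    by (auto simp: T_def)
  interpret transducer H G T H H out
  proof
    have "T \<subseteq> (\<Union>h\<in>H. (\<lambda>(r, a, u). (h, a, h, u)) ` h)"
    proof
      fix t assume "t \<in> T"
      then obtain h r a u where "h \<in> H" "(r, a, u) \<in> h" "t = (h, a, h, u)"
        by (auto simp: T_def subst_letter_def)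
      then show "t \<in> (\<Union>h\<in>H. (\<lambda>(r, a, u). (h, a, h, u)) ` h)" by force
    qed
    moreover have "finite (\<Union>h\<in>H. (\<lambda>(r, a, u). (h, a, h, u)) ` h)" using fin by simp
    ultimately show "finite T" by (rule finite_subset)
    show "q' \<in> H \<and> v \<in> lists G \<and> v \<noteq> []" if "(q, a, q', v) \<in> T" for q a q' v
      using that H unfolding T_iff subst_letter_def by blast
  qed (use fin in auto)
  have run_sound: "h' = h \<and> x \<in> subst_word h w" if "run h w x h'" for h w x h'
    using that by induction (auto simp: T_iff)
  have run_complete: "run h w x h" if "x \<in> subst_word h w" "h \<in> H" for h w x
    using that
  proof (induction w arbitrary: x)
    case (Cons a w)
    then obtain u v where "x = u @ v" "u \<in> subst_letter h a" "v \<in> subst_word h w" by auto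
    with Cons show ?case by (auto simp: T_iff intro: run_Cons)
  qed (auto intro: run_Nil)
  have sweep_iff: "sweep w x \<longleftrightarrow> (\<exists>h\<in>H. x \<in> subst_word h w)" for w x
    using run_sound run_complete unfolding sweep_def by blast
  have sweeps: "sweep\<^sup>*\<^sup>* w z \<longleftrightarrow> (\<exists>hs\<in>lists H. ders hs w z)" for w z
  proof
    assume "sweep\<^sup>*\<^sup>* w z"
    then show "\<exists>hs\<in>lists H. ders hs w z"
    proof (induction rule: converse_rtranclp_induct)
      case base
      show ?case by (intro bexI[of _ "[]"]) simp_all
    next
      case (step w y)
      then obtain h hs where "h \<in> H" "y \<in> subst_word h w" "hs \<in> lists H" "ders hs y z"
        by (auto simp: sweep_iff)
      then show ?case by (intro bexI[of _ "h # hs"]) auto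
    qed
  next
    assume "\<exists>hs\<in>lists H. ders hs w z"
    then obtain hs where "hs \<in> lists H" "ders hs w z" by blast
    then show "sweep\<^sup>*\<^sup>* w z"
    proof (induction hs arbitrary: w)
      case (Cons h hs)
      then obtain y where "y \<in> subst_word h w" "ders hs y z" by auto
      moreover have "h \<in> H" using Cons by simp
      then have "sweep w y" using \<open>y \<in> subst_word h w\<close> unfolding sweep_iff by blast
      ultimately show ?case using Cons by (auto intro: converse_rtranclp_into_rtranclp)
    qed simp
  qed
  from FCSL_transducer[OF I \<Delta>] show ?thesis unfolding sweeps outputs_def .
qed

section \<open>Growth and length gaps of propagating systems\<close>

lemma propagating_length:
  assumes "y \<in> subst_word h w" "\<And>r a u. (r, a, u) \<in> h \<Longrightarrow> 1 \<le> length u \<and> length u \<le> k"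
  shows "length w \<le> length y \<and> length y \<le> k * length w"
  using assms(1)
proof (induction w arbitrary: y)
  case (Cons a w)
  then obtain u v where "y = u @ v" "u \<in> subst_letter h a" "v \<in> subst_word h w" by auto
  moreover from this have "1 \<le> length u \<and> length u \<le> k" using assms(2) by (auto simp: subst_letter_def)
  ultimately show ?case using Cons.IH[of v] by simp
qed simp

lemma propagating_ders_length:
  assumes "ders hs w z" "hs \<in> lists H" "\<And>h r a u. h \<in> H \<Longrightarrow> (r, a, u) \<in> h \<Longrightarrow> u \<noteq> []"
  shows "length w \<le> length z"
  using assms(1,2)
proof (induction hs arbitrary: w)
  case (Cons h hs)
  then obtain y where y: "y \<in> subst_word h w" "ders hs y z" by auto
  have h: "u \<noteq> []" if "u \<in> subst_letter h a" for a u
    using that Cons.prems(2) assms(3) by (auto simp: subst_letter_def)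
  have "length w \<le> length y"
    using y(1)
  proof (induction w arbitrary: y)
    case (Cons a w)
    then obtain u v where "y = u @ v" "u \<in> subst_letter h a" "v \<in> subst_word h w" by auto
    moreover from this have "u \<noteq> []" using h by blast
    ultimately show ?case using Cons.IH[of v] by (cases u) auto
  qed simp
  also have "\<dots> \<le> length z" using Cons.IH[OF y(2)] Cons.prems(2) by auto
  finally show ?case .
qed simp

text \<open>
  Whether a word can be terminated by a sequence of tables depends only on the letters in it. So
  one sequence per set of letters suffices, which bounds the growth from any sentential form.
\<close>

lemma propagating_termination_bound:
  fixes H :: "('r, 'g) table set" and D :: "'g set"
  assumes fin: "finite G"
  shows "\<exists>M. \<forall>v\<in>lists G. (\<exists>hs\<in>lists H. \<exists>z\<in>lists D. ders hs v z) \<longrightarrow>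
           (\<exists>hs\<in>lists H. \<exists>z\<in>lists D. ders hs v z \<and> length z \<le> M * length v)"
proof -
  define ok where "ok S hs g \<longleftrightarrow> hs \<in> lists H \<and> (\<forall>a\<in>S. g a \<in> lists D \<and> ders hs [a] (g a))"
    for S hs and g :: "'g \<Rightarrow> 'g list"
  define hs where "hs S = fst (SOME p. ok S (fst p) (snd p))" for S
  define g where "g S = snd (SOME p. ok S (fst p) (snd p))" for S
  have ok: "ok S (hs S) (g S)" if "ok S hs' g'" for S hs' g'
    using someI[of "\<lambda>p. ok S (fst p) (snd p)" "(hs', g')"] that by (simp add: hs_def g_def)
  define M where "M = Max (insert 0 ((\<lambda>(S, a). length (g S a)) ` (Pow G \<times> G)))"
  have M: "length (g S a) \<le> M" if "S \<subseteq> G" "a \<in> G" for S a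
    unfolding M_def using fin that by (intro Max_ge) auto
  have "\<exists>hs\<in>lists H. \<exists>z\<in>lists D. ders hs v z \<and> length z \<le> M * length v"
    if v: "v \<in> lists G" and ex: "hs' \<in> lists H" "z \<in> lists D" "ders hs' v z" for v hs' z
  proof -
    have "\<exists>z\<in>lists D. ders hs' [a] z" if "a \<in> set v" for a
    proof -
      obtain u w where "v = u @ [a] @ w" using split_list[OF \<open>a \<in> set v\<close>] by auto
      then obtain z1 z2 z3 where "z = z1 @ z2 @ z3" "ders hs' [a] z2"
        using ex(3) ders_append_word[of hs' u "[a] @ w"] ders_append_word[of hs' "[a]" w] by metis
      then show ?thesis using ex(2) by (intro bexI[of _ z2]) auto
    qed
    then obtain g' where "\<forall>a\<in>set v. g' a \<in> lists D \<and> ders hs' [a] (g' a)" by metis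
    then have "ok (set v) hs' g'" using ex by (simp add: ok_def)
    then have o: "ok (set v) (hs (set v)) (g (set v))" by (rule ok)
    then have "list_all2 (\<lambda>a. ders (hs (set v)) [a]) v (map (g (set v)) v)"
      by (simp add: ok_def list_all2_conv_all_nth)
    then have "ders (hs (set v)) v (concat (map (g (set v)) v))"
      unfolding ders_list_all2[of "hs (set v)" v] by blast
    moreover have "concat (map (g (set v)) v) \<in> lists D"
    proof -
      have "set (g (set v) a) \<subseteq> D" if "a \<in> set v" for a using o that by (auto simp: ok_def)
      then show ?thesis unfolding in_lists_conv_set set_concat set_map by blast
    qed
    moreover have "length (concat (map (g S) u)) \<le> M * length u" if "S \<subseteq> G" "set u \<subseteq> G" for u S
      using that(2) M[OF that(1)] by (induction u) (auto intro: add_mono)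
    then have "length (concat (map (g (set v)) v)) \<le> M * length v" using v by auto
    moreover have "hs (set v) \<in> lists H" using o by (simp add: ok_def)
    ultimately show ?thesis by blast
  qed
  then show ?thesis by blast
qed

text \<open>The first sentential form of length at least \<open>N\<close> has length at most
  \<open>k * N\<close>, where \<open>k\<close> bounds the right-hand sides. Terminating it
  economically costs another factor \<open>M\<close>, and propagation keeps the length at least
  \<open>N\<close>.\<close>

lemma propagating_length_gaps:
  fixes H :: "('r, 'g) table set" and D :: "'g set"
  assumes fin: "finite G" "finite H" "\<And>h. h \<in> H \<Longrightarrow> finite h"
    and H: "\<And>h r a u. h \<in> H \<Longrightarrow> (r, a, u) \<in> h \<Longrightarrow> u \<in> lists G \<and> u \<noteq> []"
    and I: "finite I" "I \<subseteq> lists G"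
  defines "L \<equiv> {z \<in> lists D. \<exists>w\<in>I. \<exists>hs\<in>lists H. ders hs w z}"
  shows "\<exists>C N0. \<forall>z\<in>L. \<forall>N\<ge>N0. N \<le> length z \<longrightarrow> (\<exists>z'\<in>L. N \<le> length z' \<and> length z' \<le> C * N)"
proof -
  obtain M where M: "\<And>v hs z. v \<in> lists G \<Longrightarrow> hs \<in> lists H \<Longrightarrow> z \<in> lists D \<Longrightarrow> ders hs v z \<Longrightarrow>
      \<exists>hs\<in>lists H. \<exists>z\<in>lists D. ders hs v z \<and> length z \<le> M * length v"
    using propagating_termination_bound[OF fin(1), of H D] by blast
  define k where "k = Max (insert 1 ((\<lambda>(r, a, u). length u) ` \<Union>H))"
  have finH: "finite (\<Union>H)" using fin by auto
  have k: "1 \<le> k" unfolding k_def using finH by (intro Max_ge) auto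
  have rhs: "1 \<le> length u \<and> length u \<le> k" if "h \<in> H" "(r, a, u) \<in> h" for h r a u
  proof
    show "1 \<le> length u" using H[OF that] by (cases u) auto
    have "length u \<in> insert 1 ((\<lambda>(r, a, u). length u) ` \<Union>H)" using that by force
    then show "length u \<le> k" unfolding k_def using finH by (intro Max_ge) auto
  qed
  define N0 where "N0 = Max (insert 0 (length ` I))"
  have N0: "length w \<le> N0" if "w \<in> I" for w unfolding N0_def using that I by (intro Max_ge) auto
  \<comment> \<open>\<open>hs0\<close> leads from the start word to the current \<open>v\<close>;
    the induction runs through the remaining tables until the length reaches
    \<open>N\<close>.\<close>
  have main: "\<exists>z'\<in>L. N \<le> length z' \<and> length z' \<le> M * k * N"
    if "ders hs v z" "hs \<in> lists H" "z \<in> lists D" "N \<le> length z" "length v \<le> k * N" "v \<in> lists G"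
      "w \<in> I" "hs0 \<in> lists H" "ders hs0 w v" for hs v z N w hs0
    using that
  proof (induction hs arbitrary: v hs0)
    case Nil
    note long = Nil
    show ?case
    proof -
      obtain hs z where hs: "hs \<in> lists H" "z \<in> lists D" "ders hs v z" "length z \<le> M * length v"
        using M[OF long(6,2,3,1)] by blast
      then have "z \<in> L" using long unfolding L_def
        by (auto simp del: in_lists_conv_set simp: ders_append intro!: bexI[of _ w] bexI[of _ "hs0 @ hs"])
      moreover have "length v \<le> length z" using propagating_ders_length[OF hs(3,1)] H by blast
      moreover have "N \<le> length v" using long by simp
      moreover have "M * length v \<le> M * k * N" using long(5) by (simp add: mult.assoc)
      ultimately show ?thesis using hs(4) by (intro bexI[of _ z] conjI) linarith+
    qed
  next
    case (Cons h hs)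
    show ?case
    proof (cases "N \<le> length v")
      case True
      obtain hs' z' where hs: "hs' \<in> lists H" "z' \<in> lists D" "ders hs' v z'" "length z' \<le> M * length v"
        using M[OF Cons.prems(6,2,3,1)] by blast
      then have "z' \<in> L" using Cons.prems unfolding L_def
        by (auto simp del: in_lists_conv_set simp: ders_append intro!: bexI[of _ w] bexI[of _ "hs0 @ hs'"])
      moreover have "length v \<le> length z'" using propagating_ders_length[OF hs(3,1)] H by blast
      moreover have "M * length v \<le> M * k * N" using Cons.prems(5) by (simp add: mult.assoc)
      ultimately show ?thesis using hs(4) True by (intro bexI[of _ z'] conjI) linarith+
    next
      case False
      obtain y where y: "y \<in> subst_word h v" "ders hs y z" using Cons.prems(1) by auto
      have h: "h \<in> H" using Cons.prems(2) by simp
      have "length y \<le> k * length v" using propagating_length[OF y(1)] rhs[OF h] by blast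
      also have "\<dots> \<le> k * N" using False by simp
      finally have ly: "length y \<le> k * N" .
      have yG: "y \<in> lists G"
        using y(1) H[OF h] unfolding subst_word_productions by fastforce
      have d: "ders (hs0 @ [h]) w y" using Cons.prems(9) y(1) by (auto simp: ders_append)
      have "hs \<in> lists H" "hs0 @ [h] \<in> lists H" using Cons.prems(2,8) by simp_all
      then show ?thesis using Cons.IH[OF y(2) _ Cons.prems(3,4) ly yG Cons.prems(7) _ d] by blast
    qed
  qed
  have "\<exists>z'\<in>L. N \<le> length z' \<and> length z' \<le> M * k * N"
    if z: "z \<in> L" and N: "N0 \<le> N" "N \<le> length z" for z N
  proof -
    obtain w hs where w: "z \<in> lists D" "w \<in> I" "hs \<in> lists H" "ders hs w z" using z by (auto simp: L_def)
    have "length w \<le> k * N" using N0[OF w(2)] N(1) k by (metis le_trans mult_le_mono1 nat_mult_1)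
    then show ?thesis using main[OF w(4,3,1) N(2), of w "[]"] w I by auto
  qed
  then show ?thesis by blast
qed


section \<open>Elimination of erasing\<close>

text \<open>Occurrences of letters of \<open>Y\<close> may be dropped but need not be: different
  occurrences of a letter may be rewritten by different productions, and some of them may
  survive.\<close>

inductive part :: "'a set \<Rightarrow> 'a list \<Rightarrow> 'a list \<Rightarrow> bool" for Y where
  part_Nil: "part Y [] []"
| part_keep: "part Y u v \<Longrightarrow> part Y (a # u) (a # v)"
| part_drop: "a \<in> Y \<Longrightarrow> part Y u v \<Longrightarrow> part Y (a # u) v"

lemma part_refl: "part Y u u"
  by (induction u) (auto intro: part.intros)

lemma part_append: "part Y u v \<Longrightarrow> part Y u' v' \<Longrightarrow> part Y (u @ u') (v @ v')"
  by (induction rule: part.induct) (auto intro: part.intros)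

lemma part_append_split:
  "part Y (u @ u') w \<Longrightarrow> \<exists>v v'. w = v @ v' \<and> part Y u v \<and> part Y u' v'"
proof (induction u arbitrary: w)
  case Nil
  then show ?case by (intro exI[of _ "[]"] exI[of _ w]) (auto intro: part_Nil)
next
  case (Cons a u)
  from Cons.prems have "part Y (a # (u @ u')) w" by simp
  then consider w' where "w = a # w'" "part Y (u @ u') w'" | "a \<in> Y" "part Y (u @ u') w"
    by cases auto
  then show ?case
  proof cases
    case 1
    then obtain v v' where "w' = v @ v'" "part Y u v" "part Y u' v'" using Cons.IH by blast
    then show ?thesis using 1 by (intro exI[of _ "a # v"] exI[of _ v']) (auto intro: part_keep)
  next
    case 2
    then obtain v v' where "w = v @ v'" "part Y u v" "part Y u' v'" using Cons.IH by blast
    then show ?thesis using 2 by (intro exI[of _ v] exI[of _ v']) (auto intro: part_drop)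
  qed
qed

lemma part_empty: "part {} u v \<Longrightarrow> u = v"
  by (induction rule: part.induct) auto

lemma part_all: "set u \<subseteq> Y \<Longrightarrow> part Y u []"
  by (induction u) (auto intro: part.intros)

lemma part_Nil_right: "part Y u [] \<Longrightarrow> set u \<subseteq> Y"
  by (induction u "[] :: 'a list" rule: part.induct) auto

lemma part_bounds: "part Y u v \<Longrightarrow> set v \<subseteq> set u \<and> length v \<le> length u"
  by (induction rule: part.induct) auto

lemma finite_part: "finite {v. part Y u v}"
  by (rule finite_subset[OF _ finite_lists_length_le[of "set u" "length u"]]) (use part_bounds in auto)

text \<open>A backward step: if \<open>Y\<close> can vanish under the remaining tables, these
  letters can vanish under \<open>h\<close> followed by them. With no table remaining the set is
  empty.\<close>

definition vanishing :: "('r, 'a) table \<Rightarrow> 'a set \<Rightarrow> 'a set" where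
  "vanishing h Y = {a. \<exists>u\<in>subst_letter h a. set u \<subseteq> Y}"

definition mark :: "real \<Rightarrow> 'a set \<Rightarrow> 'a list \<Rightarrow> ('a \<times> real \<times> 'a set) list" where
  "mark c Y v = map (\<lambda>a. (a, c, Y)) v"

text \<open>
  The letters of the propagating system carry a grade, which never changes, and the set of the
  letters that are to vanish; only the occurrences that do not vanish are kept.
\<close>

definition ptable :: "real \<Rightarrow> ('r, 'a) table \<Rightarrow> 'a set \<Rightarrow> ('r, 'a \<times> real \<times> 'a set) table" where
  "ptable c h Y = {(r, (a, c, vanishing h Y), mark c Y v) | r a u v. (r, a, u) \<in> h \<and> part Y u v \<and> v \<noteq> []}"

definition ptables :: "'a set \<Rightarrow> real \<Rightarrow> ('r, 'a) table set \<Rightarrow> ('r, 'a \<times> real \<times> 'a set) table set" where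
  "ptables \<Sigma> c H = (\<lambda>(h, Y). ptable c h Y) ` (H \<times> Pow \<Sigma>)"

lemma mark_simps [simp]: "mark c Y [] = []" "mark c Y (a # v) = (a, c, Y) # mark c Y v"
  "mark c Y (u @ v) = mark c Y u @ mark c Y v" "length (mark c Y v) = length v"
  "mark c Y v = [] \<longleftrightarrow> v = []"
  by (simp_all add: mark_def)

lemma mark_inj: "mark c Y v = mark c Y w \<longleftrightarrow> v = w"
  unfolding mark_def by (rule inj_map_eq_map) (simp add: inj_def)

lemma mark_eq_append:
  "mark c Y v = x @ y \<Longrightarrow> \<exists>v1 v2. v = v1 @ v2 \<and> x = mark c Y v1 \<and> y = mark c Y v2"
  unfolding mark_def by (auto simp: map_eq_append_conv)

lemma subst_letter_ptable:
  "x \<in> subst_letter (ptable c h Y) (a, c', Y') \<longleftrightarrow>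
     c' = c \<and> Y' = vanishing h Y \<and> (\<exists>u v. u \<in> subst_letter h a \<and> part Y u v \<and> v \<noteq> [] \<and> x = mark c Y v)"
  unfolding subst_letter_def ptable_def by auto

lemma finite_ptable: "finite h \<Longrightarrow> finite (ptable c h Y)"
proof -
  assume "finite h"
  have "ptable c h Y \<subseteq> (\<Union>(r, a, u)\<in>h. (\<lambda>v. (r, (a, c, vanishing h Y), mark c Y v)) ` {v. part Y u v})"
    by (auto simp: ptable_def)
  moreover have "finite \<dots>" using \<open>finite h\<close> finite_part by auto
  ultimately show ?thesis by (rule finite_subset)
qed

lemma ptable_word_shape:
  "y \<in> subst_word (ptable c h Y) (mark c' Y' v) \<Longrightarrow> v \<noteq> [] \<Longrightarrow>
     c' = c \<and> Y' = vanishing h Y \<and> (\<exists>v'. v' \<noteq> [] \<and> y = mark c Y v')"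
proof (induction v arbitrary: y)
  case (Cons a v)
  then obtain x z where y: "y = x @ z" "x \<in> subst_letter (ptable c h Y) (a, c', Y')"
    "z \<in> subst_word (ptable c h Y) (mark c' Y' v)" by auto
  then obtain v1 where v1: "c' = c" "Y' = vanishing h Y" "v1 \<noteq> []" "x = mark c Y v1"
    by (auto simp: subst_letter_ptable)
  have "\<exists>v2. z = mark c Y v2"
  proof (cases "v = []")
    case True
    then have "z = mark c Y []" using y(3) by simp
    then show ?thesis ..
  qed (use Cons.IH[OF y(3)] in blast)
  then obtain v2 where "z = mark c Y v2" ..
  then have "y = mark c Y (v1 @ v2)" using y v1 by simp
  then show ?case using v1 by blast
qed simp

text \<open>A dropped occurrence is given a production with right-hand side over \<open>Y\<close>,
  all letters of which are dropped again.\<close>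

lemma ptable_word_sound:
  assumes "part (vanishing h Y) \<alpha> v"
    "mark c Y v' \<in> subst_word (ptable c h Y) (mark c (vanishing h Y) v)"
  shows "\<exists>\<alpha>'\<in>subst_word h \<alpha>. part Y \<alpha>' v'"
  using assms
proof (induction arbitrary: v')
  case part_Nil
  then show ?case by (auto intro: part.part_Nil)
next
  case (part_keep u v a)
  then obtain x z where y: "mark c Y v' = x @ z" "x \<in> subst_letter (ptable c h Y) (a, c, vanishing h Y)"
    "z \<in> subst_word (ptable c h Y) (mark c (vanishing h Y) v)" by auto
  then obtain v1 v2 where v: "v' = v1 @ v2" "x = mark c Y v1" "z = mark c Y v2"
    using mark_eq_append by metis
  then obtain w where w: "w \<in> subst_letter h a" "part Y w v1"
    using y(2) by (auto simp: subst_letter_ptable mark_inj)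
  obtain \<alpha>' where "\<alpha>' \<in> subst_word h u" "part Y \<alpha>' v2" using part_keep.IH[of v2] y(3) v(3) by blast
  then show ?case using w v by (intro bexI[of _ "w @ \<alpha>'"]) (auto intro: part_append)
next
  case (part_drop a u v)
  then obtain w where w: "w \<in> subst_letter h a" "part Y w []"
    by (auto simp: vanishing_def dest: part_all)
  obtain \<alpha>' where "\<alpha>' \<in> subst_word h u" "part Y \<alpha>' v'" using part_drop.IH part_drop.prems by blast
  then show ?case using w part_append[OF w(2), of \<alpha>' v'] by (intro bexI[of _ "w @ \<alpha>'"]) auto
qed

text \<open>An occurrence is dropped exactly when everything that it produces is dropped; this keeps
  the right-hand sides of \<open>ptable\<close> nonempty.\<close>

lemma ptable_word_complete:
  assumes "\<alpha>' \<in> subst_word h \<alpha>" "part Y \<alpha>' v'"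
  shows "\<exists>v. part (vanishing h Y) \<alpha> v \<and> mark c Y v' \<in> subst_word (ptable c h Y) (mark c (vanishing h Y) v)"
  using assms
proof (induction \<alpha> arbitrary: \<alpha>' v')
  case Nil
  then have "v' = []" by (auto elim: part.cases)
  then show ?case by (intro exI[of _ "[]"]) (auto intro: part_Nil)
next
  case (Cons a \<alpha>)
  then obtain u \<beta> where u: "\<alpha>' = u @ \<beta>" "u \<in> subst_letter h a" "\<beta> \<in> subst_word h \<alpha>" by auto
  then obtain v1 v2 where v: "v' = v1 @ v2" "part Y u v1" "part Y \<beta> v2"
    using Cons.prems part_append_split by blast
  obtain v where IH: "part (vanishing h Y) \<alpha> v"
    "mark c Y v2 \<in> subst_word (ptable c h Y) (mark c (vanishing h Y) v)"
    using Cons.IH[OF u(3) v(3)] by blast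
  show ?case
  proof (cases "v1 = []")
    case True
    then have "a \<in> vanishing h Y" using part_Nil_right[of Y u] v u by (auto simp: vanishing_def)
    then show ?thesis using IH True v by (intro exI[of _ v]) (auto intro: part_drop)
  next
    case False
    then have "mark c Y v1 \<in> subst_letter (ptable c h Y) (a, c, vanishing h Y)"
      using u v by (auto simp: subst_letter_ptable)
    then have "mark c Y v' \<in> subst_word (ptable c h Y) (mark c (vanishing h Y) (a # v))"
      using IH v by auto
    then show ?thesis using IH(1) by (blast intro: part_keep)
  qed
qed

text \<open>A table made for another grade has no production for a letter marked \<open>c\<close>,
  so one family of tables serves all thresholds. Every \<open>\<alpha>\<close> with part
  \<open>v\<close> is considered, since the dropped occurrences cannot be seen in
  \<open>v\<close>.\<close>

lemma ptables_sound:
  assumes "ders hs (mark c Y v) z" "hs \<in> lists (\<Union>c\<in>C. ptables \<Sigma> c (Hc c))" "v \<noteq> []"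
  shows "\<exists>Y' v'. v' \<noteq> [] \<and> z = mark c Y' v' \<and>
    (\<forall>\<alpha>. part Y \<alpha> v \<longrightarrow> (\<exists>hs'\<in>lists (Hc c). \<exists>\<alpha>'. ders hs' \<alpha> \<alpha>' \<and> part Y' \<alpha>' v'))"
  using assms
proof (induction hs arbitrary: Y v)
  case Nil
  have "\<exists>hs'\<in>lists (Hc c). \<exists>\<alpha>'. ders hs' \<alpha> \<alpha>' \<and> part Y \<alpha>' v" if "part Y \<alpha> v" for \<alpha>
    using that by (intro bexI[of _ "[]"]) auto
  then show ?case using Nil by (intro exI[of _ Y] exI[of _ v]) auto
next
  case (Cons k hs)
  obtain c1 h Y1 where k: "k = ptable c1 h Y1" "h \<in> Hc c1" using Cons.prems(2) by (auto simp: ptables_def)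
  obtain y where y: "y \<in> subst_word k (mark c Y v)" "ders hs y z" using Cons.prems(1) by auto
  obtain v1 where v1: "c = c1" "Y = vanishing h Y1" "v1 \<noteq> []" "y = mark c1 Y1 v1"
    using ptable_word_shape[OF y(1)[unfolded k] Cons.prems(3)] by blast
  obtain Y' v' where IH: "v' \<noteq> []" "z = mark c Y' v'"
    "\<And>\<alpha>. part Y1 \<alpha> v1 \<Longrightarrow> \<exists>hs'\<in>lists (Hc c). \<exists>\<alpha>'. ders hs' \<alpha> \<alpha>' \<and> part Y' \<alpha>' v'"
    using Cons.IH[of Y1 v1] y(2) v1 Cons.prems(2) by auto
  have "\<exists>hs'\<in>lists (Hc c). \<exists>\<alpha>'. ders hs' \<alpha> \<alpha>' \<and> part Y' \<alpha>' v'" if "part Y \<alpha> v" for \<alpha>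
  proof -
    obtain \<beta> where \<beta>: "\<beta> \<in> subst_word h \<alpha>" "part Y1 \<beta> v1"
      using ptable_word_sound[of h Y1 \<alpha> v c v1] \<open>part Y \<alpha> v\<close> y(1) v1 k by auto
    then obtain hs' \<alpha>' where "hs' \<in> lists (Hc c)" "ders hs' \<beta> \<alpha>'" "part Y' \<alpha>' v'" using IH(3) by blast
    then show ?thesis using \<beta> k v1 by (intro bexI[of _ "h # hs'"] exI[of _ \<alpha>']) auto
  qed
  then show ?case using IH(1,2) by blast
qed

text \<open>The sets are computed backwards, starting from \<open>{}\<close> at the final word
  \<open>x\<close>, of which nothing is dropped.\<close>

lemma ptables_complete:
  assumes "ders hs \<alpha> x" "hs \<in> lists (Hc c)" "x \<noteq> []" "c \<in> C"
    and \<Sigma>: "\<And>h. h \<in> Hc c \<Longrightarrow> h \<subseteq> UNIV \<times> \<Sigma> \<times> lists \<Sigma>"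
  shows "\<exists>Y v hs'. Y \<subseteq> \<Sigma> \<and> part Y \<alpha> v \<and> v \<noteq> [] \<and> hs' \<in> lists (\<Union>c\<in>C. ptables \<Sigma> c (Hc c)) \<and>
    ders hs' (mark c Y v) (mark c {} x)"
  using assms(1,2)
proof (induction hs arbitrary: \<alpha>)
  case Nil
  then show ?case using assms(3) by (intro exI[of _ "{}"] exI[of _ x] exI[of _ "[]"]) (auto intro: part_refl)
next
  case (Cons h hs)
  obtain \<beta> where \<beta>: "\<beta> \<in> subst_word h \<alpha>" "ders hs \<beta> x" using Cons.prems by auto
  obtain Y v hs' where IH: "Y \<subseteq> \<Sigma>" "part Y \<beta> v" "v \<noteq> []"
    "hs' \<in> lists (\<Union>c\<in>C. ptables \<Sigma> c (Hc c))" "ders hs' (mark c Y v) (mark c {} x)"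
    using Cons.IH[OF \<beta>(2)] Cons.prems(2) unfolding Cons_in_lists_iff by blast
  obtain v0 where v0: "part (vanishing h Y) \<alpha> v0"
    "mark c Y v \<in> subst_word (ptable c h Y) (mark c (vanishing h Y) v0)"
    using ptable_word_complete[OF \<beta>(1) IH(2)] by blast
  have h: "h \<in> Hc c" using Cons.prems by simp
  have "v0 \<noteq> []" using v0(2) IH(3) by auto
  moreover have "vanishing h Y \<subseteq> \<Sigma>" using \<Sigma>[OF h] by (auto simp: vanishing_def subst_letter_def)
  moreover have "ptable c h Y \<in> (\<Union>c\<in>C. ptables \<Sigma> c (Hc c))"
    using assms(4) h IH(1) by (auto simp: ptables_def)
  then have "ptable c h Y # hs' \<in> lists (\<Union>c\<in>C. ptables \<Sigma> c (Hc c))" using IH(4) by simp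
  moreover have "ders (ptable c h Y # hs') (mark c (vanishing h Y) v0) (mark c {} x)"
    using v0(2) IH(5) by auto
  ultimately show ?case using v0(1) by blast
qed

lemma ptables_finite:
  assumes "finite \<Sigma>" "finite C" "\<And>c. finite (Hc c)" "\<And>c h. h \<in> Hc c \<Longrightarrow> finite h"
  shows "finite (\<Union>c\<in>C. ptables \<Sigma> c (Hc c))" "k \<in> (\<Union>c\<in>C. ptables \<Sigma> c (Hc c)) \<Longrightarrow> finite k"
proof -
  show "finite (\<Union>c\<in>C. ptables \<Sigma> c (Hc c))" using assms(1,2,3) by (simp add: ptables_def)
  show "finite k" if "k \<in> (\<Union>c\<in>C. ptables \<Sigma> c (Hc c))"
  proof -
    from that obtain c h Y where "h \<in> Hc c" "k = ptable c h Y" by (auto simp: ptables_def)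
    then show ?thesis using assms(4) finite_ptable by blast
  qed
qed

lemma ptables_rhs:
  assumes "k \<in> (\<Union>c\<in>C. ptables \<Sigma> c (Hc c))" "(r, b, u) \<in> k"
    and \<Sigma>: "\<And>c h. h \<in> Hc c \<Longrightarrow> h \<subseteq> UNIV \<times> \<Sigma> \<times> lists \<Sigma>"
  shows "u \<in> lists (\<Sigma> \<times> C \<times> Pow \<Sigma>) \<and> u \<noteq> []"
proof -
  obtain c h Y where "c \<in> C" "h \<in> Hc c" "Y \<subseteq> \<Sigma>" "k = ptable c h Y" using assms(1) by (auto simp: ptables_def)
  then obtain a w v where "(r, a, w) \<in> h" "part Y w v" "v \<noteq> []" "u = mark c Y v"
    using assms(2) by (auto simp: ptable_def)
  moreover from this have "set v \<subseteq> \<Sigma>" using \<Sigma>[OF \<open>h \<in> Hc c\<close>] part_bounds by fastforce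
  ultimately show ?thesis using \<open>c \<in> C\<close> \<open>Y \<subseteq> \<Sigma>\<close> by (auto simp: mark_def)
qed

section \<open>ET0L languages are context-sensitive\<close>

text \<open>A cut table may leave letters without a production and then belongs to no fuzzy 0L
  system; the derivation relations are defined for it all the same.\<close>

definition cut :: "real \<Rightarrow> ('r \<Rightarrow> real) \<Rightarrow> ('r, 'a) table \<Rightarrow> ('r, 'a) table" where
  "cut c f h = {p \<in> h. c \<le> f (fst p)}"

lemma L_derivation_cut:
  "L_derivation (cut c f ` H) \<omega> rs x \<longleftrightarrow> L_derivation H \<omega> rs x \<and> (\<forall>r\<in>set rs. c \<le> f r)"
proof
  assume "L_derivation (cut c f ` H) \<omega> rs x"
  then show "L_derivation H \<omega> rs x \<and> (\<forall>r\<in>set rs. c \<le> f r)"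
  proof induction
    case (step rs x h' ps y)
    then obtain h where h: "h \<in> H" "h' = cut c f h" by blast
    then have "set ps \<subseteq> h" "\<forall>p\<in>set ps. c \<le> f (fst p)" using step.hyps(3) by (auto simp: cut_def)
    then show ?case using step h L_derivation.step[of H \<omega> rs x h ps y] by auto
  qed (auto intro: L_derivation.start)
next
  assume "L_derivation H \<omega> rs x \<and> (\<forall>r\<in>set rs. c \<le> f r)"
  then have "L_derivation H \<omega> rs x" "\<forall>r\<in>set rs. c \<le> f r" by blast+
  then show "L_derivation (cut c f ` H) \<omega> rs x"
  proof induction
    case (step rs x h ps y)
    then have "set ps \<subseteq> cut c f h" by (auto simp: cut_def)
    then show ?case using step by (intro L_derivation.step[of _ _ _ x "cut c f h"]) auto
  qed (auto intro: L_derivation.start)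
qed

lemma FET0L_subset_FCSL: "(FET0L :: 'a::infinite fuzzy_language set) \<subseteq> FCSL"
proof
  fix F :: "'a fuzzy_language"
  assume "F \<in> FET0L"
  then obtain \<Sigma> H \<omega> and J :: "nat set" and f \<Delta> where F: "F = fuzzy_language_ET0L H \<omega> J f \<Delta>"
    and E: "fuzzy_ET0L \<Sigma> H \<omega> J f \<Delta>" by (auto simp: FET0L_def)
  have T: "finite H" "H \<noteq> {}" "\<And>h. h \<in> H \<Longrightarrow> fuzzy_0L \<Sigma> h \<omega> (fst ` h) f" "J = (\<Union>h\<in>H. fst ` h)"
    and \<Delta>: "\<Delta> \<subseteq> \<Sigma>"
    using E unfolding fuzzy_ET0L_def fuzzy_T0L_def by blast+
  have \<Sigma>: "finite \<Sigma>" "\<Sigma> \<noteq> {}" "\<omega> \<in> lists \<Sigma>" using T(2,3) unfolding fuzzy_0L_def by blast+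
  have h: "finite h" "h \<subseteq> UNIV \<times> \<Sigma> \<times> lists \<Sigma>" "h \<noteq> {}" "\<And>r. r \<in> fst ` h \<Longrightarrow> 0 \<le> f r \<and> f r \<le> 1"
    if "h \<in> H" for h
    using T(3)[OF that] \<Sigma>(2) unfolding fuzzy_0L_def graded_labelling_def by blast+
  have J: "finite J" "J \<noteq> {}" using T(1,2,4) h by auto
  define C where "C = f ` J"
  have C: "finite C" "C \<noteq> {}" "\<And>c. c \<in> C \<Longrightarrow> 0 \<le> c \<and> c \<le> 1" using J T(4) h(4) by (auto simp: C_def)
  define Hc where "Hc c = cut c f ` H" for c
  have Hc: "h' \<subseteq> UNIV \<times> \<Sigma> \<times> lists \<Sigma>" "finite h'" if "h' \<in> Hc c" for h' c
  proof -
    from that obtain h0 where h0: "h0 \<in> H" "h' \<subseteq> h0" by (auto simp: Hc_def cut_def)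
    show "h' \<subseteq> UNIV \<times> \<Sigma> \<times> lists \<Sigma>" using h0 h(2) by blast
    show "finite h'" using h0 h(1) finite_subset by blast
  qed
  \<comment> \<open>The thresholds under which \<open>x\<close> is derivable; the grade of a
    generated word is the largest of them.\<close>
  define A where "A x = {c \<in> C. \<exists>hs\<in>lists (Hc c). ders hs \<omega> x}" for x
  have A_deriv: "c \<in> A x \<longleftrightarrow> c \<in> C \<and> (\<exists>rs. L_derivation H \<omega> rs x \<and> (\<forall>r\<in>set rs. c \<le> f r))" for c x
    unfolding A_def Hc_def L_derivation_ders[symmetric] L_derivation_cut by blast
  have Min_C: "Min (f ` set rs) \<in> C \<and> Min (f ` set rs) \<in> A x" if "L_derivation H \<omega> rs x" "rs \<noteq> []" for rs x
  proof -
    have "Min (f ` set rs) \<in> f ` set rs" using that by (intro Min_in) auto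
    moreover have "set rs \<subseteq> J" using L_derivation_labels[OF that(1)] T(4) by simp
    ultimately have "Min (f ` set rs) \<in> C" by (auto simp: C_def)
    then show ?thesis using that unfolding A_deriv by auto
  qed
  have grade: "grade_T0L H \<omega> J f x = Max (A x)" if x: "x \<in> language_T0L H \<omega>" for x
  proof (cases "x = \<omega>")
    case True
    have "A \<omega> = C" unfolding A_def by (auto intro: bexI[of _ "[]"])
    then show ?thesis using True by (simp add: grade_T0L_def C_def)
  next
    case False
    define B where "B = {Min (f ` set rs) | rs. L_derivation H \<omega> rs x}"
    have ne: "rs \<noteq> []" if "L_derivation H \<omega> rs x" for rs using that False L_derivation_no_labels by blast
    have BA: "B \<subseteq> A x" using Min_C ne by (auto simp: B_def)
    have finA: "finite (A x)" using C(1) by (simp add: A_def)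
    obtain rs where "L_derivation H \<omega> rs x"
      using x unfolding language_T0L_iff L_derivation_ders[symmetric] by blast
    then have "B \<noteq> {}" by (auto simp: B_def)
    have "Max B = Max (A x)"
    proof (rule antisym)
      show "Max B \<le> Max (A x)" using BA \<open>B \<noteq> {}\<close> finA by (rule Max_mono)
      have "Max (A x) \<in> A x" using BA \<open>B \<noteq> {}\<close> finA by (intro Max_in) auto
      then obtain rs where rs: "L_derivation H \<omega> rs x" "\<forall>r\<in>set rs. Max (A x) \<le> f r" unfolding A_deriv by blast
      then have "Max (A x) \<le> Min (f ` set rs)" using ne by (intro Min.boundedI) auto
      also have "\<dots> \<le> Max B" using rs finite_subset[OF BA finA] by (intro Max_ge) (auto simp: B_def)
      finally show "Max (A x) \<le> Max B" .
    qed
    then show ?thesis using False by (simp add: grade_T0L_def B_def)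
  qed
  have lang: "x \<in> language_T0L H \<omega> \<longleftrightarrow> A x \<noteq> {}" for x
  proof
    assume "x \<in> language_T0L H \<omega>"
    then obtain rs where rs: "L_derivation H \<omega> rs x"
      unfolding language_T0L_iff L_derivation_ders[symmetric] by blast
    show "A x \<noteq> {}"
    proof (cases "rs = []")
      case True
      then have "c \<in> A x" if "c \<in> C" for c
        unfolding A_deriv using that rs by (intro conjI exI[of _ rs]) auto
      then show ?thesis using C(2) by blast
    qed (use Min_C[OF rs] in auto)
  next
    assume "A x \<noteq> {}"
    then obtain c where "c \<in> A x" by blast
    then show "x \<in> language_T0L H \<omega>"
      unfolding A_deriv language_T0L_iff L_derivation_ders[symmetric] by blast
  qed
  define PH where "PH = (\<Union>c\<in>C. ptables \<Sigma> c (Hc c))"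
  \<comment> \<open>Only letters marked \<open>{}\<close> are translated: at the end nothing may be
    left that is still to vanish.\<close>
  define out where "out = (\<lambda>(a, c). ((a, c, {} :: 'a set), a)) ` (\<Delta> \<times> C)"
  \<comment> \<open>For the axiom the set \<open>Y\<close> is guessed. Nonempty words of a
    propagating system never become empty, so the empty word enters as a start word of its own with
    the thresholds \<open>A []\<close>.\<close>
  define I where "I = (\<Union>c\<in>C. \<Union>Y\<in>Pow \<Sigma>. (\<lambda>v. (c, mark c Y v)) ` {v. part Y \<omega> v \<and> v \<noteq> []}) \<union>
    (\<lambda>c. (c, [])) ` A []"
  define R where "R c x \<longleftrightarrow> (\<exists>w z. (c, w) \<in> I \<and> (\<exists>hs\<in>lists PH. ders hs w z) \<and>
    list_all2 (\<lambda>d x. (d, x) \<in> out) z x)" for c and x :: "'a list"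
  have finHc: "finite (Hc c)" for c using T(1) by (simp add: Hc_def)
  have out_mark: "Y = {} \<and> x = v" if "list_all2 (\<lambda>d x. (d, x) \<in> out) (mark c Y v) x" "v \<noteq> []" for c Y v x
  proof -
    have "Y = {} \<or> v = []" using that(1) by (cases v; cases x) (auto simp: out_def)
    moreover have "x = v" using that(1) by (induction v arbitrary: x) (auto simp: out_def list_all2_Cons1)
    ultimately show ?thesis using that(2) by blast
  qed
  have mark_out: "list_all2 (\<lambda>d x. (d, x) \<in> out) (mark c {} x) x" if "x \<in> lists \<Delta>" "c \<in> C" for c x
    using that by (induction x) (auto simp: out_def image_iff)
  have R_iff: "R c x \<longleftrightarrow> c \<in> A x" if x: "x \<in> lists \<Delta>" for c x
  proof
    assume "R c x"
    then obtain w z hs where w: "(c, w) \<in> I" "hs \<in> lists PH" "ders hs w z"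
      "list_all2 (\<lambda>d x. (d, x) \<in> out) z x" unfolding R_def by blast
    then consider "w = []" "c \<in> A []" | Y v where "c \<in> C" "part Y \<omega> v" "v \<noteq> []" "w = mark c Y v"
      unfolding I_def by auto
    then show "c \<in> A x"
    proof cases
      case 1
      then show ?thesis using w by simp
    next
      case 2
      obtain Y' v' where v': "v' \<noteq> []" "z = mark c Y' v'"
        "\<forall>\<alpha>. part Y \<alpha> v \<longrightarrow> (\<exists>hs'\<in>lists (Hc c). \<exists>\<alpha>'. ders hs' \<alpha> \<alpha>' \<and> part Y' \<alpha>' v')"
        using ptables_sound[where Hc = Hc, OF w(3)[unfolded 2(4)] w(2)[unfolded PH_def] 2(3)] by blast
      then have "Y' = {}" "x = v'" using out_mark w(4) by blast+
      moreover obtain hs' \<alpha>' where "hs' \<in> lists (Hc c)" "ders hs' \<omega> \<alpha>'" "part Y' \<alpha>' v'"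
        using v'(3) 2(2) by blast
      ultimately have "ders hs' \<omega> x" using part_empty by blast
      then show ?thesis using 2(1) \<open>hs' \<in> lists (Hc c)\<close> by (auto simp: A_def)
    qed
  next
    assume c: "c \<in> A x"
    show "R c x"
    proof (cases "x = []")
      case True
      have "(c, []) \<in> I" using c True by (simp add: I_def)
      moreover have "[] \<in> lists PH" "ders [] [] []" by simp_all
      ultimately show ?thesis unfolding R_def True by blast
    next
      case False
      obtain hs where hs: "c \<in> C" "hs \<in> lists (Hc c)" "ders hs \<omega> x" using c by (auto simp: A_def)
      obtain Y v hs' where "Y \<subseteq> \<Sigma>" "part Y \<omega> v" "v \<noteq> []" "hs' \<in> lists PH" "ders hs' (mark c Y v) (mark c {} x)"
        using ptables_complete[where Hc = Hc and c = c and C = C and \<Sigma> = \<Sigma>, OF hs(3,2) False hs(1)] Hc(1)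
        unfolding PH_def by blast
      moreover from this have "(c, mark c Y v) \<in> I" using hs(1) by (auto simp: I_def)
      ultimately show ?thesis using mark_out[OF x hs(1)] unfolding R_def by blast
    qed
  qed
  have "{(Max {c. R c x}, x) | x. x \<in> lists \<Delta> \<and> (\<exists>c. R c x)} \<in> FCSL"
    unfolding R_def
  proof (rule FCSL_propagating[where G = "\<Sigma> \<times> C \<times> Pow \<Sigma>"])
    show "finite (\<Sigma> \<times> C \<times> Pow \<Sigma>)" using \<Sigma>(1) C(1) by simp
    show "finite PH" unfolding PH_def using \<Sigma>(1) C(1) finHc Hc(2) by (rule ptables_finite(1))
    show "finite k" if "k \<in> PH" for k
      using \<Sigma>(1) C(1) finHc Hc(2) that[unfolded PH_def] by (rule ptables_finite(2))
    show "finite \<Delta>" using \<Delta> \<Sigma>(1) finite_subset by blast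
    then show "finite out" using C(1) by (simp add: out_def)
    show "snd ` out \<subseteq> \<Delta>" by (auto simp: out_def)
    show "u \<in> lists (\<Sigma> \<times> C \<times> Pow \<Sigma>) \<and> u \<noteq> []" if "k \<in> PH" "(r, b, u) \<in> k" for k r b u
      using that[unfolded PH_def] Hc(1) by (rule ptables_rhs)
    have "finite {v. part Y \<omega> v \<and> v \<noteq> []}" for Y
      by (rule finite_subset[OF _ finite_part[of Y \<omega>]]) auto
    moreover have "finite (A [])" using C(1) by (simp add: A_def)
    ultimately show "finite I" using C(1) \<Sigma>(1) by (simp add: I_def)
    show "w \<in> lists (\<Sigma> \<times> C \<times> Pow \<Sigma>) \<and> 0 \<le> c \<and> c \<le> 1" if "(c, w) \<in> I" for c w
    proof -
      have "c \<in> C" using that by (auto simp: I_def A_def)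
      moreover have "w = [] \<or> (\<exists>Y v. Y \<subseteq> \<Sigma> \<and> part Y \<omega> v \<and> w = mark c Y v)" using that by (auto simp: I_def)
      then have "w \<in> lists (\<Sigma> \<times> C \<times> Pow \<Sigma>)"
        using part_bounds \<Sigma>(3) \<open>c \<in> C\<close> by (fastforce simp: mark_def)
      ultimately show ?thesis using C(3) by blast
    qed
  qed
  moreover have "{(Max {c. R c x}, x) | x. x \<in> lists \<Delta> \<and> (\<exists>c. R c x)} =
      {(grade_T0L H \<omega> J f x, x) | x. x \<in> lists \<Delta> \<and> x \<in> language_T0L H \<omega>}"
    (is "?l = ?r")
  proof -
    have "?l = {(Max (A x), x) | x. x \<in> lists \<Delta> \<and> A x \<noteq> {}}"
      by (rule graded_set_eqI) (auto simp: R_iff simp del: in_lists_conv_set)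
    also have "\<dots> = ?r"
      unfolding lang[symmetric] by (intro Collect_cong) (metis grade)
    finally show ?thesis .
  qed
  moreover have "F = {(grade_T0L H \<omega> J f x, x) | x. x \<in> lists \<Delta> \<and> x \<in> language_T0L H \<omega>}"
    unfolding F fuzzy_language_ET0L_def by blast
  ultimately show "F \<in> FCSL" by simp
qed


section \<open>Length gaps of ET0L languages\<close>

lemma ET0L_length_gaps:
  fixes \<Sigma> :: "'a set" and H :: "('r, 'a) table set"
  assumes E: "fuzzy_ET0L \<Sigma> H \<omega> J f \<Delta>"
  defines "L \<equiv> {x \<in> lists \<Delta>. \<exists>hs\<in>lists H. ders hs \<omega> x}"
  shows "\<exists>C N0. \<forall>x\<in>L. \<forall>N\<ge>N0. N \<le> length x \<longrightarrow> (\<exists>y\<in>L. N \<le> length y \<and> length y \<le> C * N)"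
proof -
  have T: "finite H" "H \<noteq> {}" "\<And>h. h \<in> H \<Longrightarrow> fuzzy_0L \<Sigma> h \<omega> (fst ` h) f" and \<Delta>: "\<Delta> \<subseteq> \<Sigma>"
    using E unfolding fuzzy_ET0L_def fuzzy_T0L_def by blast+
  have \<Sigma>: "finite \<Sigma>" "\<omega> \<in> lists \<Sigma>" using T(2,3) unfolding fuzzy_0L_def by blast+
  have h: "finite h" "h \<subseteq> UNIV \<times> \<Sigma> \<times> lists \<Sigma>" if "h \<in> H" for h
    using T(3)[OF that] unfolding fuzzy_0L_def graded_labelling_def by blast+
  \<comment> \<open>Lengths do not require thresholds: all tables are kept, under the single dummy
    grade 0.\<close>
  define Hc where "Hc = (\<lambda>c :: real. H)"
  define PH where "PH = (\<Union>c\<in>{0}. ptables \<Sigma> c (Hc c))"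
  define G where "G = \<Sigma> \<times> {0 :: real} \<times> Pow \<Sigma>"
  define I where "I = (\<Union>Y\<in>Pow \<Sigma>. mark 0 Y ` {v. part Y \<omega> v \<and> v \<noteq> []})"
  define D where "D = (\<lambda>a. (a, 0 :: real, {} :: 'a set)) ` \<Delta>"
  define L' where "L' = {z \<in> lists D. \<exists>w\<in>I. \<exists>hs\<in>lists PH. ders hs w z}"
  have Hc: "finite (Hc c)" "h \<in> Hc c \<Longrightarrow> finite h" "h \<in> Hc c \<Longrightarrow> h \<subseteq> UNIV \<times> \<Sigma> \<times> lists \<Sigma>" for c h
    using T(1) h by (simp_all add: Hc_def)
  have gaps: "\<exists>C N0. \<forall>z\<in>L'. \<forall>N\<ge>N0. N \<le> length z \<longrightarrow> (\<exists>z'\<in>L'. N \<le> length z' \<and> length z' \<le> C * N)"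
    unfolding L'_def
  proof (rule propagating_length_gaps)
    show "finite G" using \<Sigma>(1) by (simp add: G_def)
    show "finite PH" unfolding PH_def using \<Sigma>(1) _ Hc(1,2) by (rule ptables_finite(1)) simp
    show "finite k" if "k \<in> PH" for k
      using \<Sigma>(1) _ Hc(1,2) that[unfolded PH_def] by (rule ptables_finite(2)) simp
    show "u \<in> lists G \<and> u \<noteq> []" if "k \<in> PH" "(r, b, u) \<in> k" for k r b u
      unfolding G_def using that[unfolded PH_def] Hc(3) by (rule ptables_rhs)
    have "finite {v. part Y \<omega> v \<and> v \<noteq> []}" for Y
      by (rule finite_subset[OF _ finite_part[of Y \<omega>]]) auto
    then show "finite I" using \<Sigma>(1) by (simp add: I_def)
    show "I \<subseteq> lists G"
      using part_bounds \<Sigma>(2) by (fastforce simp: I_def G_def mark_def)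
  qed
  have to: "mark 0 {} x \<in> L'" if x: "x \<in> L" "x \<noteq> []" for x
  proof -
    obtain hs where hs: "x \<in> lists \<Delta>" "hs \<in> lists (Hc 0)" "ders hs \<omega> x" using x by (auto simp: L_def Hc_def)
    obtain Y v hs' where "Y \<subseteq> \<Sigma>" "part Y \<omega> v" "v \<noteq> []" "hs' \<in> lists PH" "ders hs' (mark 0 Y v) (mark 0 {} x)"
      using ptables_complete[where Hc = Hc and c = 0 and C = "{0}" and \<Sigma> = \<Sigma>, OF hs(3,2) x(2)] Hc(3)
      unfolding PH_def by blast
    moreover have "mark 0 {} x \<in> lists D" using hs(1) by (auto simp: mark_def D_def)
    ultimately show ?thesis unfolding L'_def I_def by blast
  qed
  have from': "\<exists>x\<in>L. length x = length z" if z: "z \<in> L'" for z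
  proof -
    obtain Y v hs where v: "z \<in> lists D" "part Y \<omega> v" "v \<noteq> []" "hs \<in> lists PH" "ders hs (mark 0 Y v) z"
      using z unfolding L'_def I_def by blast
    obtain Y' v' where v': "v' \<noteq> []" "z = mark 0 Y' v'"
      "\<forall>\<alpha>. part Y \<alpha> v \<longrightarrow> (\<exists>hs'\<in>lists (Hc 0). \<exists>\<alpha>'. ders hs' \<alpha> \<alpha>' \<and> part Y' \<alpha>' v')"
      using ptables_sound[where Hc = Hc, OF v(5) v(4)[unfolded PH_def] v(3)] by blast
    have "Y' = {}" using v(1) v'(1,2) by (cases v') (auto simp: D_def)
    moreover obtain hs' \<alpha>' where hs': "hs' \<in> lists (Hc 0)" "ders hs' \<omega> \<alpha>'" "part Y' \<alpha>' v'"
      using v'(3) v(2) by blast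
    ultimately have "\<alpha>' = v'" using part_empty by blast
    moreover have "v' \<in> lists \<Delta>" using v(1) v'(2) by (auto simp: mark_def D_def)
    ultimately have "v' \<in> L" using hs' by (auto simp: L_def Hc_def)
    then show ?thesis using v'(2) by auto
  qed
  obtain C N0 where CN: "\<forall>z\<in>L'. \<forall>N\<ge>N0. N \<le> length z \<longrightarrow> (\<exists>z'\<in>L'. N \<le> length z' \<and> length z' \<le> C * N)"
    using gaps by blast
  \<comment> \<open>The bound \<open>max 1 N0\<close> excludes the empty word, which has no
    counterpart in \<open>L'\<close>.\<close>
  have "\<exists>y\<in>L. N \<le> length y \<and> length y \<le> C * N" if "x \<in> L" "max 1 N0 \<le> N" "N \<le> length x" for x N
  proof -
    have "mark 0 {} x \<in> L'" using that by (intro to) auto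
    moreover have "N0 \<le> N" "N \<le> length (mark 0 {} x)" using that by auto
    ultimately obtain z where "z \<in> L'" "N \<le> length z" "length z \<le> C * N" using CN by blast
    then show ?thesis using from' by metis
  qed
  then show ?thesis by blast
qed


section \<open>A context-sensitive language that is not ET0L\<close>

text \<open>The number of letters A at the beginning of round \<open>j\<close>. The 1 is subtracted
  because one letter of the preceding round becomes the new B.\<close>

primrec tower :: "nat \<Rightarrow> nat" where
  "tower 0 = 1"
| "tower (Suc j) = tower j + 2 ^ tower j - 1"

lemma tower_ge: "Suc j \<le> tower j"
proof (induction j)
  case (Suc j)
  have "Suc (tower j) \<le> 2 ^ tower j" by (simp add: Suc_leI)
  with Suc show ?case unfolding tower.simps by linarith
qed simp

lemma tower_length_mono: "i \<le> j \<Longrightarrow> tower i + 2 ^ tower i \<le> tower j + 2 ^ tower j"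
proof -
  assume "i \<le> j"
  have "tower n \<le> tower (Suc n)" for n
  proof -
    have "(1 :: nat) \<le> 2 ^ tower n" by simp
    then show ?thesis unfolding tower.simps by linarith
  qed
  then have "tower i \<le> tower j"
    using \<open>i \<le> j\<close> by (rule lift_Suc_mono_le)
  then show ?thesis by (intro add_mono power_increasing) auto
qed

lemma square_less_exp: "8 \<le> n \<Longrightarrow> n * Suc n < 2 ^ (n - 1)"
proof (induction n rule: dec_induct)
  case (step n)
  have "Suc n * Suc (Suc n) \<le> Suc n * (2 * n)" using step by (intro mult_le_mono2) simp
  then have "Suc n * Suc (Suc n) \<le> 2 * (n * Suc n)" by (simp add: mult_ac)
  also have "\<dots> < 2 * 2 ^ (n - 1)" using step by simp
  also have "\<dots> = 2 ^ n" using step by (metis Suc_diff_1 le_zero_eq not_gr_zero power_Suc zero_neq_numeral)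
  finally show ?case by simp
qed simp

text \<open>
  From \<open>C\<^sup>i A\<^sup>k B\<^sup>m\<close>, a sweep starting in state 0 leads to \<open>C\<^sup>i\<^sup>+\<^sup>1 A\<^sup>k\<^sup>-\<^sup>1 B\<^sup>2\<^sup>m\<close>, so that \<open>A\<^sup>n B\<close> becomes
  \<open>C\<^sup>n B\<^sup>N\<close> with \<open>N = 2\<^sup>n\<close>; a sweep starting in state 2 turns this word into \<open>A\<^sup>n\<^sup>+\<^sup>N\<^sup>-\<^sup>1 B\<close>. The letters
  \<open>A\<close>, \<open>B\<close>, \<open>C\<close> are the numbers 0, 3, 2.
\<close>

definition tower_rules :: "(nat \<times> nat \<times> nat \<times> nat list) set" where
  "tower_rules = {(0, 2, 0, [2]), (0, 0, 4, [2]), (4, 0, 4, [0]), (4, 3, 4, [3, 3]),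
     (2, 2, 2, [0]), (2, 3, 2, [0]), (2, 3, 3, [3])}"

definition tower_out :: "'a \<Rightarrow> (nat \<times> 'a) set" where
  "tower_out t = {(3, t), (2, t)}"

definition tower_word :: "nat \<Rightarrow> nat \<Rightarrow> nat \<Rightarrow> nat list" where
  "tower_word i k m = replicate i 2 @ replicate k 0 @ replicate m 3"

interpretation tower: transducer "{0, 2, 3, 4}" "{0, 2, 3}" tower_rules "{0, 2}" "{4, 3}"
    "tower_out (t :: 'a::infinite)" for t
  by unfold_locales (auto simp: tower_rules_def tower_out_def)

lemma tower_run_4:
  "tower.run 4 w x q \<longleftrightarrow>
     q = 4 \<and> set w \<subseteq> {0, 3} \<and> x = concat (map (\<lambda>a. if a = 3 then [3, 3] else [a]) w)"
proof
  assume "tower.run 4 w x q"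
  then show "q = 4 \<and> set w \<subseteq> {0, 3} \<and> x = concat (map (\<lambda>a. if a = 3 then [3, 3] else [a]) w)"
    by (induction "4 :: nat" w x q rule: tower.run.induct) (auto simp: tower_rules_def)
next
  assume "q = 4 \<and> set w \<subseteq> {0, 3} \<and> x = concat (map (\<lambda>a. if a = 3 then [3, 3] else [a]) w)"
  then show "tower.run 4 w x q"
  proof (induction w arbitrary: x)
    case (Cons a w)
    then have "tower.run 4 w (concat (map (\<lambda>a. if a = 3 then [3, 3] else [a]) w)) 4" by simp
    moreover have "(4, a, 4, if a = 3 then [3, 3] else [a]) \<in> tower_rules"
      using Cons.prems by (auto simp: tower_rules_def)
    ultimately show ?case using Cons.prems tower.run_Cons by simp
  qed (auto intro: tower.run_Nil)
qed

text \<open>State 3 has no transitions, which verifies the guess that the letter just read was the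
  last one.\<close>

lemma tower_run_3: "tower.run 3 w x q \<longleftrightarrow> q = 3 \<and> w = [] \<and> x = []"
  by (subst tower.run.simps) (auto simp: tower_rules_def)

lemma tower_run_word_4:
  "tower.run 4 (replicate k 0 @ replicate m 3) x q \<longleftrightarrow>
     q = 4 \<and> x = replicate k 0 @ replicate (2 * m) 3"
proof -
  have "concat (replicate k [0]) = replicate k (0::nat)" by (induction k) auto
  moreover have "concat (replicate m [3, 3]) = replicate (2 * m) (3::nat)" by (induction m) auto
  ultimately show ?thesis by (auto simp: tower_run_4)
qed

text \<open>State 0 cannot read B and is not final, so this kind of sweep requires a letter A to be
  turned into C.\<close>

lemma tower_run_0:
  "tower.run 0 (tower_word i k m) x 4 \<longleftrightarrow> (\<exists>k'. k = Suc k' \<and> x = tower_word (Suc i) k' (2 * m))"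
proof (induction i arbitrary: x)
  case 0
  show ?case
  proof (cases k)
    case 0
    then show ?thesis by (cases m) (subst tower.run.simps; auto simp: tower_rules_def tower_word_def)+
  next
    case (Suc k')
    then have "tower.run 0 (tower_word 0 k m) x 4 \<longleftrightarrow>
        (\<exists>y. x = 2 # y \<and> tower.run 4 (replicate k' 0 @ replicate m 3) y 4)"
      by (subst tower.run.simps) (auto simp: tower_rules_def tower_word_def)
    then show ?thesis using Suc by (simp add: tower_run_word_4 tower_word_def)
  qed
next
  case (Suc i)
  have "tower.run 0 (tower_word (Suc i) k m) x 4 \<longleftrightarrow> (\<exists>y. x = 2 # y \<and> tower.run 0 (tower_word i k m) y 4)"
    by (subst tower.run.simps) (auto simp: tower_rules_def tower_word_def)
  then show ?case using Suc by (auto simp: tower_word_def)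
qed

text \<open>State 2 cannot read A, so a new round begins only after all doublings of the current
  one.\<close>

lemma tower_run_2_sound:
  "tower.run 2 w x 3 \<Longrightarrow> 0 \<notin> set w \<and> w \<noteq> [] \<and> x = replicate (length w - 1) 0 @ [3]"
proof (induction "2 :: nat" w x "3 :: nat" rule: tower.run.induct)
  case (run_Cons a q v w x)
  then have "(a = 2 \<or> a = 3) \<and> (q = 2 \<and> v = [0] \<or> q = 3 \<and> v = [3])" by (auto simp: tower_rules_def)
  then show ?case using run_Cons by (cases w) (auto simp: tower_run_3)
qed simp_all

lemma tower_run_2_complete:
  assumes "set w \<subseteq> {2, 3}"
  shows "tower.run 2 (w @ [3]) (replicate (length w) 0 @ [3]) 3"
  using assms
proof (induction w)
  case Nil
  have "(2, 3, 3, [3]) \<in> tower_rules" by (simp add: tower_rules_def)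
  from tower.run_Cons[OF this tower.run_Nil] show ?case by simp
next
  case (Cons a w)
  have "(2, a, 2, [0]) \<in> tower_rules" using Cons.prems by (auto simp: tower_rules_def)
  from tower.run_Cons[OF this Cons.IH] Cons.prems show ?case by simp
qed

lemma tower_sweep:
  assumes "m > 0"
  shows "tower.sweep (tower_word i k m) x \<longleftrightarrow>
    (\<exists>k'. k = Suc k' \<and> x = tower_word (Suc i) k' (2 * m)) \<or> (k = 0 \<and> x = tower_word 0 (i + m - 1) 1)"
proof -
  \<comment> \<open>Transitions lead from 0 only to 0 and 4, and from 2 only to 2 and 3, so the
    initial state of a sweep determines its final state.\<close>
  have 0: "\<not> tower.run 0 (tower_word i k m) x 3"
  proof
    assume "tower.run 0 (tower_word i k m) x 3"
    moreover have "q' = 0 \<or> q' = 4" if "tower.run q w x q'" "q = 0 \<or> q = 4" for q w x q'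
      using that by (induction rule: tower.run.induct) (auto simp: tower_rules_def)
    ultimately show False by fastforce
  qed
  have 2: "\<not> tower.run 2 (tower_word i k m) x 4"
  proof
    assume "tower.run 2 (tower_word i k m) x 4"
    moreover have "q' = 2 \<or> q' = 3" if "tower.run q w x q'" "q = 2 \<or> q = 3" for q w x q'
      using that by (induction rule: tower.run.induct) (auto simp: tower_rules_def)
    ultimately show False by fastforce
  qed
  have 3: "tower.run 2 (tower_word i k m) x 3 \<longleftrightarrow> k = 0 \<and> x = tower_word 0 (i + m - 1) 1"
  proof
    assume "tower.run 2 (tower_word i k m) x 3"
    then have r: "0 \<notin> set (tower_word i k m)" "x = replicate (length (tower_word i k m) - 1) 0 @ [3]"
      using tower_run_2_sound by blast+
    then have "k = 0" by (auto simp: tower_word_def)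
    with r(2) show "k = 0 \<and> x = tower_word 0 (i + m - 1) 1" by (simp add: tower_word_def)
  next
    assume k: "k = 0 \<and> x = tower_word 0 (i + m - 1) 1"
    obtain m' where m': "m = Suc m'" using assms by (cases m) auto
    have "tower_word i k m = (replicate i 2 @ replicate m' 3) @ [3]"
      using k m' by (simp add: tower_word_def replicate_append_same)
    moreover have "tower.run 2 ((replicate i 2 @ replicate m' 3) @ [3])
        (replicate (length (replicate i 2 @ replicate m' 3 :: nat list)) 0 @ [3]) 3"
      by (intro tower_run_2_complete) auto
    ultimately show "tower.run 2 (tower_word i k m) x 3" using k m' by (simp add: tower_word_def)
  qed
  show ?thesis unfolding tower.sweep_def using 0 2 3 tower_run_0[of i k m x] by auto
qed

lemma tower_sweeps_sound:
  assumes "tower.sweep\<^sup>*\<^sup>* [0, 3] z"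
  shows "\<exists>j i k. i + k = tower j \<and> z = tower_word i k (2 ^ i)"
  using assms
proof (induction rule: rtranclp_induct)
  case base
  have "0 + 1 = tower 0 \<and> [0, 3] = tower_word 0 1 (2 ^ 0)" by (simp add: tower_word_def)
  then show ?case by blast
next
  case (step y z)
  then obtain j i k where y: "i + k = tower j" "y = tower_word i k (2 ^ i)" by blast
  then consider k' where "k = Suc k'" "z = tower_word (Suc i) k' (2 * 2 ^ i)"
    | "k = 0" "z = tower_word 0 (i + 2 ^ i - 1) 1"
    using step.hyps(2) tower_sweep[of "2 ^ i" i k z] by auto
  then show ?case
  proof cases
    case 1
    then have "Suc i + k' = tower j \<and> z = tower_word (Suc i) k' (2 ^ Suc i)" using y by simp
    then show ?thesis by blast
  next
    case 2
    then have "0 + (i + 2 ^ i - 1) = tower (Suc j) \<and> z = tower_word 0 (i + 2 ^ i - 1) (2 ^ 0)" using y by simp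
    then show ?thesis by blast
  qed
qed

lemma tower_sweeps_complete: "tower.sweep\<^sup>*\<^sup>* [0, 3] (tower_word (tower j) 0 (2 ^ tower j))"
proof -
  have shift: "tower.sweep\<^sup>*\<^sup>* (tower_word i k (2 ^ i)) (tower_word (i + k) 0 (2 ^ (i + k)))" for i k
  proof (induction k arbitrary: i)
    case (Suc k)
    have "tower.sweep (tower_word i (Suc k) (2 ^ i)) (tower_word (Suc i) k (2 ^ Suc i))"
      unfolding tower_sweep[OF zero_less_power[OF pos2]] by simp
    then show ?case using Suc[of "Suc i"] by (simp add: converse_rtranclp_into_rtranclp)
  qed simp
  show ?thesis
  proof (induction j)
    case 0
    have "[0, 3] = tower_word 0 1 (2 ^ 0)" by (simp add: tower_word_def)
    then show ?case using shift[of 0 1] by simp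
  next
    case (Suc j)
    have "tower.sweep (tower_word (tower j) 0 (2 ^ tower j)) (tower_word 0 (tower (Suc j)) (2 ^ 0))"
      unfolding tower_sweep[OF zero_less_power[OF pos2]] by simp
    then show ?case using Suc shift[of 0 "tower (Suc j)"]
      by (simp del: tower.simps)
  qed
qed

text \<open>The letter A has no output, so only words at the end of a round are translated.\<close>

lemma tower_outputs:
  "tower.outputs t (tower_word i k m) x \<longleftrightarrow> k = 0 \<and> x = replicate (i + m) t"
proof -
  have "tower.outputs t z x \<longleftrightarrow> set z \<subseteq> {2, 3} \<and> x = replicate (length z) t" for z
    unfolding tower.outputs_def
    by (induction z arbitrary: x) (auto simp: tower_out_def list_all2_Cons1)
  then show ?thesis by (auto simp: tower_word_def)
qed

lemma FCSL_not_FET0L: "\<exists>F :: 'a::infinite fuzzy_language. F \<in> FCSL \<and> F \<notin> FET0L"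
proof -
  define t :: 'a where "t = undefined"
  define F where "F = {(Max {c. \<exists>w z. (c, w) \<in> {(1 :: real, [0, 3])} \<and> tower.sweep\<^sup>*\<^sup>* w z \<and>
      tower.outputs t z x}, x) | x. x \<in> lists {t} \<and>
      (\<exists>c w z. (c, w) \<in> {(1 :: real, [0, 3])} \<and> tower.sweep\<^sup>*\<^sup>* w z \<and> tower.outputs t z x)}"
  have F: "F \<in> FCSL"
    unfolding F_def by (rule tower.FCSL_transducer) (auto simp: tower_out_def)
  have "snd ` F = {x \<in> lists {t}. \<exists>z. tower.sweep\<^sup>*\<^sup>* [0, 3] z \<and> tower.outputs t z x}"
    by (force simp: F_def)
  also have "\<dots> = range (\<lambda>j. replicate (tower j + 2 ^ tower j) t)"
  proof (intro equalityI subsetI)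
    fix x assume "x \<in> {x \<in> lists {t}. \<exists>z. tower.sweep\<^sup>*\<^sup>* [0, 3] z \<and> tower.outputs t z x}"
    then obtain z where "tower.sweep\<^sup>*\<^sup>* [0, 3] z" "tower.outputs t z x" by blast
    moreover from tower_sweeps_sound[OF this(1)] obtain j i k where
      "i + k = tower j" "z = tower_word i k (2 ^ i)" by blast
    ultimately have "x = replicate (tower j + 2 ^ tower j) t" by (simp add: tower_outputs)
    then show "x \<in> range (\<lambda>j. replicate (tower j + 2 ^ tower j) t)" by blast
  next
    fix x assume "x \<in> range (\<lambda>j. replicate (tower j + 2 ^ tower j) t)"
    then obtain j where j: "x = replicate (tower j + 2 ^ tower j) t" by blast
    then have "tower.outputs t (tower_word (tower j) 0 (2 ^ tower j)) x" by (simp add: tower_outputs)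
    moreover have "x \<in> lists {t}" using j by auto
    ultimately show "x \<in> {x \<in> lists {t}. \<exists>z. tower.sweep\<^sup>*\<^sup>* [0, 3] z \<and> tower.outputs t z x}"
      using tower_sweeps_complete by blast
  qed
  finally have snd: "snd ` F = range (\<lambda>j. replicate (tower j + 2 ^ tower j) t)" .
  have "F \<notin> FET0L"
  proof
    assume "F \<in> FET0L"
    then obtain \<Sigma> H \<omega> and J :: "nat set" and f \<Delta> where "F = fuzzy_language_ET0L H \<omega> J f \<Delta>"
      and E: "fuzzy_ET0L \<Sigma> H \<omega> J f \<Delta>" by (auto simp: FET0L_def)
    then have L: "{x \<in> lists \<Delta>. \<exists>hs\<in>lists H. ders hs \<omega> x} = range (\<lambda>j. replicate (tower j + 2 ^ tower j) t)"
      using snd by (simp add: snd_fuzzy_language_ET0L)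
    obtain C N0 where gap: "\<forall>x\<in>range (\<lambda>j. replicate (tower j + 2 ^ tower j) t). \<forall>N\<ge>N0. N \<le> length x \<longrightarrow>
        (\<exists>y\<in>range (\<lambda>j. replicate (tower j + 2 ^ tower j) t). N \<le> length y \<and> length y \<le> C * N)"
      using ET0L_length_gaps[OF E] unfolding L by blast
    \<comment> \<open>With \<open>n\<close> the length of word number \<open>j\<close>, the next
      word is longer than 2^(n - 1), which exceeds \<open>n * Suc n\<close> and hence
      \<open>C * Suc n\<close>. The summands of \<open>j\<close> make \<open>n\<close> large enough
      for \<open>N0\<close>, for \<open>C\<close> and for \<open>square_less_exp\<close>.\<close>
    define j where "j = N0 + C + 8"
    define n where "n = tower j + 2 ^ tower j"
    have j: "N0 + C + 8 < tower j" using tower_ge[of j] by (simp add: j_def)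
    have n: "N0 \<le> Suc n" "C \<le> n" "8 \<le> n" using j by (simp_all add: n_def)
    have Suc_j: "tower (Suc j) = n - 1" by (simp add: n_def)
    have "Suc n \<le> length (replicate (tower (Suc j) + 2 ^ tower (Suc j)) t)"
    proof -
      have "n - 1 < 2 ^ (n - 1)" by simp
      then show ?thesis unfolding length_replicate Suc_j using n(3) by linarith
    qed
    then obtain l where l: "Suc n \<le> tower l + 2 ^ tower l" "tower l + 2 ^ tower l \<le> C * Suc n"
      using gap n(1) by fastforce
    have "\<not> l \<le> j" using tower_length_mono[of l j] l(1) by (auto simp: n_def)
    then have "tower (Suc j) + 2 ^ tower (Suc j) \<le> tower l + 2 ^ tower l"
      by (intro tower_length_mono) simp
    also have "\<dots> \<le> C * Suc n" by (rule l(2))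
    also have "\<dots> \<le> n * Suc n" using n(2) by (rule mult_le_mono1)
    also have "\<dots> < 2 ^ (n - 1)" using n(3) by (rule square_less_exp)
    finally show False unfolding Suc_j by simp
  qed
  then show ?thesis using F by blast
qed


theorem theorem1:
  shows "(FCFL :: 'a::infinite fuzzy_language set) \<subset> FE0L \<and>
         (FE0L :: 'a fuzzy_language set) \<subset> FET0L \<and>
         (FET0L :: 'a fuzzy_language set) \<subset> FCSL"
  using FCFL_subset_FE0L FE0L_not_FCFL FE0L_subset_FET0L FET0L_not_FE0L
    FET0L_subset_FCSL FCSL_not_FET0L
  by (metis psubsetI)

end
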